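(* Under the assumptions on $f$, $Q$ and $X_0$ listed in the context, let $X_h^n=[U_h^n,V_h^n]^\top$, $n=0,1,\dots,N$, be the solution of the fully discrete scheme. Then it satisfies the trace formula $$\mathbb E[J(U_h^n,V_h^n)]=\mathbb E[J(U_h^0,V_h^0)]+\tfrac12\,\mathrm{Tr}(P_hQP_h)\,t_n .$$
   Context: Setting. Let $d\in\{1,2\}$, let $\mathcal D\subset\mathbb R^d$ be a bounded convex domain with polygonal boundary, $H=L^2(\mathcal D)$ with inner product $\langle\cdot,\cdot\rangle$ and norm $\|\cdot\|$, and $T>0$. Let $\Lambda=-\Delta$ with Dirichlet boundary conditions, $D(\Lambda)=H^2(\mathcal D)\cap H^1_0(\mathcal D)$; for $\alpha\in\mathbb R$ let $\dot H^\alpha=D(\Lambda^{\alpha/2})$ with norm $\|\Lambda^{\alpha/2}\cdot\|$ and $\mathbb H^\alpha=\dot H^\alpha\times\dot H^{\alpha-1}$ with the product Hilbert norm. $\mathcal L_2(H)$ denotes the Hilbert–Schmidt operators on $H$. $(\Omega,\mathcal F,\mathbb P,\{\mathcal F_t\})$ is a filtered probability space with normal filtration. Assumption on $f$. $f$ is a real cubic polynomial with primitive $F$ ($F'=f$), and there are positive constants $a_1,a_2,b_1,b_2$ with $a_1\|u\|_{L^4}^4-b_1\le\int_{\mathcal D}F(u)\,dx\le a_2\|u\|_{L^4}^4-b_2$ for all $u\in L^4(\mathcal D)$; moreover there is $c>0$ with $-\langle f(u)-f(v),u-v\rangle\le c\|u-v\|^2$ for all $u,v\in H$ (pairing understood as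 the integral over $\mathcal D$). Assumption on the noise. $W$ is an $H$-valued $Q$-Wiener process with respect to $\{\mathcal F_t\}$, $Q\in\mathcal L(H)$ self-adjoint, positive semi-definite, with $\|\Lambda^{\frac{\gamma-1}{2}}Q^{1/2}\|_{\mathcal L_2(H)}<\infty$ for some $\gamma\in[1,\infty)$ if $d=1$, $\gamma\in[1,3]$ if $d=2$. Assumption on the initial value. $X_0=[u_0,v_0]^\top$ is $\mathcal F_0$-measurable with $\mathbb E\|X_0\|_{\mathbb H^\gamma}^{p_0}<\infty$ for a sufficiently large $p_0\in\mathbb N$. Energy. $J(u,v)=\tfrac12\|\nabla u\|^2+\tfrac12\|v\|^2+\int_{\mathcal D}F(u)\,dx+C_1$, with a fixed constant $C_1\ge b_1$. Discrete space. $V_h\subset H_0^1(\mathcal D)$ is finite-dimensional; $\Lambda_h:V_h\to V_h$ is defined by $\langle\Lambda_hv_h,\chi_h\rangle=\langle\nabla v_h,\nabla\chi_h\rangle$ for $v_h,\chi_h\in V_h$; $P_h:\dot H^{-1}\to V_h$ is defined by $\langle P_hv,\chi_h\rangle=\langle v,\chi_h\rangle$ for all $\chi_h\in V_h$. Scheme. $N\in\mathbb N^+$, $\tau=T/N$, $t_n=n\tau$, $\delta W^n=W(t_{n+1})-W(t_n)$, $C_h(\tau)=\cos(\tau\Lambda_h^{1/2})$, $S_h(\tau)=\sin(\tau\Lambda_h^{1/2})$, $U_h^0=P_hu_0$, $V_h^0=P_hv_0$, and for $n=0,\dots,N-1$ the $V_h$-valued random variables satisfy $$U_h^{n+1}=C_h(\tau)U_h^n+\Lambda_h^{-1/2}S_h(\tau)V_h^n-\Lambda_h^{-1}(I-C_h(\tau))P_h\int_0^1f(U_h^n+\theta(U_h^{n+1}-U_h^n))\,d\theta,$$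 $$V_h^{n+1}=-\Lambda_h^{1/2}S_h(\tau)U_h^n+C_h(\tau)V_h^n-\Lambda_h^{-1/2}S_h(\tau)P_h\int_0^1f(U_h^n+\theta(U_h^{n+1}-U_h^n))\,d\theta+P_h\delta W^n,$$ with $U_h^{n+1}$ being $\mathcal F_{t_n}$-measurable. *)

theory Defs
  imports "HOL-Probability.Probability" "HOL-Computational_Algebra.Polynomial"
begin

definition l2_rel :: "('a::euclidean_space \<Rightarrow> real) \<Rightarrow> ('a \<Rightarrow> real) \<Rightarrow> bool" where
  "l2_rel f g \<longleftrightarrow>
     f \<in> borel_measurable lborel \<and> integrable lborel (\<lambda>x. (f x)\<^sup>2) \<and>
     g \<in> borel_measurable lborel \<and> integrable lborel (\<lambda>x. (g x)\<^sup>2) \<and>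
     (AE x in lborel. f x = g x)"

lemma part_equivp_l2_rel: "part_equivp (l2_rel :: ('a::euclidean_space \<Rightarrow> real) \<Rightarrow> _)"
proof (rule part_equivpI)
  show "\<exists>f. l2_rel f f"
    by (rule exI[of _ "\<lambda>_. 0"]) (simp add: l2_rel_def)
  show "symp l2_rel"
    by (auto simp: symp_def l2_rel_def eq_commute)
  show "transp (l2_rel :: ('a \<Rightarrow> real) \<Rightarrow> _)"
  proof (rule transpI)
    fix f g h :: "'a \<Rightarrow> real"
    assume fg: "l2_rel f g" and gh: "l2_rel g h"
    from fg have "AE x in lborel. f x = g x" by (simp add: l2_rel_def)
    moreover from gh have "AE x in lborel. g x = h x" by (simp add: l2_rel_def)
    ultimately have "AE x in lborel. f x = h x" by eventually_elim simp
    with fg gh show "l2_rel f h" by (simp add: l2_rel_def)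
  qed
qed

text \<open>The elements of \<open>'a l2\<close> are classes of Borel functions on all of \<open>'a\<close> modulo equality
  almost everywhere; \<open>rep_l2 u\<close> is an arbitrarily chosen representative, and \<open>abs_l2 f\<close> is
  meaningful only for square-integrable \<open>f\<close>.\<close>

quotient_type (overloaded) 'a l2 = "'a::euclidean_space \<Rightarrow> real" / partial: l2_rel
  by (rule part_equivp_l2_rel)

lemma integrable_mult_l2:
  fixes f g :: "'a::euclidean_space \<Rightarrow> real"
  assumes "f \<in> borel_measurable lborel" "integrable lborel (\<lambda>x. (f x)\<^sup>2)"
    and "g \<in> borel_measurable lborel" "integrable lborel (\<lambda>x. (g x)\<^sup>2)"
  shows "integrable lborel (\<lambda>x. f x * g x)"
proof (rule Bochner_Integration.integrable_bound)
  show "integrable lborel (\<lambda>x. (f x)\<^sup>2 + (g x)\<^sup>2)"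
    using assms by simp
  show "(\<lambda>x. f x * g x) \<in> borel_measurable lborel"
    using assms by simp
  have "\<bar>a * b\<bar> \<le> a\<^sup>2 + b\<^sup>2" for a b :: real
  proof -
    have "0 \<le> (\<bar>a\<bar> - \<bar>b\<bar>)\<^sup>2" by simp
    then have "2 * (\<bar>a\<bar> * \<bar>b\<bar>) \<le> a\<^sup>2 + b\<^sup>2"
      by (simp add: power2_diff algebra_simps)
    moreover have "0 \<le> \<bar>a\<bar> * \<bar>b\<bar>" by simp
    ultimately show ?thesis unfolding abs_mult by linarith
  qed
  then show "AE x in lborel. norm (f x * g x) \<le> norm ((f x)\<^sup>2 + (g x)\<^sup>2)"
    by simp
qed

lemma integrable_add_l2:
  fixes f g :: "'a::euclidean_space \<Rightarrow> real"
  assumes "f \<in> borel_measurable lborel" "integrable lborel (\<lambda>x. (f x)\<^sup>2)"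
    and "g \<in> borel_measurable lborel" "integrable lborel (\<lambda>x. (g x)\<^sup>2)"
  shows "integrable lborel (\<lambda>x. (f x + g x)\<^sup>2)"
proof -
  have "integrable lborel (\<lambda>x. (f x)\<^sup>2 + (g x)\<^sup>2 + 2 * (f x * g x))"
    using assms integrable_mult_l2[OF assms] by simp
  then show ?thesis by (simp add: power2_sum algebra_simps)
qed

lemma integrable_diff_l2:
  fixes f g :: "'a::euclidean_space \<Rightarrow> real"
  assumes "f \<in> borel_measurable lborel" "integrable lborel (\<lambda>x. (f x)\<^sup>2)"
    and "g \<in> borel_measurable lborel" "integrable lborel (\<lambda>x. (g x)\<^sup>2)"
  shows "integrable lborel (\<lambda>x. (f x - g x)\<^sup>2)"
  using integrable_add_l2[of f "\<lambda>x. - g x"] assms by simp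

instantiation l2 :: (euclidean_space) real_vector
begin

lift_definition zero_l2 :: "'a l2" is "\<lambda>_. 0"
  by (simp add: l2_rel_def)

lift_definition plus_l2 :: "'a l2 \<Rightarrow> 'a l2 \<Rightarrow> 'a l2" is "\<lambda>f g x. f x + g x"
  by (auto simp: l2_rel_def integrable_add_l2)

lift_definition minus_l2 :: "'a l2 \<Rightarrow> 'a l2 \<Rightarrow> 'a l2" is "\<lambda>f g x. f x - g x"
  by (auto simp: l2_rel_def integrable_diff_l2)

lift_definition uminus_l2 :: "'a l2 \<Rightarrow> 'a l2" is "\<lambda>f x. - f x"
  by (auto simp: l2_rel_def)

lift_definition scaleR_l2 :: "real \<Rightarrow> 'a l2 \<Rightarrow> 'a l2" is "\<lambda>c f x. c * f x"
  by (auto simp: l2_rel_def power_mult_distrib)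

instance
  by standard
    (transfer, auto simp: l2_rel_def algebra_simps power_mult_distrib
       integrable_add_l2 integrable_diff_l2)+

end

instantiation l2 :: (euclidean_space) real_inner
begin

lift_definition inner_l2 :: "'a l2 \<Rightarrow> 'a l2 \<Rightarrow> real" is "\<lambda>f g. LINT x|lborel. f x * g x"
proof -
  fix f f' g g' :: "'a \<Rightarrow> real"
  assume f: "l2_rel f f'" and g: "l2_rel g g'"
  have "AE x in lborel. f x = f' x" "AE x in lborel. g x = g' x"
    using f g by (auto simp: l2_rel_def)
  then have "AE x in lborel. f x * g x = f' x * g' x" by eventually_elim simp
  then show "(LINT x|lborel. f x * g x) = (LINT x|lborel. f' x * g' x)"
    using f g by (intro integral_cong_AE) (auto simp: l2_rel_def)
qed

definition "norm_l2 (u :: 'a l2) = sqrt (inner u u)"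
definition "dist_l2 (u :: 'a l2) v = norm (u - v)"
definition "sgn_l2 (u :: 'a l2) = u /\<^sub>R norm u"
definition "uniformity_l2 = (INF e\<in>{0<..}. principal {(x :: 'a l2, y). dist x y < e})"
definition "open_l2 (S :: 'a l2 set) =
  (\<forall>x\<in>S. \<forall>\<^sub>F (x', y) in uniformity. x' = x \<longrightarrow> y \<in> S)"

instance
proof
  fix u v w :: "'a l2" and c :: real
  show "inner u v = inner v u"
    by transfer (simp add: mult.commute)
  show "inner (u + v) w = inner u w + inner v w"
    by transfer (simp add: l2_rel_def distrib_right integrable_mult_l2)
  show "inner (c *\<^sub>R u) v = c * inner u v"
    by transfer (simp add: mult.assoc)
  show "0 \<le> inner u u"
    by transfer simp
  show "inner u u = 0 \<longleftrightarrow> u = 0"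
  proof transfer
    fix f :: "'a \<Rightarrow> real"
    assume "l2_rel f f"
    then show "(LINT x|lborel. f x * f x) = 0 \<longleftrightarrow> l2_rel f (\<lambda>_. 0)"
      using integral_nonneg_eq_0_iff_AE[of lborel "\<lambda>x. f x * f x"]
      by (auto simp: l2_rel_def power2_eq_square)
  qed
qed (simp_all add: norm_l2_def dist_l2_def sgn_l2_def uniformity_l2_def open_l2_def)

end

text \<open>\<open>L\<^sup>2(D)\<close> is identified, by extension by zero, with the closed subspace of those elements of
  \<open>L\<^sup>2\<close> of the whole space that vanish almost everywhere outside \<open>D\<close>.\<close>

definition L2_on :: "'a::euclidean_space set \<Rightarrow> 'a l2 set" where
  "L2_on D = {u. AE x in lborel. x \<notin> D \<longrightarrow> rep_l2 u x = 0}"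

text \<open>The boundary of a bounded convex open set is polygonal iff the closure is a polytope; in
  dimension one this is a bounded open interval.\<close>

definition convex_polygonal_domain :: "'a::euclidean_space set \<Rightarrow> bool" where
  "convex_polygonal_domain D \<longleftrightarrow>
     D \<noteq> {} \<and> open D \<and> bounded D \<and> convex D \<and> polytope (closure D)"

definition pderiv_at :: "'a::euclidean_space \<Rightarrow> ('a \<Rightarrow> real) \<Rightarrow> 'a \<Rightarrow> real" where
  "pderiv_at b \<phi> x = frechet_derivative \<phi> (at x) b"

primrec Ck :: "nat \<Rightarrow> ('a::euclidean_space \<Rightarrow> real) \<Rightarrow> bool" where
  "Ck 0 \<phi> \<longleftrightarrow> continuous_on UNIV \<phi>"
| "Ck (Suc k) \<phi> \<longleftrightarrow> \<phi> differentiable_on UNIV \<and> (\<forall>b\<in>Basis. Ck k (pderiv_at b \<phi>))"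

definition test_functions :: "'a::euclidean_space set \<Rightarrow> ('a \<Rightarrow> real) set" where
  "test_functions D = {\<phi>. (\<forall>k. Ck k \<phi>) \<and>
     compact (closure {x. \<phi> x \<noteq> 0}) \<and> closure {x. \<phi> x \<noteq> 0} \<subseteq> D}"

definition has_weak_partial :: "'a::euclidean_space set \<Rightarrow> 'a \<Rightarrow> 'a l2 \<Rightarrow> 'a l2 \<Rightarrow> bool" where
  "has_weak_partial D b u g \<longleftrightarrow> u \<in> L2_on D \<and> g \<in> L2_on D \<and>
     (\<forall>\<phi>\<in>test_functions D.
        (LINT x:D|lborel. rep_l2 u x * pderiv_at b \<phi> x) = - (LINT x:D|lborel. rep_l2 g x * \<phi> x))"

definition weak_partial :: "'a::euclidean_space set \<Rightarrow> 'a \<Rightarrow> 'a l2 \<Rightarrow> 'a l2" where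
  "weak_partial D b u = (THE g. has_weak_partial D b u g)"

definition H1 :: "'a::euclidean_space set \<Rightarrow> 'a l2 set" where
  "H1 D = {u \<in> L2_on D. \<forall>b\<in>Basis. \<exists>g. has_weak_partial D b u g}"

definition H2 :: "'a::euclidean_space set \<Rightarrow> 'a l2 set" where
  "H2 D = {u \<in> H1 D. \<forall>b\<in>Basis. weak_partial D b u \<in> H1 D}"

definition grad_inner :: "'a::euclidean_space set \<Rightarrow> 'a l2 \<Rightarrow> 'a l2 \<Rightarrow> real" where
  "grad_inner D u v = (\<Sum>b\<in>Basis. inner (weak_partial D b u) (weak_partial D b v))"

definition H1_norm :: "'a::euclidean_space set \<Rightarrow> 'a l2 \<Rightarrow> real" where
  "H1_norm D u = sqrt ((norm u)\<^sup>2 + grad_inner D u u)"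

definition H10 :: "'a::euclidean_space set \<Rightarrow> 'a l2 set" where
  "H10 D = {u \<in> H1 D. \<forall>\<epsilon>>0. \<exists>\<phi>\<in>test_functions D. H1_norm D (u - abs_l2 \<phi>) < \<epsilon>}"

text \<open>An operator on \<open>H\<close> is a function on the ambient type of which only the restriction to \<open>H\<close>
  matters.\<close>

definition bounded_op :: "'b::real_normed_vector set \<Rightarrow> ('b \<Rightarrow> 'b) \<Rightarrow> bool" where
  "bounded_op H A \<longleftrightarrow> A \<in> H \<rightarrow> H \<and>
     (\<forall>u\<in>H. \<forall>v\<in>H. A (u + v) = A u + A v) \<and>
     (\<forall>r. \<forall>u\<in>H. A (r *\<^sub>R u) = r *\<^sub>R A u) \<and>
     (\<exists>K. \<forall>u\<in>H. norm (A u) \<le> K * norm u)"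

definition psd_op :: "'b::real_inner set \<Rightarrow> ('b \<Rightarrow> 'b) \<Rightarrow> bool" where
  "psd_op H A \<longleftrightarrow> bounded_op H A \<and>
     (\<forall>u\<in>H. \<forall>v\<in>H. inner (A u) v = inner u (A v)) \<and> (\<forall>u\<in>H. 0 \<le> inner (A u) u)"

definition sqrt_op :: "'b::real_inner set \<Rightarrow> ('b \<Rightarrow> 'b) \<Rightarrow> 'b \<Rightarrow> 'b" where
  "sqrt_op H A = (SOME S. psd_op H S \<and> (\<forall>u\<in>H. S (S u) = A u))"

definition onb :: "'b::real_inner set \<Rightarrow> 'b set \<Rightarrow> bool" where
  "onb H B \<longleftrightarrow> B \<subseteq> H \<and> (\<forall>e\<in>B. norm e = 1) \<and> pairwise orthogonal B \<and> H \<subseteq> closure (span B)"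

definition hilbert_schmidt :: "'b::real_inner set \<Rightarrow> ('b \<Rightarrow> 'b) \<Rightarrow> bool" where
  "hilbert_schmidt H A \<longleftrightarrow> bounded_op H A \<and>
     (\<exists>B. onb H B \<and> (\<lambda>e. (norm (A e))\<^sup>2) summable_on B)"

text \<open>As for the Hilbert--Schmidt property, the choice of the orthonormal basis is immaterial.\<close>

definition trace_op :: "'b::real_inner set \<Rightarrow> ('b \<Rightarrow> 'b) \<Rightarrow> real" where
  "trace_op H A = (\<Sum>\<^sub>\<infinity>e\<in>(SOME B. onb H B). inner (A e) e)"

text \<open>Functional calculus for an operator \<open>A\<close> with domain \<open>Dom\<close> in \<open>H\<close> that is diagonalised by an
  orthonormal basis \<open>B\<close> of \<open>H\<close>, with eigenvalue \<open>lam e\<close> at \<open>e \<in> B\<close>: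
  \<open>g(A) u = (\<Sum>e\<in>B. g (lam e) \<langle>u, e\<rangle> e)\<close>, defined for those \<open>u\<close> for which the series
  converges. The value does not depend on \<open>B\<close>.\<close>

definition has_fun_of_op ::
    "'b::real_inner set \<Rightarrow> 'b set \<Rightarrow> ('b \<Rightarrow> 'b) \<Rightarrow> (real \<Rightarrow> real) \<Rightarrow> 'b \<Rightarrow> 'b \<Rightarrow> bool" where
  "has_fun_of_op H Dom A g u w \<longleftrightarrow> u \<in> H \<and> w \<in> H \<and>
     (\<exists>B lam. onb H B \<and> (\<forall>e\<in>B. e \<in> Dom \<and> A e = lam e *\<^sub>R e) \<and>
        ((\<lambda>e. (g (lam e) * inner u e) *\<^sub>R e) has_sum w) B)"

definition fun_of_op ::
    "'b::real_inner set \<Rightarrow> 'b set \<Rightarrow> ('b \<Rightarrow> 'b) \<Rightarrow> (real \<Rightarrow> real) \<Rightarrow> 'b \<Rightarrow> 'b" where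
  "fun_of_op H Dom A g u = (SOME w. has_fun_of_op H Dom A g u w)"

definition dom_Lambda :: "'a::euclidean_space set \<Rightarrow> 'a l2 set" where
  "dom_Lambda D = H2 D \<inter> H10 D"

definition Lambda :: "'a::euclidean_space set \<Rightarrow> 'a l2 \<Rightarrow> 'a l2" where
  "Lambda D u = - (\<Sum>b\<in>Basis. weak_partial D b (weak_partial D b u))"

definition Lambda_pow :: "'a::euclidean_space set \<Rightarrow> real \<Rightarrow> 'a l2 \<Rightarrow> 'a l2" where
  "Lambda_pow D s = fun_of_op (L2_on D) (dom_Lambda D) (Lambda D) (\<lambda>x. x powr s)"

definition dom_Lambda_pow :: "'a::euclidean_space set \<Rightarrow> real \<Rightarrow> 'a l2 set" where
  "dom_Lambda_pow D s =
     {u. \<exists>w. has_fun_of_op (L2_on D) (dom_Lambda D) (Lambda D) (\<lambda>x. x powr s) u w}"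

text \<open>The spaces \<open>D(\<Lambda>\<^bsup>\<alpha>/2\<^esup>)\<close>, to be used for \<open>\<alpha> \<ge> 0\<close> only: for \<open>\<alpha> < 0\<close> one
  would have to complete \<open>L\<^sup>2(D)\<close>.\<close>

definition Hdot :: "'a::euclidean_space set \<Rightarrow> real \<Rightarrow> 'a l2 set" where
  "Hdot D \<alpha> = dom_Lambda_pow D (\<alpha> / 2)"

definition Hdot_norm :: "'a::euclidean_space set \<Rightarrow> real \<Rightarrow> 'a l2 \<Rightarrow> real" where
  "Hdot_norm D \<alpha> u = norm (Lambda_pow D (\<alpha> / 2) u)"

definition HH_norm :: "'a::euclidean_space set \<Rightarrow> real \<Rightarrow> 'a l2 \<Rightarrow> 'a l2 \<Rightarrow> real" where
  "HH_norm D \<alpha> u v = sqrt ((Hdot_norm D \<alpha> u)\<^sup>2 + (Hdot_norm D (\<alpha> - 1) v)\<^sup>2)"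

definition normal_filtration :: "'w measure \<Rightarrow> real \<Rightarrow> (real \<Rightarrow> 'w measure) \<Rightarrow> bool" where
  "normal_filtration M T Fl \<longleftrightarrow>
     (\<forall>t\<in>{0..T}. subalgebra M (Fl t)) \<and>
     (\<forall>s t. 0 \<le> s \<and> s \<le> t \<and> t \<le> T \<longrightarrow> sets (Fl s) \<subseteq> sets (Fl t)) \<and>
     null_sets M \<subseteq> sets (Fl 0) \<and>
     (\<forall>t\<in>{0..<T}. sets (Fl t) = (\<Inter>s\<in>{t<..T}. sets (Fl s)))"

definition centered_gaussian :: "'w measure \<Rightarrow> ('w \<Rightarrow> real) \<Rightarrow> real \<Rightarrow> bool" where
  "centered_gaussian M X v \<longleftrightarrow> X \<in> borel_measurable M \<and>
     (if v = 0 then (AE \<omega> in M. X \<omega> = 0) else distributed M lborel X (normal_density 0 (sqrt v)))"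

text \<open>\<open>Q\<close>-Wiener process in \<open>H\<close> with respect to \<open>Fl\<close>. An \<open>H\<close>-valued random variable is
  \<open>N(0, R)\<close>-distributed iff its inner product with every \<open>h \<in> H\<close> is a centered real Gaussian variable
  of variance \<open>\<langle>R h, h\<rangle>\<close>. Independence of the increments from each other is a
  consequence of adaptedness and of their independence of the past.\<close>

definition Q_Wiener ::
    "'b::real_inner set \<Rightarrow> ('b \<Rightarrow> 'b) \<Rightarrow> 'w measure \<Rightarrow> real \<Rightarrow> (real \<Rightarrow> 'w measure) \<Rightarrow>
     (real \<Rightarrow> 'w \<Rightarrow> 'b) \<Rightarrow> bool" where
  "Q_Wiener H Q M T Fl W \<longleftrightarrow>
     (\<forall>t\<in>{0..T}. W t \<in> borel_measurable (Fl t) \<and> (\<forall>\<omega>\<in>space M. W t \<omega> \<in> H)) \<and>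
     (AE \<omega> in M. W 0 \<omega> = 0) \<and>
     (AE \<omega> in M. continuous_on {0..T} (\<lambda>t. W t \<omega>)) \<and>
     (\<forall>s t. 0 \<le> s \<and> s < t \<and> t \<le> T \<longrightarrow>
        prob_space.indep_set M (sets (Fl s))
          {(\<lambda>\<omega>. W t \<omega> - W s \<omega>) -` A \<inter> space M |A. A \<in> sets borel} \<and>
        (\<forall>h\<in>H. centered_gaussian M (\<lambda>\<omega>. inner (W t \<omega> - W s \<omega>) h) ((t - s) * inner (Q h) h)))"

definition noise_regularity :: "'a::euclidean_space set \<Rightarrow> ('a l2 \<Rightarrow> 'a l2) \<Rightarrow> real \<Rightarrow> bool" where
  "noise_regularity D Q \<gamma> \<longleftrightarrow>
     (\<forall>u\<in>L2_on D. sqrt_op (L2_on D) Q u \<in> dom_Lambda_pow D ((\<gamma> - 1) / 2)) \<and>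
     hilbert_schmidt (L2_on D) (\<lambda>u. Lambda_pow D ((\<gamma> - 1) / 2) (sqrt_op (L2_on D) Q u))"

definition initial_value ::
    "'a::euclidean_space set \<Rightarrow> 'w measure \<Rightarrow> 'w measure \<Rightarrow> real \<Rightarrow> nat \<Rightarrow>
     ('w \<Rightarrow> 'a l2) \<Rightarrow> ('w \<Rightarrow> 'a l2) \<Rightarrow> bool" where
  "initial_value D M F0 \<gamma> p u0 v0 \<longleftrightarrow>
     u0 \<in> borel_measurable F0 \<and> v0 \<in> borel_measurable F0 \<and>
     (AE \<omega> in M. u0 \<omega> \<in> Hdot D \<gamma> \<and> v0 \<omega> \<in> Hdot D (\<gamma> - 1)) \<and>
     integrable M (\<lambda>\<omega>. HH_norm D \<gamma> (u0 \<omega>) (v0 \<omega>) ^ p)"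

text \<open>In the last condition, constant functions \<open>u\<close> and \<open>v\<close> on \<open>D\<close> show that
  \<open>(f(x) - f(y)) (x - y) + c (x - y)\<^sup>2 \<ge> 0\<close> pointwise. Hence, whenever the integral is
  not finite, its value in the extended sense is \<open>+\<infinity>\<close>; the inequality is then true, as it
  is with the library's value \<open>0\<close>.\<close>

definition nonlinearity ::
    "'a::euclidean_space set \<Rightarrow> real poly \<Rightarrow> (real \<Rightarrow> real) \<Rightarrow>
     real \<Rightarrow> real \<Rightarrow> real \<Rightarrow> real \<Rightarrow> real \<Rightarrow> bool" where
  "nonlinearity D f F a1 a2 b1 b2 c \<longleftrightarrow>
     degree f = 3 \<and> (\<forall>x. (F has_real_derivative poly f x) (at x)) \<and>
     0 < a1 \<and> 0 < a2 \<and> 0 < b1 \<and> 0 < b2 \<and> 0 < c \<and>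
     (\<forall>u\<in>borel_measurable lborel. set_integrable lborel D (\<lambda>x. (u x) ^ 4) \<longrightarrow>
        a1 * (LINT x:D|lborel. (u x) ^ 4) - b1 \<le> (LINT x:D|lborel. F (u x)) \<and>
        (LINT x:D|lborel. F (u x)) \<le> a2 * (LINT x:D|lborel. (u x) ^ 4) - b2) \<and>
     (\<forall>u\<in>L2_on D. \<forall>v\<in>L2_on D.
        - (LINT x:D|lborel. (poly f (rep_l2 u x) - poly f (rep_l2 v x)) * (rep_l2 u x - rep_l2 v x))
        \<le> c * (norm (u - v))\<^sup>2)"

definition energy ::
    "'a::euclidean_space set \<Rightarrow> (real \<Rightarrow> real) \<Rightarrow> real \<Rightarrow> 'a l2 \<Rightarrow> 'a l2 \<Rightarrow> real" where
  "energy D F C1 u v =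
     grad_inner D u u / 2 + (norm v)\<^sup>2 / 2 + (LINT x:D|lborel. F (rep_l2 u x)) + C1"

definition discrete_space :: "'a::euclidean_space set \<Rightarrow> 'a l2 set \<Rightarrow> bool" where
  "discrete_space D Vh \<longleftrightarrow> Vh \<subseteq> H10 D \<and> (\<exists>B. finite B \<and> Vh = span B)"

definition Lambda_h :: "'a::euclidean_space set \<Rightarrow> 'a l2 set \<Rightarrow> 'a l2 \<Rightarrow> 'a l2" where
  "Lambda_h D Vh v = (THE w. w \<in> Vh \<and> (\<forall>z\<in>Vh. inner w z = grad_inner D v z))"

definition fun_Lambda_h ::
    "'a::euclidean_space set \<Rightarrow> 'a l2 set \<Rightarrow> (real \<Rightarrow> real) \<Rightarrow> 'a l2 \<Rightarrow> 'a l2" where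
  "fun_Lambda_h D Vh = fun_of_op Vh Vh (Lambda_h D Vh)"

definition Lambda_h_pow ::
    "'a::euclidean_space set \<Rightarrow> 'a l2 set \<Rightarrow> real \<Rightarrow> 'a l2 \<Rightarrow> 'a l2" where
  "Lambda_h_pow D Vh s = fun_Lambda_h D Vh (\<lambda>x. x powr s)"

definition C_h :: "'a::euclidean_space set \<Rightarrow> 'a l2 set \<Rightarrow> real \<Rightarrow> 'a l2 \<Rightarrow> 'a l2" where
  "C_h D Vh \<tau> = fun_Lambda_h D Vh (\<lambda>x. cos (\<tau> * sqrt x))"

definition S_h :: "'a::euclidean_space set \<Rightarrow> 'a l2 set \<Rightarrow> real \<Rightarrow> 'a l2 \<Rightarrow> 'a l2" where
  "S_h D Vh \<tau> = fun_Lambda_h D Vh (\<lambda>x. sin (\<tau> * sqrt x))"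

text \<open>The projection is defined on functionals on \<open>H\<^sup>1\<^sub>0(D)\<close>, so as to cover \<open>H\<^sup>-\<^sup>1\<close>;
  \<open>u \<in> L\<^sup>2(D)\<close> is identified with the functional \<open>inner u\<close>, and a function \<open>g\<close> on \<open>D\<close>
  with \<open>pairing D g\<close>.\<close>

definition P_h :: "'a::euclidean_space l2 set \<Rightarrow> ('a l2 \<Rightarrow> real) \<Rightarrow> 'a l2" where
  "P_h Vh l = (THE w. w \<in> Vh \<and> (\<forall>z\<in>Vh. inner w z = l z))"

definition pairing :: "'a::euclidean_space set \<Rightarrow> ('a \<Rightarrow> real) \<Rightarrow> 'a l2 \<Rightarrow> real" where
  "pairing D g z = (LINT x:D|lborel. g x * rep_l2 z x)"

text \<open>\<open>P\<^sub>h\<close> applied to the averaged nonlinearity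
  \<open>\<integral>\<^sub>0\<^sup>1 f(u + \<theta> (u' - u)) d\<theta>\<close>.\<close>

definition avf_term ::
    "'a::euclidean_space set \<Rightarrow> real poly \<Rightarrow> 'a l2 set \<Rightarrow> 'a l2 \<Rightarrow> 'a l2 \<Rightarrow> 'a l2" where
  "avf_term D f Vh u u' = P_h Vh (pairing D
     (\<lambda>x. LINT \<theta>:{0..1}|lborel. poly f (rep_l2 u x + \<theta> * (rep_l2 u' x - rep_l2 u x))))"

definition scheme_solution ::
    "'a::euclidean_space set \<Rightarrow> real poly \<Rightarrow> 'w measure \<Rightarrow> (real \<Rightarrow> 'w measure) \<Rightarrow>
     (real \<Rightarrow> 'w \<Rightarrow> 'a l2) \<Rightarrow> 'a l2 set \<Rightarrow> real \<Rightarrow> nat \<Rightarrow> ('w \<Rightarrow> 'a l2) \<Rightarrow> ('w \<Rightarrow> 'a l2) \<Rightarrow>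
     (nat \<Rightarrow> 'w \<Rightarrow> 'a l2) \<Rightarrow> (nat \<Rightarrow> 'w \<Rightarrow> 'a l2) \<Rightarrow> bool" where
  "scheme_solution D f M Fl W Vh \<tau> N u0 v0 U V \<longleftrightarrow>
     (\<forall>n\<le>N. U n \<in> borel_measurable M \<and> V n \<in> borel_measurable M \<and>
        (\<forall>\<omega>\<in>space M. U n \<omega> \<in> Vh \<and> V n \<omega> \<in> Vh)) \<and>
     (\<forall>n<N. U (Suc n) \<in> borel_measurable (Fl (real n * \<tau>))) \<and>
     (AE \<omega> in M. U 0 \<omega> = P_h Vh (inner (u0 \<omega>)) \<and> V 0 \<omega> = P_h Vh (inner (v0 \<omega>))) \<and>
     (\<forall>n<N. AE \<omega> in M.
        let G = avf_term D f Vh (U n \<omega>) (U (Suc n) \<omega>);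
            dW = W (real (Suc n) * \<tau>) \<omega> - W (real n * \<tau>) \<omega>
        in U (Suc n) \<omega> =
             C_h D Vh \<tau> (U n \<omega>) + Lambda_h_pow D Vh (- 1/2) (S_h D Vh \<tau> (V n \<omega>))
             - Lambda_h_pow D Vh (- 1) (G - C_h D Vh \<tau> G) \<and>
           V (Suc n) \<omega> =
             - Lambda_h_pow D Vh (1/2) (S_h D Vh \<tau> (U n \<omega>)) + C_h D Vh \<tau> (V n \<omega>)
             - Lambda_h_pow D Vh (- 1/2) (S_h D Vh \<tau> G) + P_h Vh (inner dW))"

end

theory Submission
  imports Defs
begin

text \<open>The scheme combines an exponential integrator for the linear part with the averaged vector field
  for the nonlinearity. Let \<open>U\<close> and \<open>U'\<close> be the old and the new first component and \<open>G\<close> the averaged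
  nonlinearity. In an eigenbasis of \<open>\<Lambda>\<^sub>h\<close> and for given \<open>G\<close>, every mode of the noise-free step is a
  rotation about a shifted equilibrium, so the quadratic part of the energy changes by
  \<open>- \<langle>G, U' - U\<rangle>\<close> (\<open>energy_conserved_mode\<close>, \<open>step_energy\<close>). Since \<open>G\<close> is the projected average of \<open>f\<close>
  over the segment from \<open>U\<close> to \<open>U'\<close>, this pairing is exactly the increment of the potential part
  (\<open>avf_term_chain_rule\<close>). Hence the noise-free step conserves the energy.

  The noise \<open>P\<^sub>h \<delta>W\<close> is then added to the second component. Writing \<open>w\<close> for the noise-free value of this
  component, the energy increases by \<open>\<langle>w, P\<^sub>h \<delta>W\<rangle> + \<parallel>P\<^sub>h \<delta>W\<parallel>\<^sup>2 / 2\<close>. Since \<open>U'\<close> is known at the old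
  time, so is \<open>w\<close>, and the cross term has mean zero by independence; the square has mean
  \<open>\<tau> Tr(P\<^sub>h Q P\<^sub>h)\<close> (\<open>noisy_step_energy\<close>, \<open>trace_eq_noise_trace\<close>). Induction over the steps gives the
  formula. Integrability propagates along with it: the potential is bounded below, so an integrable
  energy makes \<open>w\<close> square integrable. It starts from the moments of the initial value, which control
  its \<open>L\<^sup>2\<close> norms because \<open>\<Lambda>\<close> is bounded below (\<open>initial_energy_integrable\<close>).

  Four facts of analysis support this. Weak derivatives are unique (\<open>fundamental_lemma\<close>), so that the
  Dirichlet form is bilinear and can be diagonalised on the discrete space
  (\<open>ex_diagonalising_basis\<close>). In dimensions one and two, \<open>H\<^sup>1\<^sub>0\<close> is contained in \<open>L\<^sup>4\<close> (\<open>H10_L4\<close>), so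
  that the potential and the pairing with the cubic are finite. Poincare's inequality bounds \<open>\<Lambda>\<close> from
  below (\<open>Lambda_eigenvalue_lower_bound\<close>). Parseval's identity evaluates the trace in any orthonormal
  basis of \<open>L\<^sup>2(D)\<close> (\<open>trace_op_finite_rank\<close>) and shows that the functional calculus for \<open>\<Lambda>\<^sub>h\<close> has the
  same value in every eigenbasis (\<open>fun_of_op_finite\<close>).\<close>

section \<open>Representatives of square-integrable classes\<close>

lemma l2_rel_refl_iff:
  "l2_rel f f \<longleftrightarrow> f \<in> borel_measurable borel \<and> integrable lborel (\<lambda>x. (f x)\<^sup>2)"
  by (auto simp: l2_rel_def)

lemma l2_rel_rep: "l2_rel (rep_l2 u) (rep_l2 u)"
  by (rule Quotient3_rep_reflp[OF Quotient3_l2])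

lemma rep_l2_measurable [measurable]: "rep_l2 u \<in> borel_measurable borel"
  using l2_rel_rep[of u] by (simp add: l2_rel_refl_iff)

lemma integrable_rep_sq: "integrable lborel (\<lambda>x. (rep_l2 u x)\<^sup>2)"
  using l2_rel_rep[of u] by (simp add: l2_rel_refl_iff)

lemma rep_abs_l2:
  assumes "l2_rel f f"
  shows "AE x in lborel. rep_l2 (abs_l2 f) x = f x"
  using Quotient3_rep_abs[OF Quotient3_l2, OF assms] by (simp add: l2_rel_def)

lemma abs_rep_l2: "abs_l2 (rep_l2 u) = u"
  by (rule Quotient3_abs_rep[OF Quotient3_l2])

lemma abs_l2_eqI:
  assumes "l2_rel f f" "l2_rel g g" "AE x in lborel. f x = g x"
  shows "abs_l2 f = abs_l2 g"
  using assms by (intro Quotient3_rel_abs[OF Quotient3_l2]) (simp add: l2_rel_def)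

lemma l2_eqI:
  assumes "AE x in lborel. rep_l2 u x = rep_l2 v x"
  shows "u = v"
  using abs_l2_eqI[OF l2_rel_rep[of u] l2_rel_rep[of v] assms] by (simp add: abs_rep_l2)

lemma rep_plus_l2: "AE x in lborel. rep_l2 (u + v) x = rep_l2 u x + rep_l2 v x"
proof -
  have "u + v = abs_l2 (\<lambda>x. rep_l2 u x + rep_l2 v x)"
    using plus_l2.abs_eq[OF l2_rel_rep[of u] l2_rel_rep[of v]] by (simp add: abs_rep_l2)
  moreover have "l2_rel (\<lambda>x. rep_l2 u x + rep_l2 v x) (\<lambda>x. rep_l2 u x + rep_l2 v x)"
    by (auto simp: l2_rel_refl_iff intro!: integrable_add_l2 integrable_rep_sq)
  ultimately show ?thesis using rep_abs_l2 by metis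
qed

lemma rep_scaleR_l2: "AE x in lborel. rep_l2 (c *\<^sub>R u) x = c * rep_l2 u x"
proof -
  have "c *\<^sub>R u = abs_l2 (\<lambda>x. c * rep_l2 u x)"
    using scaleR_l2.abs_eq[OF l2_rel_rep[of u]] by (simp add: abs_rep_l2)
  moreover have "l2_rel (\<lambda>x. c * rep_l2 u x) (\<lambda>x. c * rep_l2 u x)"
    by (auto simp: l2_rel_refl_iff power_mult_distrib integrable_rep_sq)
  ultimately show ?thesis using rep_abs_l2 by metis
qed

lemma rep_zero_l2: "AE x in lborel. rep_l2 0 x = 0"
  using rep_scaleR_l2[of 0 0] by simp

lemma rep_diff_l2: "AE x in lborel. rep_l2 (u - v) x = rep_l2 u x - rep_l2 v x"
  using rep_plus_l2[of u "(-1) *\<^sub>R v"] rep_scaleR_l2[of "-1" v]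
  by eventually_elim simp

lemma rep_sum_l2:
  assumes "finite I"
  shows "AE x in lborel. rep_l2 (\<Sum>i\<in>I. u i) x = (\<Sum>i\<in>I. rep_l2 (u i) x)"
  using assms
proof (induction I)
  case empty
  then show ?case using rep_zero_l2 by simp
next
  case (insert i I)
  show ?case
    using insert.IH rep_plus_l2[of "u i" "\<Sum>i\<in>I. u i"] by eventually_elim (simp add: insert.hyps)
qed

lemma inner_l2_rep: "inner u v = (LINT x|lborel. rep_l2 u x * rep_l2 v x)"
  using inner_l2.abs_eq[OF l2_rel_rep[of u] l2_rel_rep[of v]] by (simp add: abs_rep_l2)

lemma norm_l2_rep: "(norm u)\<^sup>2 = (LINT x|lborel. (rep_l2 u x)\<^sup>2)"
  unfolding power2_norm_eq_inner inner_l2_rep by (simp add: power2_eq_square)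

lemma inner_abs_l2:
  assumes "l2_rel f f"
  shows "inner u (abs_l2 f) = (LINT x|lborel. rep_l2 u x * f x)"
  unfolding inner_l2_rep using rep_abs_l2[OF assms] assms
  by (intro integral_cong_AE) (auto simp: l2_rel_refl_iff)

lemma L2_on_iff: "u \<in> L2_on D \<longleftrightarrow> (AE x in lborel. x \<notin> D \<longrightarrow> rep_l2 u x = 0)"
  by (simp add: L2_on_def)

lemma subspace_L2_on: "subspace (L2_on D)"
proof (rule subspaceI)
  show "0 \<in> L2_on D" using rep_zero_l2 by (auto simp: L2_on_iff elim: eventually_mono)
next
  fix u v :: "'a l2" assume "u \<in> L2_on D" "v \<in> L2_on D"
  then show "u + v \<in> L2_on D"
    unfolding L2_on_iff using rep_plus_l2[of u v] by eventually_elim simp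
next
  fix c and u :: "'a l2" assume "u \<in> L2_on D"
  then show "c *\<^sub>R u \<in> L2_on D"
    unfolding L2_on_iff using rep_scaleR_l2[of c u] by eventually_elim simp
qed

lemma set_integral_L2_on:
  assumes "u \<in> L2_on D" "D \<in> sets borel" "g \<in> borel_measurable borel"
  shows "(LINT x:D|lborel. rep_l2 u x * g x) = (LINT x|lborel. rep_l2 u x * g x)"
proof -
  have "AE x in lborel. indicat_real D x *\<^sub>R (rep_l2 u x * g x) = rep_l2 u x * g x"
    using assms(1) unfolding L2_on_iff by eventually_elim (auto simp: indicator_def)
  then show ?thesis
    unfolding set_lebesgue_integral_def using assms by (intro integral_cong_AE) auto
qed

section \<open>Smooth functions of compact support\<close>

lemma pderiv_at_eq:
  assumes "(\<phi> has_derivative \<phi>') (at x)"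
  shows "pderiv_at b \<phi> x = \<phi>' b"
  using frechet_derivative_at[OF assms] by (simp add: pderiv_at_def)

lemma Ck_SucD: "Ck (Suc k) \<phi> \<Longrightarrow> Ck k \<phi>"
proof (induction k arbitrary: \<phi>)
  case 0
  then show ?case by (auto intro: differentiable_imp_continuous_on)
next
  case (Suc k)
  then show ?case by (metis Ck.simps(2))
qed

lemma Ck_has_derivative:
  assumes "Ck (Suc k) \<phi>"
  shows "(\<phi> has_derivative (\<lambda>h. pderiv_at h \<phi> x)) (at x)"
  using assms unfolding pderiv_at_def
  by (metis Ck.simps(2) UNIV_I differentiable_on_def frechet_derivative_works)

lemma Ck_line_derivative:
  fixes \<phi> :: "'a::euclidean_space \<Rightarrow> real"
  assumes "Ck (Suc k) \<phi>"
  shows "((\<lambda>t. \<phi> (y + t *\<^sub>R b)) has_real_derivative pderiv_at b \<phi> (y + t *\<^sub>R b)) (at t)"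
proof -
  have "((\<lambda>t. \<phi> (y + t *\<^sub>R b)) has_derivative (\<lambda>h. pderiv_at (h *\<^sub>R b) \<phi> (y + t *\<^sub>R b))) (at t)"
    by (rule has_derivative_compose[OF _ Ck_has_derivative[OF assms]]) (auto intro!: derivative_eq_intros)
  moreover have "pderiv_at (h *\<^sub>R b) \<phi> z = pderiv_at b \<phi> z * h" for h z
    using linear_scale[OF has_derivative_linear[OF Ck_has_derivative[OF assms, where x = z]], of h b] by simp
  ultimately show ?thesis by (simp add: has_field_derivative_def)
qed

lemma Ck_SucI:
  assumes "\<And>x. (\<phi> has_derivative \<phi>' x) (at x)" "\<And>b. b \<in> Basis \<Longrightarrow> Ck k (\<lambda>x. \<phi>' x b)"
  shows "Ck (Suc k) \<phi>"
proof -
  have "pderiv_at b \<phi> = (\<lambda>x. \<phi>' x b)" for b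
    using pderiv_at_eq[OF assms(1)] by auto
  then show ?thesis
    using assms by (auto simp: differentiable_on_def differentiable_def intro: has_derivative_at_withinI)
qed

lemma Ck_const: "Ck k (\<lambda>_. c)"
proof (induction k arbitrary: c)
  case (Suc k)
  show ?case by (rule Ck_SucI[where \<phi>' = "\<lambda>_ _. 0"]) (auto simp: Suc)
qed simp

lemma Ck_add: "Ck k \<phi> \<Longrightarrow> Ck k \<psi> \<Longrightarrow> Ck k (\<lambda>x. \<phi> x + \<psi> x)"
proof (induction k arbitrary: \<phi> \<psi>)
  case 0
  then show ?case by (auto intro: continuous_intros)
next
  case (Suc k)
  show ?case
    by (rule Ck_SucI[OF has_derivative_add[OF Ck_has_derivative[OF Suc.prems(1)]
          Ck_has_derivative[OF Suc.prems(2)]]])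
      (use Suc in auto)
qed

lemma Ck_mult: "Ck k \<phi> \<Longrightarrow> Ck k \<psi> \<Longrightarrow> Ck k (\<lambda>x. \<phi> x * \<psi> x)"
proof (induction k arbitrary: \<phi> \<psi>)
  case 0
  then show ?case by (auto intro: continuous_intros)
next
  case (Suc k)
  show ?case
    by (rule Ck_SucI[OF has_derivative_mult[OF Ck_has_derivative[OF Suc.prems(1)]
          Ck_has_derivative[OF Suc.prems(2)]]])
      (use Suc.prems in \<open>auto intro!: Ck_add Suc.IH dest: Ck_SucD simp del: Ck.simps,
         (auto intro: Suc.IH)[2]\<close>)
qed

lemma Ck_prod: "finite I \<Longrightarrow> (\<And>i. i \<in> I \<Longrightarrow> Ck k (\<phi> i)) \<Longrightarrow> Ck k (\<lambda>x. \<Prod>i\<in>I. \<phi> i x)"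
  by (induction I rule: finite_induct) (auto intro: Ck_const Ck_mult)

lemma Ck_inner: "Ck k (\<lambda>x. x \<bullet> b)"
proof (cases k)
  case (Suc j)
  show ?thesis unfolding Suc
    by (rule Ck_SucI[where \<phi>' = "\<lambda>_ h. h \<bullet> b"])
      (auto intro!: derivative_eq_intros Ck_const)
qed (auto intro!: continuous_intros)

text \<open>The functions \<open>t \<mapsto> p(1/t) e\<^sup>-\<^sup>1\<^sup>/\<^sup>t\<close>, extended by zero to \<open>t \<le> 0\<close>, are
  closed under differentiation; hence all of them are smooth.\<close>

definition flat_exp :: "real poly \<Rightarrow> real \<Rightarrow> real" where
  "flat_exp p t = (if t > 0 then poly p (1 / t) * exp (- (1 / t)) else 0)"

lemma poly_over_exp_tendsto_0: "((\<lambda>x. poly p x / exp x) \<longlongrightarrow> (0::real)) at_top"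
proof -
  have "((\<lambda>x. \<Sum>i\<le>degree p. coeff p i * (x ^ i / exp x)) \<longlongrightarrow> (\<Sum>i\<le>degree p. coeff p i * 0)) at_top"
    by (intro tendsto_intros tendsto_power_div_exp_0)
  then show ?thesis
    by (simp add: poly_altdef sum_divide_distrib)
qed

lemma flat_exp_has_derivative:
  "(flat_exp p has_real_derivative flat_exp ([:0, 0, 1:] * (p - pderiv p)) t) (at t)"
proof (rule linorder_cases[of t 0])
  assume t: "t > 0"
  have "((\<lambda>t. poly p (1 / t) * exp (- (1 / t))) has_real_derivative
      flat_exp ([:0, 0, 1:] * (p - pderiv p)) t) (at t)"
    using t by (auto intro!: derivative_eq_intros simp: flat_exp_def field_simps power2_eq_square)
  then show ?thesis
    by (rule has_field_derivative_transform_within_open[where S = "{0<..}"])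
      (use t in \<open>auto simp: flat_exp_def\<close>)
next
  assume t: "t < 0"
  have "((\<lambda>t. 0) has_real_derivative 0) (at t)" by simp
  then have "(flat_exp p has_real_derivative 0) (at t)"
    by (rule has_field_derivative_transform_within_open[where S = "{..<0}"])
      (use t in \<open>auto simp: flat_exp_def\<close>)
  then show ?thesis using t by (simp add: flat_exp_def)
next
  assume t: "t = 0"
  have lim: "((\<lambda>y. flat_exp p y / y) \<longlongrightarrow> 0) (at_right 0)"
  proof -
    have "((\<lambda>y. poly (pCons 0 p) (inverse y) / exp (inverse y)) \<longlongrightarrow> (0::real)) (at_right 0)"
      by (rule filterlim_compose[OF poly_over_exp_tendsto_0 filterlim_inverse_at_top_right])
    moreover have "\<forall>\<^sub>F y in at_right (0::real). poly (pCons 0 p) (inverse y) / exp (inverse y) = flat_exp p y / y"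
      using eventually_at_right_less[of 0]
      by eventually_elim (simp add: flat_exp_def exp_minus field_simps)
    ultimately show ?thesis by (rule Lim_transform_eventually)
  qed
  have "((\<lambda>y. flat_exp p y / y) \<longlongrightarrow> 0) (at_left 0)"
    by (rule Lim_transform_eventually[OF tendsto_const])
      (auto simp: flat_exp_def eventually_at_filter)
  with lim have "((\<lambda>y. flat_exp p y / y) \<longlongrightarrow> 0) (at 0)"
    by (simp add: filterlim_at_split)
  then show ?thesis
    unfolding t by (simp add: has_field_derivative_iff flat_exp_def)
qed

lemma Ck_flat_exp: "Ck k (\<lambda>x. flat_exp p (c * (x \<bullet> b) + d))"
proof (induction k arbitrary: p)
  case 0
  have "continuous_on UNIV (flat_exp p)"
    using flat_exp_has_derivative
    by (meson DERIV_isCont continuous_at_imp_continuous_on)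
  then show ?case
    by (auto intro!: continuous_intros continuous_on_compose2[where g = "flat_exp p" and t = UNIV])
next
  case (Suc k)
  have "((\<lambda>x. flat_exp p (c * (x \<bullet> b) + d)) has_derivative
      (\<lambda>h. (c * (h \<bullet> b)) * flat_exp ([:0, 0, 1:] * (p - pderiv p)) (c * (x \<bullet> b) + d))) (at x)" for x
    using flat_exp_has_derivative
    by (rule DERIV_compose_FDERIV) (auto intro!: derivative_eq_intros)
  then show ?case
    by (rule Ck_SucI) (intro Ck_mult Ck_const Suc)
qed

lemma flat_exp_1: "flat_exp 1 t \<in> {0..1}" "t \<le> 0 \<Longrightarrow> flat_exp 1 t = 0"
  by (auto simp: flat_exp_def)

lemma flat_exp_1_tendsto: "(flat_exp 1 \<longlongrightarrow> 1) at_top"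
proof -
  have "((\<lambda>t. exp (- (1 / t))) \<longlongrightarrow> exp (- (0::real))) at_top"
    by (intro tendsto_intros tendsto_divide_0[OF tendsto_const] filterlim_at_top_imp_at_infinity filterlim_ident)
  moreover have "\<forall>\<^sub>F t in at_top. exp (- (1 / t)) = flat_exp 1 t"
    using eventually_gt_at_top[of 0] by eventually_elim (simp add: flat_exp_def)
  ultimately show ?thesis by (simp add: Lim_transform_eventually)
qed

text \<open>Smooth approximations of the indicator function of \<open>box l u\<close>. The shift by one keeps the
  support at distance \<open>1 / n\<close> from the faces of the box, so that boxes touching the boundary of the
  domain are admitted as well.\<close>

definition box_bump :: "'a::euclidean_space \<Rightarrow> 'a \<Rightarrow> nat \<Rightarrow> 'a \<Rightarrow> real" where
  "box_bump l u n x = (\<Prod>b\<in>Basis. flat_exp 1 (real n * (x \<bullet> b) + (- real n * (l \<bullet> b) - 1))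
     * flat_exp 1 (- real n * (x \<bullet> b) + (real n * (u \<bullet> b) - 1)))"

lemma box_bump_bounds: "box_bump l u n x \<in> {0..1}"
  unfolding box_bump_def using flat_exp_1(1)
  by (auto intro!: prod_nonneg prod_le_1 mult_nonneg_nonneg mult_le_one)

lemma box_bump_nonzero:
  assumes "box_bump l u n x \<noteq> 0"
  shows "x \<in> cbox (l + (1 / n) *\<^sub>R One) (u - (1 / n) *\<^sub>R One)" "n > 0"
proof -
  have *: "real n * (x \<bullet> b) + (- real n * (l \<bullet> b) - 1) > 0"
      "- real n * (x \<bullet> b) + (real n * (u \<bullet> b) - 1) > 0" if "b \<in> Basis" for b
  proof -
    have "flat_exp 1 (real n * (x \<bullet> b) + (- real n * (l \<bullet> b) - 1)) \<noteq> 0"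
        "flat_exp 1 (- real n * (x \<bullet> b) + (real n * (u \<bullet> b) - 1)) \<noteq> 0"
      using assms that by (auto simp: box_bump_def)
    then show "real n * (x \<bullet> b) + (- real n * (l \<bullet> b) - 1) > 0"
        "- real n * (x \<bullet> b) + (real n * (u \<bullet> b) - 1) > 0"
      by (metis flat_exp_1(2) not_le)+
  qed
  obtain b0 :: 'a where "b0 \<in> Basis" using nonempty_Basis by blast
  from *(1)[OF this] show n: "n > 0" by (cases n) auto
  have "l \<bullet> b + 1 / n \<le> x \<bullet> b" "x \<bullet> b \<le> u \<bullet> b - 1 / n" if "b \<in> Basis" for b
    using *[OF that] n by (auto simp: field_simps)
  then show "x \<in> cbox (l + (1 / n) *\<^sub>R One) (u - (1 / n) *\<^sub>R One)"
    by (auto simp: mem_box inner_add_left inner_diff_left)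
qed

lemma cbox_shrink_subset_box:
  fixes l u :: "'a::euclidean_space"
  assumes "\<delta> > 0"
  shows "cbox (l + \<delta> *\<^sub>R One) (u - \<delta> *\<^sub>R One) \<subseteq> box l u"
proof
  fix x assume "x \<in> cbox (l + \<delta> *\<^sub>R One) (u - \<delta> *\<^sub>R One)"
  then have "l \<bullet> b + \<delta> \<le> x \<bullet> b \<and> x \<bullet> b \<le> u \<bullet> b - \<delta>" if "b \<in> Basis" for b
    using that by (auto simp: mem_box inner_add_left inner_diff_left)
  with assms have "l \<bullet> b < x \<bullet> b \<and> x \<bullet> b < u \<bullet> b" if "b \<in> Basis" for b
    using that by (smt (verit))
  then show "x \<in> box l u" by (auto simp: mem_box)
qed

lemma box_bump_outside: "x \<notin> box l u \<Longrightarrow> box_bump l u n x = 0"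
  using box_bump_nonzero[of l u n x] cbox_shrink_subset_box[of "1 / n" l u] by auto

lemma compact_closed_subset: "compact S \<Longrightarrow> closed T \<Longrightarrow> T \<subseteq> S \<Longrightarrow> compact T"
  by (metis closed_Int_compact inf.absorb_iff1)

lemma box_bump_test_function:
  assumes "box l u \<subseteq> D"
  shows "box_bump l u n \<in> test_functions D"
proof -
  let ?C = "cbox (l + (1 / n) *\<^sub>R One) (u - (1 / n) *\<^sub>R One)"
  let ?S = "{x. box_bump l u n x \<noteq> 0}"
  have sub: "closure ?S \<subseteq> ?C"
    using box_bump_nonzero(1) by (intro closure_minimal) (auto simp: closed_cbox)
  have "closure ?S \<subseteq> D"
  proof (cases "n = 0")
    case True
    then have "?S = {}" using box_bump_nonzero(2) by blast
    then show ?thesis by simp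
  next
    case False
    then have "?C \<subseteq> box l u" by (intro cbox_shrink_subset_box) simp
    with sub assms show ?thesis by blast
  qed
  moreover have "Ck k (box_bump l u n)" for k
    unfolding box_bump_def by (intro Ck_prod Ck_mult Ck_flat_exp finite_Basis)
  moreover have "compact (closure ?S)"
    using sub by (rule compact_closed_subset[OF compact_cbox closed_closure])
  ultimately show ?thesis by (simp add: test_functions_def)
qed

lemma box_bump_tendsto: "(\<lambda>n. box_bump l u n x) \<longlonglongrightarrow> indicator (box l u) x"
proof (cases "x \<in> box l u")
  case True
  have "(\<lambda>n. box_bump l u n x) \<longlonglongrightarrow> (\<Prod>b\<in>(Basis::'a set). 1 * 1)"
    unfolding box_bump_def
  proof (intro tendsto_prod tendsto_mult filterlim_compose[OF flat_exp_1_tendsto])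
    fix b :: 'a assume "b \<in> Basis"
    then have pos: "0 < x \<bullet> b - l \<bullet> b" "0 < u \<bullet> b - x \<bullet> b"
      using True by (auto simp: mem_box)
    have gen: "LIM n sequentially. r * real n + (- 1) :> at_top" if "r > 0" for r
      using filterlim_tendsto_add_at_top[OF tendsto_const
        filterlim_tendsto_pos_mult_at_top[OF tendsto_const that filterlim_real_sequentially], of "- 1"]
      by (simp add: add.commute)
    show "LIM n sequentially. real n * (x \<bullet> b) + (- real n * (l \<bullet> b) - 1) :> at_top"
      using gen[OF pos(1)] by (simp add: algebra_simps)
    show "LIM n sequentially. - real n * (x \<bullet> b) + (real n * (u \<bullet> b) - 1) :> at_top"
      using gen[OF pos(2)] by (simp add: algebra_simps)
  qed
  then show ?thesis using True by simp
next
  case False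
  then show ?thesis by (simp add: box_bump_outside)
qed

lemma test_functionsD:
  assumes "\<phi> \<in> test_functions D"
  shows "Ck k \<phi>" "continuous_on UNIV \<phi>" "\<phi> \<in> borel_measurable borel" "x \<notin> D \<Longrightarrow> \<phi> x = 0"
    "compact (closure {x. \<phi> x \<noteq> 0})" "closure {x. \<phi> x \<noteq> 0} \<subseteq> D"
proof -
  show ck: "Ck k \<phi>" for k using assms by (simp add: test_functions_def)
  show "continuous_on UNIV \<phi>" using ck[of 0] by simp
  then show "\<phi> \<in> borel_measurable borel" by (rule borel_measurable_continuous_onI)
  show *: "closure {x. \<phi> x \<noteq> 0} \<subseteq> D" using assms by (simp add: test_functions_def)
  show "x \<notin> D \<Longrightarrow> \<phi> x = 0" using * closure_subset[of "{x. \<phi> x \<noteq> 0}"] by auto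
  show "compact (closure {x. \<phi> x \<noteq> 0})" using assms by (simp add: test_functions_def)
qed

lemma pderiv_zero_outside:
  assumes "compact K" "\<And>x. x \<notin> K \<Longrightarrow> \<phi> x = (0::real)" "x \<notin> K"
  shows "pderiv_at b \<phi> x = 0"
proof -
  have "((\<lambda>_. 0) has_derivative (\<lambda>_. 0)) (at x)" by simp
  then have "(\<phi> has_derivative (\<lambda>_. 0)) (at x)"
    by (rule has_derivative_transform_within_open[where s = "- K"])
      (use assms compact_imp_closed in auto)
  then show ?thesis by (rule pderiv_at_eq)
qed

lemma test_function_pderiv:
  assumes "\<phi> \<in> test_functions D" "b \<in> Basis"
  shows "pderiv_at b \<phi> \<in> test_functions D"
proof -
  let ?S = "closure {x. \<phi> x \<noteq> 0}"
  have "\<phi> x = 0" if "x \<notin> ?S" for x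
    using that closure_subset[of "{x. \<phi> x \<noteq> 0}"] by auto
  then have "pderiv_at b \<phi> x = 0" if "x \<notin> ?S" for x
    using that by (rule pderiv_zero_outside[OF test_functionsD(5)[OF assms(1)]])
  then have sub: "closure {x. pderiv_at b \<phi> x \<noteq> 0} \<subseteq> ?S"
    by (intro closure_minimal) auto
  moreover have "compact (closure {x. pderiv_at b \<phi> x \<noteq> 0})"
    using sub by (rule compact_closed_subset[OF test_functionsD(5)[OF assms(1)] closed_closure])
  moreover have "Ck k (pderiv_at b \<phi>)" for k
    using test_functionsD(1)[OF assms(1), of "Suc k"] assms(2) by simp
  ultimately show ?thesis
    using test_functionsD(6)[OF assms(1)] unfolding test_functions_def by blast
qed

lemma compact_support_integrable:
  fixes \<phi> :: "'a::euclidean_space \<Rightarrow> real"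
  assumes "continuous_on UNIV \<phi>" "compact K" "\<And>x. x \<notin> K \<Longrightarrow> \<phi> x = 0"
  shows "integrable lborel \<phi>"
proof -
  have "integrable lborel (\<lambda>x. indicator K x *\<^sub>R \<phi> x)"
    by (rule borel_integrable_compact[OF assms(2) continuous_on_subset[OF assms(1)]]) simp
  moreover have "(\<lambda>x. indicator K x *\<^sub>R \<phi> x) = \<phi>"
    using assms(3) by (intro ext) (simp add: indicator_def, blast)
  ultimately show ?thesis by simp
qed

lemma test_function_l2:
  assumes "\<phi> \<in> test_functions D"
  shows "l2_rel \<phi> \<phi>"
proof -
  have "integrable lborel (\<lambda>x. (\<phi> x)\<^sup>2)"
    using test_functionsD[OF assms] closure_subset[of "{x. \<phi> x \<noteq> 0}"]
    by (intro compact_support_integrable[where K = "closure {x. \<phi> x \<noteq> 0}"])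
       (auto intro!: continuous_intros)
  then show ?thesis using test_functionsD[OF assms] by (simp add: l2_rel_refl_iff)
qed

lemma test_function_L2_on:
  assumes "\<phi> \<in> test_functions D"
  shows "abs_l2 \<phi> \<in> L2_on D"
  unfolding L2_on_iff using rep_abs_l2[OF test_function_l2[OF assms]]
  by eventually_elim (use test_functionsD(4)[OF assms] in auto)

text \<open>The indicator function of a box in \<open>D\<close> is a limit of test functions, so \<open>w\<close> integrates to zero
  over every such box. Boxes generate the Borel sets and countably many of them cover \<open>D\<close>.\<close>

lemma fundamental_lemma:
  assumes D: "open D" and w: "w \<in> L2_on D"
    and orth: "\<And>\<phi>. \<phi> \<in> test_functions D \<Longrightarrow> inner w (abs_l2 \<phi>) = 0"
  shows "w = 0"
proof -
  have int: "integrable lborel (\<lambda>x. indicator (box l u) x * rep_l2 w x)" for l u :: 'a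
  proof (rule integrable_mult_l2)
    have "(\<lambda>x. (indicator (box l u) x :: real)\<^sup>2) = indicator (box l u)" by (auto simp: indicator_def)
    then show "integrable lborel (\<lambda>x. (indicator (box l u) x :: real)\<^sup>2)"
      by (auto intro!: integrable_real_indicator emeasure_lborel_box_finite)
  qed (auto simp: integrable_rep_sq)
  have box0: "(LINT x|lborel. indicator (box l u) x * rep_l2 w x) = 0" if lu: "box l u \<subseteq> D" for l u
  proof -
    have meas: "box_bump l u n \<in> borel_measurable borel" for n
      using test_functionsD(3)[OF box_bump_test_function[OF lu]] .
    have "(\<lambda>n. LINT x|lborel. box_bump l u n x * rep_l2 w x) \<longlonglongrightarrow>
        (LINT x|lborel. indicator (box l u) x * rep_l2 w x)"
    proof (rule integral_dominated_convergence)
      show "integrable lborel (\<lambda>x. \<bar>indicator (box l u) x * rep_l2 w x\<bar>)"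
        using int by simp
      show "AE x in lborel. (\<lambda>n. box_bump l u n x * rep_l2 w x) \<longlonglongrightarrow> indicator (box l u) x * rep_l2 w x"
        by (intro AE_I2 tendsto_mult box_bump_tendsto tendsto_const)
      show "AE x in lborel. norm (box_bump l u n x * rep_l2 w x) \<le> \<bar>indicator (box l u) x * rep_l2 w x\<bar>" for n
      proof (rule AE_I2)
        fix x
        have "\<bar>box_bump l u n x\<bar> \<le> indicator (box l u) x"
          using box_bump_bounds[of l u n x] box_bump_outside[of x l u n]
          by (auto simp: indicator_def)
        then show "norm (box_bump l u n x * rep_l2 w x) \<le> \<bar>indicator (box l u) x * rep_l2 w x\<bar>"
          by (simp add: abs_mult mult_right_mono)
      qed
    qed (use meas in auto)
    moreover have "(LINT x|lborel. box_bump l u n x * rep_l2 w x) = 0" for n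
      using orth[OF box_bump_test_function[OF lu]]
        inner_abs_l2[OF test_function_l2[OF box_bump_test_function[OF lu]]]
      by (simp add: mult.commute)
    ultimately show ?thesis by (simp add: LIMSEQ_const_iff)
  qed
  have ae0: "AE x in lborel. x \<in> box l u \<longrightarrow> rep_l2 w x = 0" if lu: "box l u \<subseteq> D" for l u
  proof -
    let ?f = "\<lambda>x. indicator (box l u) x * rep_l2 w x"
    have sint: "set_integrable lborel A ?f" if "A \<in> sets borel" for A
      unfolding set_integrable_def using that int by (intro integrable_mult_indicator) auto
    have "set_lebesgue_integral lborel A ?f = 0" if "A \<in> sets lborel" for A
    proof -
      let ?E = "range (\<lambda>(a, b). box a b::'a set)"
      have "Int_stable ?E" by (auto simp: Int_stable_def box_Int_box)
      moreover have "?E \<subseteq> Pow UNIV" by simp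
      moreover have "A \<in> sigma_sets UNIV ?E" using that by (simp add: borel_eq_box)
      ultimately show ?thesis
      proof (induction rule: sigma_sets_induct_disjoint)
        case (basic A)
        then obtain a b where A: "A = box a b" by auto
        obtain l' u' where lu': "box a b \<inter> box l u = box l' u'"
          unfolding box_Int_box by blast
        have "set_lebesgue_integral lborel A ?f = (LINT x|lborel. indicator (box l' u') x * rep_l2 w x)"
          unfolding A lu'[symmetric] set_lebesgue_integral_def
          by (intro Bochner_Integration.integral_cong) (auto simp: indicator_def)
        also have "\<dots> = 0" using lu lu' by (intro box0) auto
        finally show ?case .
      next
        case empty
        then show ?case by (simp add: set_lebesgue_integral_def)
      next
        case (compl A)
        then have A: "A \<in> sets borel" by (simp add: borel_eq_box)
        have "set_lebesgue_integral lborel (A \<union> (UNIV - A)) ?f =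
            set_lebesgue_integral lborel A ?f + set_lebesgue_integral lborel (UNIV - A) ?f"
          using A by (intro set_integral_Un sint) auto
        then show ?case using compl box0[OF lu] by (simp add: set_lebesgue_integral_def)
      next
        case (union A)
        then have A: "A i \<in> sets lborel" for i by (auto simp: borel_eq_box)
        have "set_lebesgue_integral lborel (\<Union>i. A i) ?f = (\<Sum>i. set_lebesgue_integral lborel (A i) ?f)"
          using union(1) A by (intro lebesgue_integral_countable_add sint)
             (auto simp: disjoint_family_on_def)
        then show ?case using union by simp
      qed
    qed
    then have "AE x in lborel. ?f x = 0" by (intro sigma_finite_measure.density_zero[OF sigma_finite_lborel] int)
    then show ?thesis by eventually_elim (auto simp: indicator_def)
  qed
  obtain \<D> where \<D>: "countable \<D>" "\<D> \<subseteq> Pow D" "\<And>X. X \<in> \<D> \<Longrightarrow> \<exists>a b. X = box a b" "\<Union>\<D> = D"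
    using open_countable_Union_open_box[OF D] by metis
  have "AE x in lborel. \<forall>X\<in>\<D>. x \<in> X \<longrightarrow> rep_l2 w x = 0"
    unfolding AE_ball_countable[OF \<D>(1)]
  proof
    fix X assume X: "X \<in> \<D>"
    then obtain a b where "X = box a b" using \<D>(3) by blast
    then show "AE x in lborel. x \<in> X \<longrightarrow> rep_l2 w x = 0"
      using X \<D>(2) ae0[of a b] by auto
  qed
  then have "AE x in lborel. rep_l2 w x = rep_l2 0 x"
    using w[unfolded L2_on_iff] rep_zero_l2
    by eventually_elim (use \<D>(4) in auto)
  then show ?thesis by (rule l2_eqI)
qed

section \<open>Weak derivatives\<close>

lemma test_function_support:
  assumes "\<phi> \<in> test_functions D"
  shows "\<exists>K. compact K \<and> K \<subseteq> D \<and> (\<forall>x. x \<notin> K \<longrightarrow> \<phi> x = 0)"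
proof (intro exI conjI allI impI)
  show "compact (closure {x. \<phi> x \<noteq> 0})" "closure {x. \<phi> x \<noteq> 0} \<subseteq> D"
    by (rule test_functionsD[OF assms])+
  show "x \<notin> closure {x. \<phi> x \<noteq> 0} \<Longrightarrow> \<phi> x = 0" for x
    using closure_subset[of "{x. \<phi> x \<noteq> 0}"] by auto
qed

text \<open>The difference quotients of \<open>\<phi>\<close> integrate to zero because Lebesgue measure is translation
  invariant; they are uniformly bounded and supported in one ball, so the limit may be taken under
  the integral.\<close>

lemma integral_pderiv_zero:
  fixes \<phi> :: "'a::euclidean_space \<Rightarrow> real"
  assumes ck: "Ck (Suc 0) \<phi>" and K: "compact K" "\<And>x. x \<notin> K \<Longrightarrow> \<phi> x = 0" and b: "b \<in> Basis"
  shows "(LINT x|lborel. pderiv_at b \<phi> x) = 0"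
proof -
  let ?\<psi> = "pderiv_at b \<phi>"
  have cont: "continuous_on UNIV \<phi>" using Ck_SucD[OF ck] by simp
  have contd: "continuous_on UNIV ?\<psi>" using ck b by simp
  have int: "integrable lborel \<phi>" using cont K by (rule compact_support_integrable)
  have meas[measurable]: "\<phi> \<in> borel_measurable borel" "?\<psi> \<in> borel_measurable borel"
    using cont contd borel_measurable_continuous_onI by blast+
  have "bounded (?\<psi> ` K)"
    using contd K(1) by (meson compact_continuous_image compact_imp_bounded continuous_on_subset subset_UNIV)
  then obtain C where C: "C > 0" "\<And>x. x \<in> K \<Longrightarrow> \<bar>?\<psi> x\<bar> \<le> C"
    unfolding bounded_pos by auto
  have bound: "\<bar>?\<psi> x\<bar> \<le> C" for x
    using C pderiv_zero_outside[OF K, where x = x and b = b] by (cases "x \<in> K") auto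
  obtain R where R: "\<And>x. x \<in> K \<Longrightarrow> norm x \<le> R"
    using compact_imp_bounded[OF K(1)] unfolding bounded_iff by auto
  note line = Ck_line_derivative[OF ck, where b = b]
  define d where "d n x = real (Suc n) * (\<phi> (inverse (real (Suc n)) *\<^sub>R b + x) - \<phi> x)" for n x
  have dmeas: "d n \<in> borel_measurable borel" for n
    unfolding d_def by measurable
  have "(\<lambda>n. LINT x|lborel. d n x) \<longlonglongrightarrow> (LINT x|lborel. ?\<psi> x)"
  proof (rule integral_dominated_convergence)
    show "integrable lborel (\<lambda>x. C * indicator (cball 0 (R + 1)) x)"
      by (auto intro!: integrable_real_indicator emeasure_bounded_finite)
    show "AE x in lborel. (\<lambda>n. d n x) \<longlonglongrightarrow> ?\<psi> x"
    proof (rule AE_I2)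
      fix x
      have "(\<lambda>t. (\<phi> (x + t *\<^sub>R b) - \<phi> x) / t) \<midarrow>0\<rightarrow> ?\<psi> x"
        using line[of x 0] by (simp add: has_field_derivative_iff)
      moreover have "filterlim (\<lambda>n. inverse (real (Suc n))) (at 0) sequentially"
        using LIMSEQ_inverse_real_of_nat by (auto simp: filterlim_at)
      ultimately have "(\<lambda>n. (\<phi> (x + inverse (real (Suc n)) *\<^sub>R b) - \<phi> x) / inverse (real (Suc n)))
          \<longlonglongrightarrow> ?\<psi> x"
        by (rule filterlim_compose)
      then show "(\<lambda>n. d n x) \<longlonglongrightarrow> ?\<psi> x"
        by (simp add: d_def field_simps add.commute)
    qed
    show "AE x in lborel. norm (d n x) \<le> C * indicator (cball 0 (R + 1)) x" for n
    proof (rule AE_I2)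
      fix x
      let ?h = "inverse (real (Suc n))"
      have h: "?h > 0" "?h \<le> 1" by (auto simp: field_simps)
      obtain z where z: "\<phi> (x + ?h *\<^sub>R b) - \<phi> x = ?h * ?\<psi> (x + z *\<^sub>R b)"
        using MVT2[OF h(1), of "\<lambda>t. \<phi> (x + t *\<^sub>R b)" "\<lambda>t. ?\<psi> (x + t *\<^sub>R b)"] line by auto
      then have "d n x = ?\<psi> (x + z *\<^sub>R b)" using h by (simp add: d_def add.commute)
      then have le: "norm (d n x) \<le> C" using bound by simp
      show "norm (d n x) \<le> C * indicator (cball 0 (R + 1)) x"
      proof (cases "norm x \<le> R + 1")
        case True
        then show ?thesis using le by simp
      next
        case False
        have "norm x \<le> norm (?h *\<^sub>R b + x) + norm (?h *\<^sub>R b)"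
          by (metis add_diff_cancel_left' norm_triangle_sub add.commute norm_minus_commute)
        moreover have "norm (?h *\<^sub>R b) \<le> 1" using h b by simp
        ultimately have "norm (?h *\<^sub>R b + x) > R" using False by linarith
        then have "\<phi> (?h *\<^sub>R b + x) = 0" "\<phi> x = 0" using R K(2) False by fastforce+
        then show ?thesis using C by (simp add: d_def indicator_def)
      qed
    qed
  qed (use dmeas in auto)
  moreover have "(LINT x|lborel. d n x) = 0" for n
  proof -
    let ?c = "inverse (real (Suc n)) *\<^sub>R b"
    have "integrable lborel (\<lambda>x. \<phi> (?c + x))"
      using int integrable_distr_eq[of "(+) ?c" lborel borel \<phi>] lborel_distr_plus[of ?c] by simp
    moreover have "(LINT x|lborel. \<phi> (?c + x)) = (LINT x|lborel. \<phi> x)"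
      using integral_distr[of "(+) ?c" lborel borel \<phi>] lborel_distr_plus[of ?c] by simp
    ultimately show ?thesis unfolding d_def using int by simp
  qed
  ultimately show ?thesis by (simp add: LIMSEQ_const_iff)
qed

lemma pderiv_at_mult:
  assumes "Ck (Suc k) \<phi>" "Ck (Suc k) \<psi>"
  shows "pderiv_at b (\<lambda>x. \<phi> x * \<psi> x) x = \<phi> x * pderiv_at b \<psi> x + pderiv_at b \<phi> x * \<psi> x"
  using pderiv_at_eq[OF has_derivative_mult[OF Ck_has_derivative[OF assms(1)] Ck_has_derivative[OF assms(2)]]]
  by simp

lemma integration_by_parts:
  fixes \<phi> \<psi> :: "'a::euclidean_space \<Rightarrow> real"
  assumes \<phi>: "Ck (Suc 0) \<phi>" and \<psi>: "Ck (Suc 0) \<psi>"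
    and K: "compact K" "\<And>x. x \<notin> K \<Longrightarrow> \<phi> x = 0" and b: "b \<in> Basis"
  shows "(LINT x|lborel. \<phi> x * pderiv_at b \<psi> x) = - (LINT x|lborel. pderiv_at b \<phi> x * \<psi> x)"
proof -
  have cont: "continuous_on UNIV \<phi>" "continuous_on UNIV \<psi>"
      "continuous_on UNIV (pderiv_at b \<phi>)" "continuous_on UNIV (pderiv_at b \<psi>)"
    using Ck_SucD[OF \<phi>] Ck_SucD[OF \<psi>] \<phi> \<psi> b by auto
  have "integrable lborel (\<lambda>x. \<phi> x * pderiv_at b \<psi> x)"
    by (rule compact_support_integrable[OF _ K(1)]) (use cont K in \<open>auto intro!: continuous_intros\<close>)
  moreover have "integrable lborel (\<lambda>x. pderiv_at b \<phi> x * \<psi> x)"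
    by (rule compact_support_integrable[OF _ K(1)])
      (use cont pderiv_zero_outside[OF K] in \<open>auto intro!: continuous_intros\<close>)
  moreover have "(LINT x|lborel. \<phi> x * pderiv_at b \<psi> x + pderiv_at b \<phi> x * \<psi> x) = 0"
    using integral_pderiv_zero[OF Ck_mult[OF \<phi> \<psi>] K(1) _ b] K(2) pderiv_at_mult[OF \<phi> \<psi>] by simp
  ultimately show ?thesis by simp
qed

lemma has_weak_partial_iff:
  assumes "open D" "b \<in> Basis"
  shows "has_weak_partial D b u g \<longleftrightarrow> u \<in> L2_on D \<and> g \<in> L2_on D \<and>
    (\<forall>\<phi>\<in>test_functions D. inner u (abs_l2 (pderiv_at b \<phi>)) = - inner g (abs_l2 \<phi>))"
proof -
  have "(LINT x:D|lborel. rep_l2 u x * \<phi> x) = inner u (abs_l2 \<phi>)"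
    if "\<phi> \<in> test_functions D" "u \<in> L2_on D" for \<phi> u
    using that assms
    by (simp add: inner_abs_l2[OF test_function_l2] test_functionsD(3) set_integral_L2_on)
  then show ?thesis
    unfolding has_weak_partial_def using assms(2) by (auto simp: test_function_pderiv)
qed

text \<open>Uniqueness makes the definite description \<^const>\<open>weak_partial\<close> a linear operator, and hence
  \<^const>\<open>grad_inner\<close> a symmetric bilinear form on \<^const>\<open>H1\<close>.\<close>

lemma has_weak_partial_unique:
  assumes "open D" "b \<in> Basis" "has_weak_partial D b u g" "has_weak_partial D b u h"
  shows "g = h"
proof -
  have "g - h = 0"
  proof (rule fundamental_lemma[OF assms(1)])
    show "g - h \<in> L2_on D"
      using assms subspace_diff[OF subspace_L2_on] by (auto simp: has_weak_partial_iff)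
    show "inner (g - h) (abs_l2 \<phi>) = 0" if "\<phi> \<in> test_functions D" for \<phi>
      using that assms by (auto simp: has_weak_partial_iff inner_diff_left)
  qed
  then show ?thesis by simp
qed

lemma weak_partial_eq:
  assumes "open D" "b \<in> Basis" "has_weak_partial D b u g"
  shows "weak_partial D b u = g"
  unfolding weak_partial_def using has_weak_partial_unique[OF assms(1,2)] assms(3) by blast

lemma has_weak_partial_H1:
  assumes "open D" "b \<in> Basis" "u \<in> H1 D"
  shows "has_weak_partial D b u (weak_partial D b u)"
  using assms weak_partial_eq[OF assms(1,2)] unfolding H1_def by fastforce

lemma has_weak_partial_add:
  assumes "open D" "b \<in> Basis" "has_weak_partial D b u g" "has_weak_partial D b v h"
  shows "has_weak_partial D b (u + v) (g + h)"
  using assms by (auto simp: has_weak_partial_iff inner_add_left intro: subspace_add[OF subspace_L2_on])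

lemma has_weak_partial_scaleR:
  assumes "open D" "b \<in> Basis" "has_weak_partial D b u g"
  shows "has_weak_partial D b (c *\<^sub>R u) (c *\<^sub>R g)"
  using assms by (auto simp: has_weak_partial_iff intro: subspace_scale[OF subspace_L2_on])

lemma subspace_H1:
  assumes "open D"
  shows "subspace (H1 D)"
proof (rule subspaceI)
  have "has_weak_partial D b 0 0" if "b \<in> Basis" for b
    using assms that subspace_0[OF subspace_L2_on] by (simp add: has_weak_partial_iff)
  then show "0 \<in> H1 D" using subspace_0[OF subspace_L2_on] by (auto simp: H1_def)
next
  fix u v assume "u \<in> H1 D" "v \<in> H1 D"
  then show "u + v \<in> H1 D"
    unfolding H1_def using has_weak_partial_add[OF assms] subspace_add[OF subspace_L2_on] by blast
next
  fix u c assume "u \<in> H1 D"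
  then show "c *\<^sub>R u \<in> H1 D"
    unfolding H1_def using has_weak_partial_scaleR[OF assms] subspace_scale[OF subspace_L2_on] by blast
qed

lemma weak_partial_add:
  assumes "open D" "b \<in> Basis" "u \<in> H1 D" "v \<in> H1 D"
  shows "weak_partial D b (u + v) = weak_partial D b u + weak_partial D b v"
  by (intro weak_partial_eq has_weak_partial_add has_weak_partial_H1 assms)

lemma weak_partial_scaleR:
  assumes "open D" "b \<in> Basis" "u \<in> H1 D"
  shows "weak_partial D b (c *\<^sub>R u) = c *\<^sub>R weak_partial D b u"
  by (intro weak_partial_eq has_weak_partial_scaleR has_weak_partial_H1 assms)

lemma weak_partial_diff:
  assumes "open D" "b \<in> Basis" "u \<in> H1 D" "v \<in> H1 D"
  shows "weak_partial D b (u - v) = weak_partial D b u - weak_partial D b v"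
  using weak_partial_add[OF assms(1-3), of "(-1) *\<^sub>R v"] weak_partial_scaleR[OF assms(1,2,4), of "-1"]
    subspace_scale[OF subspace_H1[OF assms(1)] assms(4), of "-1"] by simp

lemma grad_inner_commute: "grad_inner D u v = grad_inner D v u"
  by (simp add: grad_inner_def inner_commute)

lemma grad_inner_add_left:
  assumes "open D" "u \<in> H1 D" "v \<in> H1 D"
  shows "grad_inner D (u + v) w = grad_inner D u w + grad_inner D v w"
  using assms by (simp add: grad_inner_def weak_partial_add inner_add_left sum.distrib)

lemma grad_inner_scaleR_left:
  assumes "open D" "u \<in> H1 D"
  shows "grad_inner D (c *\<^sub>R u) w = c * grad_inner D u w"
  using assms by (simp add: grad_inner_def weak_partial_scaleR sum_distrib_left)

lemma grad_inner_nonneg: "grad_inner D u u \<ge> 0"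
  unfolding grad_inner_def by (intro sum_nonneg) simp

lemma has_weak_partial_test_function:
  fixes D :: "'a::euclidean_space set"
  assumes "open D" "b \<in> Basis" "\<phi> \<in> test_functions D"
  shows "has_weak_partial D b (abs_l2 \<phi>) (abs_l2 (pderiv_at b \<phi>))"
proof -
  have "inner (abs_l2 \<phi>) (abs_l2 (pderiv_at b \<psi>)) = - inner (abs_l2 (pderiv_at b \<phi>)) (abs_l2 \<psi>)"
    if \<psi>: "\<psi> \<in> test_functions D" for \<psi>
  proof -
    have inner: "inner (abs_l2 \<alpha>) (abs_l2 \<beta>) = (LINT x|lborel. \<alpha> x * \<beta> x)"
      if "\<alpha> \<in> test_functions D" "\<beta> \<in> test_functions D" for \<alpha> \<beta> :: "'a \<Rightarrow> real"
      using inner_l2.abs_eq[OF test_function_l2 test_function_l2] that by blast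
    obtain K where "compact K" "K \<subseteq> D" "\<And>x. x \<notin> K \<Longrightarrow> \<phi> x = 0"
      using test_function_support[OF assms(3)] by auto
    then show ?thesis
      using integration_by_parts[OF test_functionsD(1)[OF assms(3)] test_functionsD(1)[OF \<psi>] _ _ assms(2)]
        assms that by (simp add: inner test_function_pderiv)
  qed
  then show ?thesis
    using assms by (simp add: has_weak_partial_iff test_function_L2_on test_function_pderiv)
qed

lemma test_function_H1:
  assumes "open D" "\<phi> \<in> test_functions D"
  shows "abs_l2 \<phi> \<in> H1 D"
  using has_weak_partial_test_function[OF assms(1) _ assms(2)] test_function_L2_on[OF assms(2)]
  by (auto simp: H1_def)

section \<open>The spaces \<open>H\<^sup>1\<^sub>0\<close> and \<open>D(\<Lambda>)\<close>\<close>

lemma H10_approximation: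
  fixes D :: "'a::euclidean_space set"
  assumes D: "open D" and u: "u \<in> H10 D"
  obtains \<phi> :: "nat \<Rightarrow> 'a \<Rightarrow> real" where "\<And>n. \<phi> n \<in> test_functions D" "(\<lambda>n. abs_l2 (\<phi> n)) \<longlonglongrightarrow> u"
    "\<And>b. b \<in> Basis \<Longrightarrow> (\<lambda>n. abs_l2 (pderiv_at b (\<phi> n))) \<longlonglongrightarrow> weak_partial D b u"
proof -
  have uH: "u \<in> H1 D" using u by (simp add: H10_def)
  have "\<exists>\<phi>\<in>test_functions D. H1_norm D (u - abs_l2 \<phi>) < inverse (real (Suc n))" for n
    using u by (auto simp: H10_def)
  then obtain \<phi> where \<phi>: "\<And>n. \<phi> n \<in> test_functions D"
    and less: "\<And>n. H1_norm D (u - abs_l2 (\<phi> n)) < inverse (real (Suc n))"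
    by metis
  have "norm (abs_l2 (\<phi> n) - u) \<le> H1_norm D (u - abs_l2 (\<phi> n))" for n
    unfolding H1_norm_def using grad_inner_nonneg
    by (subst norm_minus_commute, intro real_le_rsqrt) simp
  then have le1: "norm (abs_l2 (\<phi> n) - u) \<le> inverse (real (Suc n))" for n
    using less[of n] by (meson less_imp_le order_trans)
  have le2: "norm (abs_l2 (pderiv_at b (\<phi> n)) - weak_partial D b u) \<le> inverse (real (Suc n))"
    if b: "b \<in> Basis" for b n
  proof -
    let ?v = "u - abs_l2 (\<phi> n)"
    have "weak_partial D b ?v = weak_partial D b u - abs_l2 (pderiv_at b (\<phi> n))"
      using weak_partial_diff[OF D b uH test_function_H1[OF D \<phi>]]
        weak_partial_eq[OF D b has_weak_partial_test_function[OF D b \<phi>]] by simp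
    then have "(norm (abs_l2 (pderiv_at b (\<phi> n)) - weak_partial D b u))\<^sup>2
        = inner (weak_partial D b ?v) (weak_partial D b ?v)"
      by (simp add: power2_norm_eq_inner[symmetric] norm_minus_commute)
    also have "\<dots> \<le> grad_inner D ?v ?v"
      unfolding grad_inner_def by (rule member_le_sum[OF b]) auto
    finally have "norm (abs_l2 (pderiv_at b (\<phi> n)) - weak_partial D b u) \<le> H1_norm D ?v"
      unfolding H1_norm_def by (intro real_le_rsqrt) (simp add: add_increasing)
    then show ?thesis using less[of n] by simp
  qed
  have lim: "X \<longlonglongrightarrow> x" if "\<And>n. norm (X n - x) \<le> inverse (real (Suc n))" for X and x :: "'a l2"
    by (rule LIM_zero_cancel, rule Lim_null_comparison[OF _ LIMSEQ_inverse_real_of_nat])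
      (use that in auto)
  show thesis
    by (rule that[OF \<phi>]) (auto intro!: lim le1 le2)
qed

text \<open>Poincare's inequality: write \<open>\<phi>\<^sup>2\<close> as \<open>\<phi>\<^sup>2\<close> times the derivative of the coordinate \<open>x \<bullet> b\<close> and
  integrate by parts; the coordinate is bounded by \<open>R\<close> on \<open>D\<close>.\<close>

lemma poincare_test_function:
  fixes D :: "'a::euclidean_space set"
  assumes R: "D \<subseteq> cball 0 R" and \<phi>: "\<phi> \<in> test_functions D" and b: "b \<in> Basis"
  shows "norm (abs_l2 \<phi>) \<le> 2 * R * norm (abs_l2 (pderiv_at b \<phi>))"
proof -
  obtain K where K: "compact K" "K \<subseteq> D" "\<And>x. x \<notin> K \<Longrightarrow> \<phi> x = 0"
    using test_function_support[OF \<phi>] by auto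
  let ?d = "pderiv_at b \<phi>"
  have d: "?d \<in> test_functions D" using \<phi> b by (rule test_function_pderiv)
  have [measurable]: "\<phi> \<in> borel_measurable borel" "?d \<in> borel_measurable borel"
    using test_functionsD(3) \<phi> d by auto
  have int: "integrable lborel (\<lambda>x. (\<phi> x)\<^sup>2)" "integrable lborel (\<lambda>x. (?d x)\<^sup>2)"
    using test_function_l2[OF \<phi>] test_function_l2[OF d] by (auto simp: l2_rel_refl_iff)
  let ?g = "\<lambda>x. (x \<bullet> b) * ?d x"
  have g_le: "(?g x)\<^sup>2 \<le> R\<^sup>2 * (?d x)\<^sup>2" for x
  proof (cases "x \<in> D")
    case True
    then have "\<bar>x \<bullet> b\<bar> \<le> R" using R b Basis_le_norm[OF b, of x] by force
    then have "(x \<bullet> b)\<^sup>2 \<le> R\<^sup>2" by (simp add: abs_le_square_iff[symmetric] power2_le_iff_abs_le)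
    then show ?thesis by (simp add: power_mult_distrib mult_right_mono)
  qed (simp add: test_functionsD(4)[OF d])
  have gi: "integrable lborel (\<lambda>x. (?g x)\<^sup>2)"
    by (rule Bochner_Integration.integrable_bound[where f = "\<lambda>x. R\<^sup>2 * (?d x)\<^sup>2"]) (use int g_le in auto)
  then have g: "l2_rel ?g ?g" by (simp add: l2_rel_refl_iff)
  have sq: "(norm (abs_l2 f))\<^sup>2 = (LINT x|lborel. (f x)\<^sup>2)" if "l2_rel f f" for f :: "'a \<Rightarrow> real"
    using inner_l2.abs_eq[OF that that] unfolding power2_norm_eq_inner by (simp add: power2_eq_square)
  have "(norm (abs_l2 ?g))\<^sup>2 \<le> (R * norm (abs_l2 ?d))\<^sup>2"
    unfolding sq[OF g] power_mult_distrib[of R] sq[OF test_function_l2[OF d]]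
    using integral_mono[OF gi _ g_le] int by simp
  then have g_norm: "norm (abs_l2 ?g) \<le> R * norm (abs_l2 ?d)" if "D \<noteq> {}"
  proof (rule power2_le_imp_le)
    from that obtain x where "x \<in> D" by auto
    then have "norm x \<le> R" using R by auto
    then have "R \<ge> 0" by (rule order_trans[OF norm_ge_zero])
    then show "0 \<le> R * norm (abs_l2 ?d)" by simp
  qed
  have pd: "pderiv_at b (\<lambda>x. x \<bullet> b) x = 1" for x
    using b by (subst pderiv_at_eq[where \<phi>' = "\<lambda>h. h \<bullet> b"]) (auto intro!: derivative_eq_intros)
  have "(norm (abs_l2 \<phi>))\<^sup>2 = (LINT x|lborel. (\<phi> x * \<phi> x) * pderiv_at b (\<lambda>x. x \<bullet> b) x)"
    using sq[OF test_function_l2[OF \<phi>]] by (simp add: pd power2_eq_square)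
  also have "\<dots> = - (LINT x|lborel. pderiv_at b (\<lambda>x. \<phi> x * \<phi> x) x * (x \<bullet> b))"
    by (rule integration_by_parts[OF Ck_mult[OF test_functionsD(1,1)[OF \<phi> ]] Ck_inner K(1) _ b])
      (use K(3) \<phi> test_functionsD(1) in auto)
  also have "\<dots> = - (LINT x|lborel. 2 * (\<phi> x * ?g x))"
    using pderiv_at_mult[OF test_functionsD(1)[OF \<phi>, of "Suc 0"] test_functionsD(1)[OF \<phi>, of "Suc 0"], of b]
    by (simp add: algebra_simps)
  also have "\<dots> = - 2 * inner (abs_l2 \<phi>) (abs_l2 ?g)"
    using inner_l2.abs_eq[OF test_function_l2[OF \<phi>] g] by simp
  also have "\<dots> \<le> 2 * (norm (abs_l2 \<phi>) * norm (abs_l2 ?g))"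
    using Cauchy_Schwarz_ineq2[of "abs_l2 \<phi>" "abs_l2 ?g"] by simp
  finally have main: "(norm (abs_l2 \<phi>))\<^sup>2 \<le> 2 * (norm (abs_l2 \<phi>) * norm (abs_l2 ?g))" .
  show ?thesis
  proof (cases "D = {}")
    case True
    then have "\<phi> = (\<lambda>_. 0)" "?d = (\<lambda>_. 0)" using test_functionsD(4)[OF \<phi>] test_functionsD(4)[OF d] by auto
    then show ?thesis by (simp add: zero_l2_def[symmetric])
  next
    case False
    have "norm (abs_l2 \<phi>) * norm (abs_l2 \<phi>) \<le> norm (abs_l2 \<phi>) * (2 * norm (abs_l2 ?g))"
      using main by (simp add: power2_eq_square algebra_simps)
    then have "norm (abs_l2 \<phi>) \<le> 2 * norm (abs_l2 ?g)"
      using mult_le_cancel_left_pos[of "norm (abs_l2 \<phi>)" "norm (abs_l2 \<phi>)" "2 * norm (abs_l2 ?g)"]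
      by (cases "norm (abs_l2 \<phi>) = 0") simp_all
    then show ?thesis using g_norm[OF False] by simp
  qed
qed

lemma poincare_H10:
  assumes "open D" "D \<subseteq> cball 0 R" "u \<in> H10 D" "b \<in> Basis"
  shows "norm u \<le> 2 * R * norm (weak_partial D b u)"
proof -
  obtain \<phi> where \<phi>: "\<And>n. \<phi> n \<in> test_functions D" "(\<lambda>n. abs_l2 (\<phi> n)) \<longlonglongrightarrow> u"
    "\<And>b. b \<in> Basis \<Longrightarrow> (\<lambda>n. abs_l2 (pderiv_at b (\<phi> n))) \<longlonglongrightarrow> weak_partial D b u"
    using H10_approximation[OF assms(1,3)] by metis
  show ?thesis
    by (rule LIMSEQ_le[OF tendsto_norm[OF \<phi>(2)] tendsto_mult[OF tendsto_const tendsto_norm[OF \<phi>(3)[OF assms(4)]]]])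
      (auto intro!: poincare_test_function[OF assms(2) \<phi>(1) assms(4)])
qed

text \<open>Green's formula. Tested with \<open>\<phi>\<close> instead of the second factor \<open>u\<close> it is the definition of the
  weak derivatives of the first derivatives of \<open>u\<close>; both sides are continuous in the \<open>H\<^sup>1\<close> norm, in
  which test functions approximate \<open>u\<close>.\<close>

lemma Lambda_inner_self:
  assumes D: "open D" and u: "u \<in> dom_Lambda D"
  shows "inner (Lambda D u) u = grad_inner D u u"
proof -
  have uH: "u \<in> H10 D" and H2: "u \<in> H1 D" "\<And>b. b \<in> Basis \<Longrightarrow> weak_partial D b u \<in> H1 D"
    using u by (auto simp: dom_Lambda_def H2_def)
  obtain \<phi> where \<phi>: "\<And>n. \<phi> n \<in> test_functions D" "(\<lambda>n. abs_l2 (\<phi> n)) \<longlonglongrightarrow> u"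
    "\<And>b. b \<in> Basis \<Longrightarrow> (\<lambda>n. abs_l2 (pderiv_at b (\<phi> n))) \<longlonglongrightarrow> weak_partial D b u"
    using H10_approximation[OF D uH] by metis
  have "inner (weak_partial D b (weak_partial D b u)) u = - inner (weak_partial D b u) (weak_partial D b u)"
    if b: "b \<in> Basis" for b
  proof -
    have "inner (weak_partial D b u) (abs_l2 (pderiv_at b (\<phi> n)))
        = - inner (weak_partial D b (weak_partial D b u)) (abs_l2 (\<phi> n))" for n
      using has_weak_partial_H1[OF D b H2(2)[OF b]] \<phi>(1) by (simp add: has_weak_partial_iff[OF D b])
    then have "(\<lambda>n. - inner (weak_partial D b (weak_partial D b u)) (abs_l2 (\<phi> n)))
        \<longlonglongrightarrow> inner (weak_partial D b u) (weak_partial D b u)"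
      using tendsto_inner[OF tendsto_const \<phi>(3)[OF b], of "weak_partial D b u"] by simp
    moreover have "(\<lambda>n. - inner (weak_partial D b (weak_partial D b u)) (abs_l2 (\<phi> n)))
        \<longlonglongrightarrow> - inner (weak_partial D b (weak_partial D b u)) u"
      by (intro tendsto_intros \<phi>(2))
    ultimately show ?thesis using LIMSEQ_unique by (metis add.inverse_inverse)
  qed
  then show ?thesis
    by (simp add: Lambda_def grad_inner_def inner_sum_left sum_negf)
qed

text \<open>The eigenvalue of a normalised eigenvector is its Dirichlet energy, which Poincare's inequality
  bounds from below.\<close>

lemma Lambda_eigenvalue_lower_bound:
  fixes D :: "'a::euclidean_space set"
  assumes D: "open D" "D \<subseteq> cball 0 R" "R > 0"
    and e: "e \<in> dom_Lambda D" "Lambda D e = l *\<^sub>R e" "norm e = 1"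
  shows "inverse ((2 * R)\<^sup>2) \<le> l"
proof -
  obtain b :: 'a where b: "b \<in> Basis" using nonempty_Basis by blast
  have "1 \<le> (2 * R) * norm (weak_partial D b e)"
    using poincare_H10[OF D(1,2) _ b, of e] e by (simp add: dom_Lambda_def)
  then have "1\<^sup>2 \<le> ((2 * R) * norm (weak_partial D b e))\<^sup>2"
    by (rule power_mono) simp
  also have "\<dots> = (2 * R)\<^sup>2 * inner (weak_partial D b e) (weak_partial D b e)"
    by (simp only: power_mult_distrib power2_norm_eq_inner)
  also have "\<dots> \<le> (2 * R)\<^sup>2 * grad_inner D e e"
    unfolding grad_inner_def by (intro mult_left_mono member_le_sum[OF b]) auto
  also have "grad_inner D e e = l"
    using Lambda_inner_self[OF D(1) e(1)] e(2,3) by (simp add: power2_norm_eq_inner[symmetric])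
  finally show ?thesis using D(3) by (simp add: field_simps)
qed

section \<open>Orthonormal systems\<close>

definition orthonormal :: "'b::real_inner set \<Rightarrow> bool" where
  "orthonormal B \<longleftrightarrow> pairwise orthogonal B \<and> (\<forall>e\<in>B. norm e = 1)"

lemma orthonormal_inner:
  assumes "orthonormal B" "e \<in> B" "e' \<in> B"
  shows "inner e e' = (if e = e' then 1 else 0)"
  using assms by (auto simp: orthonormal_def pairwise_def orthogonal_def power2_norm_eq_inner[symmetric])

lemma orthonormal_subset: "orthonormal B \<Longrightarrow> F \<subseteq> B \<Longrightarrow> orthonormal F"
  unfolding orthonormal_def by (meson pairwise_subset subsetD)

lemma orthonormal_expand:
  assumes "orthonormal E" "finite E" "x \<in> span E"
  shows "x = (\<Sum>e\<in>E. inner x e *\<^sub>R e)"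
  using orthonormal_basis_expand[of E x] assms by (simp add: orthonormal_def)

lemma orthonormal_inner_sum:
  assumes "orthonormal E" "finite E" "e \<in> E"
  shows "inner (\<Sum>e\<in>E. c e *\<^sub>R e) e = c e"
proof -
  have "inner (\<Sum>e\<in>E. c e *\<^sub>R e) e = (\<Sum>e'\<in>E. if e' = e then c e else 0)"
    unfolding inner_sum_left using orthonormal_inner[OF assms(1) _ assms(3)]
    by (intro sum.cong) auto
  then show ?thesis using assms by simp
qed

lemma orthonormal_inner_expand:
  assumes "orthonormal E" "finite E" "y \<in> span E"
  shows "inner x y = (\<Sum>e\<in>E. inner x e * inner y e)"
proof -
  have "inner x y = inner x (\<Sum>e\<in>E. inner y e *\<^sub>R e)" using orthonormal_expand[OF assms] by simp
  then show ?thesis by (simp add: inner_sum_right mult.commute)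
qed

lemma orthonormal_eqI:
  assumes "orthonormal E" "finite E" "x \<in> span E" "y \<in> span E" "\<And>e. e \<in> E \<Longrightarrow> inner x e = inner y e"
  shows "x = y"
proof -
  have "x = (\<Sum>e\<in>E. inner x e *\<^sub>R e)" "y = (\<Sum>e\<in>E. inner y e *\<^sub>R e)"
    using orthonormal_expand[OF assms(1,2)] assms(3,4) by blast+
  moreover have "(\<Sum>e\<in>E. inner x e *\<^sub>R e) = (\<Sum>e\<in>E. inner y e *\<^sub>R e)"
    using assms(5) by (intro sum.cong) auto
  ultimately show ?thesis by simp
qed

text \<open>The left-hand side is the squared distance from \<open>x\<close> to its orthogonal projection onto the span.\<close>

lemma bessel_defect:
  assumes E: "orthonormal E" "finite E" and y: "y \<in> span E"
  shows "(norm x)\<^sup>2 - (\<Sum>e\<in>E. (inner x e)\<^sup>2) \<le> (norm (x - y))\<^sup>2"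
proof -
  have "(norm (x - y))\<^sup>2 = (norm x)\<^sup>2 - 2 * inner x y + inner y y"
    by (simp add: power2_norm_eq_inner inner_diff_left inner_diff_right inner_commute)
  also have "\<dots> = (norm x)\<^sup>2 - (\<Sum>e\<in>E. (inner x e)\<^sup>2) + (\<Sum>e\<in>E. (inner x e - inner y e)\<^sup>2)"
    unfolding orthonormal_inner_expand[OF E y]
    by (simp add: power2_diff sum.distrib sum_subtractf sum_distrib_left power2_eq_square algebra_simps)
  finally show ?thesis by (simp add: sum_nonneg)
qed

lemma bessel_inequality:
  assumes E: "orthonormal E" "finite E"
  shows "(\<Sum>e\<in>E. (inner x e)\<^sup>2) \<le> (norm x)\<^sup>2"
proof -
  let ?y = "\<Sum>e\<in>E. inner x e *\<^sub>R e"
  have y: "?y \<in> span E" by (intro span_sum span_scale span_base)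
  have "inner x ?y = (\<Sum>e\<in>E. (inner x e)\<^sup>2)"
    by (simp add: inner_sum_right power2_eq_square)
  moreover have "inner ?y ?y = (\<Sum>e\<in>E. (inner x e)\<^sup>2)"
    unfolding orthonormal_inner_expand[OF E y]
    using orthonormal_inner_sum[OF E, of _ "inner x"] by (simp add: power2_eq_square)
  ultimately have "(norm (x - ?y))\<^sup>2 = (norm x)\<^sup>2 - (\<Sum>e\<in>E. (inner x e)\<^sup>2)"
    by (simp add: power2_norm_eq_inner inner_diff_left inner_diff_right inner_commute)
  then show ?thesis by (metis diff_ge_0_iff_ge zero_le_power2)
qed

lemma onb_orthonormal: "onb H B \<Longrightarrow> orthonormal B"
  by (auto simp: onb_def orthonormal_def)

text \<open>A vector close to \<open>x\<close> in the span of \<open>B\<close> is a combination of finitely many elements of \<open>B\<close>; for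
  any finite subset of \<open>B\<close> containing these, the projection of \<open>x\<close> is at least as close.\<close>

lemma onb_parseval:
  assumes B: "onb H B" and x: "x \<in> H"
  shows "((\<lambda>e. (inner x e)\<^sup>2) has_sum (norm x)\<^sup>2) B"
  unfolding has_sum_def tendsto_iff
proof (intro allI impI)
  fix \<epsilon> :: real assume \<epsilon>: "\<epsilon> > 0"
  have "x \<in> closure (span B)" using B x by (auto simp: onb_def)
  then obtain y where y: "y \<in> span B" "dist y x < sqrt \<epsilon>"
    using \<epsilon> by (meson closure_approachable real_sqrt_gt_zero)
  then obtain F r where F: "finite F" "F \<subseteq> B" "y = (\<Sum>e\<in>F. r e *\<^sub>R e)"
    by (auto simp: span_explicit)
  show "\<forall>\<^sub>F G in finite_subsets_at_top B. dist (\<Sum>e\<in>G. (inner x e)\<^sup>2) ((norm x)\<^sup>2) < \<epsilon>"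
    unfolding eventually_finite_subsets_at_top
  proof (intro exI conjI allI impI)
    fix G assume G: "finite G \<and> F \<subseteq> G \<and> G \<subseteq> B"
    then have on: "orthonormal G" using onb_orthonormal[OF B] orthonormal_subset by blast
    have "y \<in> span G" unfolding F(3) using G by (intro span_sum span_scale span_base) auto
    then have "(norm x)\<^sup>2 - (\<Sum>e\<in>G. (inner x e)\<^sup>2) \<le> (norm (x - y))\<^sup>2"
      using bessel_defect[OF on] G by blast
    moreover have "(norm (x - y))\<^sup>2 < (sqrt \<epsilon>)\<^sup>2"
      using y(2) by (intro power_strict_mono) (auto simp: dist_norm norm_minus_commute)
    ultimately show "dist (\<Sum>e\<in>G. (inner x e)\<^sup>2) ((norm x)\<^sup>2) < \<epsilon>"
      using bessel_inequality[OF on, of x] G \<epsilon> by (simp add: dist_real_def)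
  qed (use F in auto)
qed

lemma onb_parseval_inner:
  assumes B: "onb H B" and H: "subspace H" and x: "x \<in> H" and y: "y \<in> H"
  shows "((\<lambda>e. inner x e * inner y e) has_sum inner x y) B"
proof -
  have "((\<lambda>e. ((inner (x + y) e)\<^sup>2 + (-1) * (inner (x - y) e)\<^sup>2) * (1 / 4))
      has_sum (((norm (x + y))\<^sup>2 + (-1) * (norm (x - y))\<^sup>2) * (1 / 4))) B"
    by (intro has_sum_cmult_left has_sum_add has_sum_cmult_right onb_parseval[OF B]
        subspace_add[OF H] subspace_diff[OF H] x y)
  moreover have "((inner (x + y) e)\<^sup>2 + (-1) * (inner (x - y) e)\<^sup>2) * (1 / 4) = inner x e * inner y e" for e
    by (simp add: inner_add_left inner_diff_left power2_sum power2_diff)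
  moreover have "((norm (x + y))\<^sup>2 + (-1) * (norm (x - y))\<^sup>2) * (1 / 4) = inner x y"
    by (simp add: power2_norm_eq_inner inner_add_left inner_diff_left inner_add_right inner_diff_right inner_commute)
  ultimately show ?thesis by simp
qed

lemma has_sum_sum_finite:
  fixes f :: "'i \<Rightarrow> 'b \<Rightarrow> real"
  assumes "finite I" "\<And>i. i \<in> I \<Longrightarrow> (f i has_sum s i) A"
  shows "((\<lambda>x. \<Sum>i\<in>I. f i x) has_sum (\<Sum>i\<in>I. s i)) A"
  using assms by (induction I) (auto intro: has_sum_add)

text \<open>The trace of an operator whose quadratic form is given by a matrix \<open>q\<close> with respect to \<open>E\<close>. Summing
  over an orthonormal basis of \<open>H\<close>, Parseval's identity turns the coordinates into inner products of
  elements of \<open>E\<close>, so that only the diagonal of \<open>q\<close> remains.\<close>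

lemma trace_op_finite_rank:
  assumes ex: "\<exists>B. onb H B" and H: "subspace H" and E: "orthonormal E" "finite E" "E \<subseteq> H"
    and A: "\<And>u. u \<in> H \<Longrightarrow> inner (A u) u = (\<Sum>e\<in>E. \<Sum>e'\<in>E. inner u e * inner u e' * q e e')"
  shows "trace_op H A = (\<Sum>e\<in>E. q e e)"
proof -
  let ?B = "SOME B. onb H B"
  have B: "onb H ?B" using someI_ex[OF ex] .
  have "((\<lambda>b. \<Sum>e\<in>E. \<Sum>e'\<in>E. inner e b * inner e' b * q e e') has_sum
      (\<Sum>e\<in>E. \<Sum>e'\<in>E. inner e e' * q e e')) ?B"
    using E(3) by (intro has_sum_sum_finite E(2) has_sum_cmult_left onb_parseval_inner[OF B H]) auto
  moreover have "(\<Sum>e\<in>E. \<Sum>e'\<in>E. inner e e' * q e e') = (\<Sum>e\<in>E. q e e)"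
  proof (rule sum.cong[OF refl])
    fix e assume e: "e \<in> E"
    have "(\<Sum>e'\<in>E. inner e e' * q e e') = (\<Sum>e'\<in>E. if e' = e then q e e else 0)"
      by (intro sum.cong) (auto simp: orthonormal_inner[OF E(1) e])
    then show "(\<Sum>e'\<in>E. inner e e' * q e e') = q e e" using E(2) e by simp
  qed
  moreover have "(\<Sum>e\<in>E. \<Sum>e'\<in>E. inner e b * inner e' b * q e e') = inner (A b) b" if "b \<in> ?B" for b
    using A[of b] B that by (auto simp: onb_def inner_commute)
  ultimately have "((\<lambda>b. inner (A b) b) has_sum (\<Sum>e\<in>E. q e e)) ?B"
    using has_sum_cong[of ?B "\<lambda>b. inner (A b) b" "\<lambda>b. \<Sum>e\<in>E. \<Sum>e'\<in>E. inner e b * inner e' b * q e e'"]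
    by simp
  then show ?thesis unfolding trace_op_def by (rule infsumI)
qed

section \<open>Functional calculus\<close>

lemma onb_has_sum_inner:
  assumes B: "onb H B" and w: "((\<lambda>e. c e *\<^sub>R e) has_sum w) B" and e: "e \<in> B"
  shows "inner w e = c e"
proof -
  have "((\<lambda>e'. inner e (c e' *\<^sub>R e')) has_sum inner e w) B"
    using has_sum_bounded_linear[OF bounded_linear_inner_right w] by (simp add: o_def)
  moreover have "((\<lambda>e'. inner e (c e' *\<^sub>R e')) has_sum c e) B"
    by (rule has_sum_finite_neutralI[of "{e}"])
      (use e orthonormal_inner[OF onb_orthonormal[OF B] e] in auto)
  ultimately have "inner e w = c e" by (rule has_sum_unique)
  then show ?thesis by (simp add: inner_commute)
qed

text \<open>In an eigenbasis every coordinate is multiplied by at least \<open>m\<close>; Parseval's identity compares the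
  norms.\<close>

lemma has_fun_of_op_norm_ge:
  assumes f: "has_fun_of_op H Dom A g u w"
    and m: "\<And>e l. e \<in> Dom \<Longrightarrow> norm e = 1 \<Longrightarrow> A e = l *\<^sub>R e \<Longrightarrow> m \<le> g l" "m \<ge> 0"
  shows "m * norm u \<le> norm w"
proof -
  obtain B lam where B: "onb H B" and lam: "\<forall>e\<in>B. e \<in> Dom \<and> A e = lam e *\<^sub>R e"
    and w: "((\<lambda>e. (g (lam e) * inner u e) *\<^sub>R e) has_sum w) B" and H: "u \<in> H" "w \<in> H"
    using f by (auto simp: has_fun_of_op_def)
  have "m\<^sup>2 * (norm u)\<^sup>2 \<le> (norm w)\<^sup>2"
  proof (rule has_sum_mono[OF has_sum_cmult_right[OF onb_parseval[OF B H(1)]] onb_parseval[OF B H(2)]])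
    fix e assume e: "e \<in> B"
    have "m\<^sup>2 \<le> (g (lam e))\<^sup>2"
      using m e lam B by (intro power_mono) (auto simp: onb_def)
    then show "m\<^sup>2 * (inner u e)\<^sup>2 \<le> (inner w e)\<^sup>2"
      by (simp add: onb_has_sum_inner[OF B w e] power_mult_distrib mult_right_mono)
  qed
  then show ?thesis
    using power2_le_imp_le[of "m * norm u" "norm w"] by (simp add: power_mult_distrib)
qed

lemma Lambda_pow_norm_ge:
  fixes D :: "'a::euclidean_space set"
  assumes D: "open D" "D \<subseteq> cball 0 R" "R > 0" and s: "s \<ge> 0" and u: "u \<in> dom_Lambda_pow D s"
  shows "inverse ((2 * R)\<^sup>2) powr s * norm u \<le> norm (Lambda_pow D s u)"
proof -
  have "has_fun_of_op (L2_on D) (dom_Lambda D) (Lambda D) (\<lambda>x. x powr s) u (Lambda_pow D s u)"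
    using u unfolding dom_Lambda_pow_def Lambda_pow_def fun_of_op_def by (auto intro: someI)
  then show ?thesis
  proof (rule has_fun_of_op_norm_ge)
    fix e l assume "e \<in> dom_Lambda D" "norm e = 1" "Lambda D e = l *\<^sub>R e"
    then show "inverse ((2 * R)\<^sup>2) powr s \<le> l powr s"
      using Lambda_eigenvalue_lower_bound[OF D] s by (intro powr_mono2) auto
  qed simp
qed

text \<open>Eigenvectors to different eigenvalues are orthogonal, so the value of the functional
  calculus has the same coordinates whichever eigenbasis is used.\<close>

lemma fun_of_op_finite:
  assumes E: "orthonormal E" "finite E" and A: "\<And>e. e \<in> E \<Longrightarrow> A e = lam e *\<^sub>R e"
    and sym: "\<And>x y. x \<in> span E \<Longrightarrow> y \<in> span E \<Longrightarrow> inner (A x) y = inner x (A y)"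
    and u: "u \<in> span E"
  shows "fun_of_op (span E) (span E) A g u = (\<Sum>e\<in>E. (g (lam e) * inner u e) *\<^sub>R e)" (is "_ = ?w")
proof -
  have sp: "?w \<in> span E" by (intro span_sum span_scale span_base)
  have "onb (span E) E"
    using E(1) closure_subset[of "span E"] by (auto simp: onb_def orthonormal_def intro: span_base)
  then have ex: "has_fun_of_op (span E) (span E) A g u ?w"
    unfolding has_fun_of_op_def using u sp A E(2)
    by (auto intro!: exI[of _ E] exI[of _ lam] span_base has_sum_finite)
  have "w = ?w" if w: "has_fun_of_op (span E) (span E) A g u w" for w
  proof -
    obtain B mu where B: "onb (span E) B" and mu: "\<And>e. e \<in> B \<Longrightarrow> e \<in> span E \<and> A e = mu e *\<^sub>R e"
      and ws: "((\<lambda>e. (g (mu e) * inner u e) *\<^sub>R e) has_sum w) B" and wE: "w \<in> span E"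
      using w by (auto simp: has_fun_of_op_def)
    show ?thesis
    proof (rule orthonormal_eqI[OF E wE sp])
      fix e assume e: "e \<in> E"
      have "((\<lambda>b. inner e ((g (mu b) * inner u b) *\<^sub>R b)) has_sum inner e w) B"
        using has_sum_bounded_linear[OF bounded_linear_inner_right ws] by (simp add: o_def)
      moreover have "inner e ((g (mu b) * inner u b) *\<^sub>R b) = g (lam e) * (inner u b * inner e b)"
        if b: "b \<in> B" for b
      proof -
        have "mu b * inner b e = lam e * inner b e"
          using sym[of b e] mu[OF b] A[OF e] span_base[OF e] by simp
        then show ?thesis by (auto simp: inner_commute)
      qed
      ultimately have "((\<lambda>b. g (lam e) * (inner u b * inner e b)) has_sum inner e w) B"
        using has_sum_cong[of B "\<lambda>b. inner e ((g (mu b) * inner u b) *\<^sub>R b)"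
            "\<lambda>b. g (lam e) * (inner u b * inner e b)"] by blast
      moreover have "((\<lambda>b. g (lam e) * (inner u b * inner e b)) has_sum (g (lam e) * inner u e)) B"
        by (intro has_sum_cmult_right onb_parseval_inner[OF B subspace_span u span_base[OF e]])
      ultimately show "inner w e = inner ?w e"
        using has_sum_unique orthonormal_inner_sum[OF E e, of "\<lambda>e. g (lam e) * inner u e"]
        by (metis (no_types, lifting) inner_commute)
    qed
  qed
  then show ?thesis unfolding fun_of_op_def using someI[of "has_fun_of_op (span E) (span E) A g u", OF ex] by blast
qed

section \<open>Diagonalisation of symmetric forms\<close>

lemma ex_orthonormal_basis:
  fixes B :: "'b::real_inner set"
  assumes "finite B"
  shows "\<exists>E. finite E \<and> orthonormal E \<and> span E = span B"
proof -
  obtain C where C: "finite C" "span C = span B" "pairwise orthogonal C"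
    using basis_orthogonal[OF assms] by blast
  let ?E = "(\<lambda>x. x /\<^sub>R norm x) ` (C - {0})"
  have "orthonormal ?E"
    using C(3) by (auto simp: orthonormal_def pairwise_def orthogonal_def)
  moreover have "span ?E = span (C - {0})"
    using C(1) by (intro span_image_scale) auto
  ultimately show ?thesis using C by (intro exI[of _ ?E]) (auto simp: span_delete_0)
qed

text \<open>In place of the Heine-Borel theorem, which needs a Euclidean ambient space: the unit sphere of a
  finite-dimensional subspace lies in a compact cube.\<close>

lemma compact_cube_in_span:
  fixes B :: "'b::real_inner set"
  assumes "finite B"
  shows "\<exists>K. compact K \<and> K \<subseteq> span B \<and> (\<forall>c. (\<forall>b\<in>B. \<bar>c b\<bar> \<le> 1) \<longrightarrow> (\<Sum>b\<in>B. c b *\<^sub>R b) \<in> K)"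
  using assms
proof (induction B)
  case empty
  show ?case by (intro exI[of _ "{0}"]) auto
next
  case (insert b B)
  then obtain K where K: "compact K" "K \<subseteq> span B"
    "\<And>c. (\<forall>b\<in>B. \<bar>c b\<bar> \<le> 1) \<Longrightarrow> (\<Sum>b\<in>B. c b *\<^sub>R b) \<in> K" by blast
  let ?f = "\<lambda>p. fst p *\<^sub>R b + snd p"
  have "compact (?f ` ({-1..1} \<times> K))"
    by (intro compact_continuous_image compact_Times K continuous_intros compact_Icc)
  moreover have "?f ` ({-1..1} \<times> K) \<subseteq> span (insert b B)"
  proof
    fix z assume "z \<in> ?f ` ({-1..1} \<times> K)"
    then obtain t y where "z = t *\<^sub>R b + y" "y \<in> K" by auto
    moreover have "y \<in> span (insert b B)"
      using \<open>y \<in> K\<close> K(2) span_mono[OF subset_insertI[of B b]] by blast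
    moreover have "t *\<^sub>R b \<in> span (insert b B)" by (intro span_scale span_base) simp
    ultimately show "z \<in> span (insert b B)" by (simp add: span_add)
  qed
  moreover have "(\<Sum>x\<in>insert b B. c x *\<^sub>R x) \<in> ?f ` ({-1..1} \<times> K)" if c: "\<forall>x\<in>insert b B. \<bar>c x\<bar> \<le> 1" for c
  proof (rule image_eqI)
    show "(\<Sum>x\<in>insert b B. c x *\<^sub>R x) = ?f (c b, \<Sum>x\<in>B. c x *\<^sub>R x)" using insert by simp
    show "(c b, \<Sum>x\<in>B. c x *\<^sub>R x) \<in> {-1..1} \<times> K"
      using c K(3)[of c] by (auto simp: abs_le_iff)
  qed
  ultimately show ?case by blast
qed

locale symmetric_form =
  fixes V :: "'b::real_inner set" and a :: "'b \<Rightarrow> 'b \<Rightarrow> real"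
  assumes subspace_V: "subspace V"
    and form_add: "\<And>u v w. u \<in> V \<Longrightarrow> v \<in> V \<Longrightarrow> w \<in> V \<Longrightarrow> a (u + v) w = a u w + a v w"
    and form_scale: "\<And>c u w. u \<in> V \<Longrightarrow> w \<in> V \<Longrightarrow> a (c *\<^sub>R u) w = c * a u w"
    and form_commute: "\<And>u w. u \<in> V \<Longrightarrow> w \<in> V \<Longrightarrow> a u w = a w u"
begin

lemma form_sum:
  assumes "finite I" "\<And>i. i \<in> I \<Longrightarrow> x i \<in> V" "w \<in> V"
  shows "a (\<Sum>i\<in>I. c i *\<^sub>R x i) w = (\<Sum>i\<in>I. c i * a (x i) w)"
  using assms(1,2)
proof (induction I)
  case empty
  show ?case using form_scale[of 0 w 0] subspace_0[OF subspace_V] assms(3) by simp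
next
  case (insert i I)
  then show ?case
    using assms(3) subspace_V
    by (simp add: form_add form_scale subspace_scale subspace_sum)
qed

lemma form_expand:
  assumes E: "orthonormal E" "finite E" "span E = V" and u: "u \<in> V" "w \<in> V"
  shows "a u w = (\<Sum>e\<in>E. inner u e * a e w)"
proof -
  have "a u w = a (\<Sum>e\<in>E. inner u e *\<^sub>R e) w" using orthonormal_expand[OF E(1,2)] E(3) u by simp
  then show ?thesis using form_sum[of E "\<lambda>e. e" w] E u by (auto intro: span_base)
qed

text \<open>First-order condition at a maximum of the Rayleigh quotient.\<close>

lemma rayleigh_maximum:
  assumes U: "subspace U" "U \<subseteq> V" and e: "e \<in> U" "norm e = 1"
    and max: "\<And>x. x \<in> U \<Longrightarrow> norm x = 1 \<Longrightarrow> a x x \<le> a e e" and v: "v \<in> U" "inner e v = 0"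
  shows "a e v = 0"
proof -
  have sc: "a (c *\<^sub>R x) (c *\<^sub>R x) = c\<^sup>2 * a x x" if "x \<in> U" for c x
    using that U form_scale form_commute subspace_scale[OF subspace_V]
    by (auto simp: power2_eq_square subset_iff)
  have hom: "a x x \<le> a e e * (norm x)\<^sup>2" if x: "x \<in> U" for x
  proof (cases "x = 0")
    case True
    then show ?thesis using sc[OF x, of 0] by simp
  next
    case False
    then have "a (inverse (norm x) *\<^sub>R x) (inverse (norm x) *\<^sub>R x) \<le> a e e"
      by (intro max subspace_scale U x) auto
    then show ?thesis using False by (simp add: sc[OF x] field_simps)
  qed
  have V: "e \<in> V" "v \<in> V" using e v U by auto
  define k where "k = a e e * (norm v)\<^sup>2 - a v v"
  have quad: "2 * t * a e v \<le> t\<^sup>2 * k" for t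
  proof -
    have "a (e + t *\<^sub>R v) (e + t *\<^sub>R v) = a e e + 2 * t * a e v + t\<^sup>2 * a v v"
    proof -
      have "e + t *\<^sub>R v \<in> V" "t *\<^sub>R v \<in> V"
        using V by (auto intro: subspace_add[OF subspace_V] subspace_scale[OF subspace_V])
      then show ?thesis
        using V form_add[of e "t *\<^sub>R v" "e + t *\<^sub>R v"] form_add[of e "t *\<^sub>R v" e] form_add[of e "t *\<^sub>R v" v]
          form_scale[of v _ t] form_commute[of e "e + t *\<^sub>R v"] form_commute[of v "e + t *\<^sub>R v"] form_commute[of e v]
        by (simp add: power2_eq_square algebra_simps)
    qed
    moreover have "(norm (e + t *\<^sub>R v))\<^sup>2 = 1 + t\<^sup>2 * (norm v)\<^sup>2"
      using e(2) v(2) unfolding power2_norm_eq_inner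
      by (simp add: inner_add_left inner_add_right inner_commute power2_eq_square norm_eq_1)
    moreover have "e + t *\<^sub>R v \<in> U" using e v U by (intro subspace_add subspace_scale)
    ultimately show ?thesis using hom[of "e + t *\<^sub>R v"] by (simp add: k_def algebra_simps)
  qed
  \<comment> \<open>A linear term dominated by a quadratic one vanishes: test with \<open>t = a e v / m\<close>.\<close>
  define m where "m = \<bar>k\<bar> + 1"
  have m: "m > 0" "k \<le> m" by (auto simp: m_def)
  have "2 * (a e v / m) * a e v \<le> (a e v / m)\<^sup>2 * k" by (rule quad)
  also have "\<dots> \<le> (a e v / m)\<^sup>2 * m" using m by (intro mult_left_mono) auto
  finally have "2 * (a e v)\<^sup>2 \<le> (a e v)\<^sup>2"
    using m by (simp add: field_simps power2_eq_square)
  then show ?thesis by simp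
qed

text \<open>The spectral theorem in finite dimension, for a form instead of an operator. A largest orthonormal
  set of eigenvectors spans \<open>V\<close>: otherwise, maximising the Rayleigh quotient over the unit sphere of its
  orthogonal complement in \<open>V\<close> yields one more.\<close>

theorem ex_diagonalising_basis:
  assumes fin: "finite B0" "V = span B0"
  shows "\<exists>E. finite E \<and> orthonormal E \<and> span E = V \<and> (\<forall>e\<in>E. \<forall>e'\<in>E. e \<noteq> e' \<longrightarrow> a e e' = 0)"
proof -
  obtain B where B: "finite B" "orthonormal B" "span B = V"
    using ex_orthonormal_basis[OF fin(1)] fin(2) by blast
  \<comment> \<open>In terms of the form, \<open>e\<close> is an eigenvector iff \<open>a e\<close> vanishes on the orthogonal complement
    of \<open>e\<close>.\<close>
  define P where "P E \<longleftrightarrow> orthonormal E \<and> E \<subseteq> V \<and> (\<forall>e\<in>E. \<forall>v\<in>V. inner e v = 0 \<longrightarrow> a e v = 0)" for E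
  have bound: "finite E \<and> card E \<le> card B0" if "P E" for E
  proof -
    have "pairwise orthogonal E" "0 \<notin> E" using that by (auto simp: P_def orthonormal_def)
    then have "independent E" by (rule pairwise_orthogonal_independent)
    then show ?thesis using independent_span_bound[OF fin(1)] that fin(2) by (auto simp: P_def)
  qed
  have "P {}" by (simp add: P_def orthonormal_def)
  then obtain E where E: "P E" and maxE: "\<And>E'. P E' \<Longrightarrow> card E' \<le> card E"
    using ex_has_greatest_nat[of P "{}" card "Suc (card B0)"] bound by (auto simp: less_Suc_eq_le)
  have finE: "finite E" and onE: "orthonormal E" and EV: "E \<subseteq> V"
    and eig: "\<And>e v. e \<in> E \<Longrightarrow> v \<in> V \<Longrightarrow> inner e v = 0 \<Longrightarrow> a e v = 0"
    using E bound by (auto simp: P_def)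
  have "span E = V"
  proof (rule ccontr)
    assume "span E \<noteq> V"
    moreover have "span E \<subseteq> V" using EV subspace_V by (simp add: span_minimal)
    ultimately obtain x where x: "x \<in> V" "x \<notin> span E" by blast
    define pr where "pr y = (\<Sum>e\<in>E. inner y e *\<^sub>R e)" for y
    have pr: "pr y \<in> span E" "\<And>e. e \<in> E \<Longrightarrow> inner (y - pr y) e = 0" for y
    proof -
      show "pr y \<in> span E" unfolding pr_def by (intro span_sum span_scale span_base)
      show "inner (y - pr y) e = 0" if "e \<in> E" for e
        unfolding pr_def inner_diff_left using orthonormal_inner_sum[OF onE finE that] by simp
    qed
    define U where "U = {y \<in> V. \<forall>e\<in>E. inner y e = 0}"
    have U: "subspace U" "U \<subseteq> V"
      using subspace_V by (auto simp: U_def subspace_def inner_add_left)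
    have prU: "y - pr y \<in> U" if "y \<in> V" for y
      unfolding U_def
      using subspace_diff[OF subspace_V that subsetD[OF \<open>span E \<subseteq> V\<close> pr(1)]] pr(2) by simp
    obtain K where K: "compact K" "K \<subseteq> span B" "\<And>c. (\<forall>b\<in>B. \<bar>c b\<bar> \<le> 1) \<Longrightarrow> (\<Sum>b\<in>B. c b *\<^sub>R b) \<in> K"
      using compact_cube_in_span[OF B(1)] by blast
    let ?S = "{y \<in> U. norm y = 1}"
    have inK: "y \<in> K" if "y \<in> V" "norm y = 1" for y
    proof -
      have "\<forall>b\<in>B. \<bar>inner y b\<bar> \<le> 1"
        using that B(2) Cauchy_Schwarz_ineq2[of y] by (auto simp: orthonormal_def) (metis mult_1)
      then have "(\<Sum>b\<in>B. inner y b *\<^sub>R b) \<in> K" by (rule K(3))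
      then show ?thesis using orthonormal_expand[OF B(2,1), of y] B(3) that by simp
    qed
    have "?S = K \<inter> ({y. norm y = 1} \<inter> (\<Inter>e\<in>E. {y. inner y e = 0}))"
      using inK K(2) B(3) by (auto simp: U_def)
    moreover have "closed ({y::'b. norm y = 1} \<inter> (\<Inter>e\<in>E. {y. inner y e = 0}))"
      by (intro closed_Int closed_INT ballI closed_Collect_eq continuous_intros)
    ultimately have comp: "compact ?S" using K(1) by (simp add: compact_Int_closed)
    have "continuous_on ?S (\<lambda>y. \<Sum>b\<in>B. inner y b * (\<Sum>b'\<in>B. inner y b' * a b' b))"
      by (intro continuous_intros)
    moreover have "(\<Sum>b\<in>B. inner y b * (\<Sum>b'\<in>B. inner y b' * a b' b)) = a y y" if "y \<in> ?S" for y
    proof -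
      have y: "y \<in> V" using that by (simp add: U_def)
      have BV: "b \<in> V" if "b \<in> B" for b using B(3) that span_base by blast
      have "a y y = (\<Sum>b\<in>B. inner y b * a b y)" by (rule form_expand[OF B(2,1,3) y y])
      also have "\<dots> = (\<Sum>b\<in>B. inner y b * a y b)"
        using BV y form_commute by (intro sum.cong) auto
      also have "\<dots> = (\<Sum>b\<in>B. inner y b * (\<Sum>b'\<in>B. inner y b' * a b' b))"
        using BV y form_expand[OF B(2,1,3)] by (intro sum.cong) auto
      finally show ?thesis by simp
    qed
    ultimately have cont: "continuous_on ?S (\<lambda>y. a y y)" by (rule continuous_on_eq)
    have "x - pr x \<noteq> 0" using x(2) pr(1)[of x] by auto
    then have "inverse (norm (x - pr x)) *\<^sub>R (x - pr x) \<in> ?S"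
      using prU[OF x(1)] subspace_scale[OF U(1)] by auto
    then have "?S \<noteq> {}" by blast
    then obtain e where e: "e \<in> U" "norm e = 1" and emax: "\<And>y. y \<in> U \<Longrightarrow> norm y = 1 \<Longrightarrow> a y y \<le> a e e"
      using continuous_attains_sup[OF comp _ cont] by auto
    have eE: "inner e' e = 0" if "e' \<in> E" for e' using e that by (simp add: U_def inner_commute)
    have "a e v = 0" if v: "v \<in> V" "inner e v = 0" for v
    proof -
      have eV: "e \<in> V" using e U by auto
      have pv: "inner e (pr v) = 0" unfolding pr_def inner_sum_right
        using eE by (intro sum.neutral) (auto simp: inner_commute)
      have "a e (v - pr v) = 0"
        using rayleigh_maximum[OF U e emax prU[OF v(1)]] v(2) pv by (simp add: inner_diff_right)
      moreover have "a (pr v) e = (\<Sum>e'\<in>E. inner v e' * a e' e)"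
        unfolding pr_def using EV eV by (intro form_sum finE) auto
      then have "a (pr v) e = 0" using eig eE eV by simp
      moreover have "a ((v - pr v) + pr v) e = a (v - pr v) e + a (pr v) e"
        using prU[OF v(1)] U(2) pr(1)[of v] \<open>span E \<subseteq> V\<close> eV by (intro form_add) auto
      moreover have "v - pr v \<in> V" using prU[OF v(1)] U(2) by auto
      ultimately show ?thesis using form_commute v(1) eV by simp
    qed
    then have "P (insert e E)"
      using E e U(2) eE
      by (auto simp: P_def orthonormal_def pairwise_insert orthogonal_def inner_commute)
    then have "card (insert e E) \<le> card E" by (rule maxE)
    moreover have "e \<notin> E" using eE[of e] e(2) by (auto simp: norm_eq_1)
    ultimately show False using finE by simp
  qed
  moreover have "a e e' = 0" if "e \<in> E" "e' \<in> E" "e \<noteq> e'" for e e'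
    using eig[of e e'] that EV orthonormal_inner[OF onE that(1,2)] by auto
  ultimately show ?thesis using finE onE by blast
qed

end

section \<open>The embedding of \<open>H\<^sup>1\<^sub>0\<close> into \<open>L\<^sup>4\<close> in dimensions one and two\<close>

text \<open>The fundamental theorem of calculus for \<open>\<phi>\<^sup>2\<close> along the line through \<open>y\<close> in direction \<open>b\<close>,
  starting outside the support.\<close>

lemma square_le_line_integral:
  fixes \<phi> :: "'a::euclidean_space \<Rightarrow> real"
  assumes \<phi>: "\<phi> \<in> test_functions D" and b: "b \<in> Basis"
  shows "ennreal ((\<phi> (y + s *\<^sub>R b))\<^sup>2)
    \<le> (\<integral>\<^sup>+t. ennreal (2 * \<bar>\<phi> (y + t *\<^sub>R b) * pderiv_at b \<phi> (y + t *\<^sub>R b)\<bar>) \<partial>lborel)"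
proof -
  obtain K where K: "compact K" "K \<subseteq> D" "\<And>x. x \<notin> K \<Longrightarrow> \<phi> x = 0"
    using test_function_support[OF \<phi>] by auto
  let ?d = "pderiv_at b \<phi>"
  let ?g = "\<lambda>t. (\<phi> (y + t *\<^sub>R b))\<^sup>2"
  let ?g' = "\<lambda>t. 2 * (\<phi> (y + t *\<^sub>R b) * ?d (y + t *\<^sub>R b))"
  obtain R where R: "\<And>x. x \<in> K \<Longrightarrow> norm x \<le> R" "R \<ge> 0"
    using compact_imp_bounded[OF K(1)] unfolding bounded_pos by (auto dest: less_imp_le)
  define r where "r = - (R + norm y + \<bar>s\<bar> + 1)"
  have "r \<le> s" "\<bar>r\<bar> = R + norm y + \<bar>s\<bar> + 1" using R(2) norm_ge_zero[of y] unfolding r_def by linarith+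
  then have r: "r \<le> s" "norm (r *\<^sub>R b) = R + norm y + \<bar>s\<bar> + 1" using b by simp_all
  have "norm (r *\<^sub>R b) \<le> norm (y + r *\<^sub>R b) + norm y"
    using norm_triangle_ineq4[of "y + r *\<^sub>R b" y] by simp
  then have "norm (y + r *\<^sub>R b) > R" using r by linarith
  then have g0: "?g r = 0" using K(3) R(1) by fastforce
  note line = Ck_line_derivative[OF test_functionsD(1)[OF \<phi>, of "Suc 0"]]
  have deriv: "(?g has_real_derivative ?g' t) (at t)" for t
    using line by (auto intro!: derivative_eq_intros)
  have cont: "continuous_on UNIV (\<lambda>t. ?g' t)"
    using test_functionsD(2)[OF \<phi>] test_functionsD(2)[OF test_function_pderiv[OF \<phi> b]]
    by (auto intro!: continuous_intros elim: continuous_on_compose2)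
  then have [measurable]: "?g' \<in> borel_measurable borel" by (rule borel_measurable_continuous_onI)
  have "has_bochner_integral lborel (\<lambda>t. ?g' t * indicator {r..s} t) (?g s - ?g r)"
    using r(1) deriv cont by (intro has_bochner_integral_FTC_Icc_real) (auto simp: continuous_on_eq_continuous_at)
  then have "?g s = (LINT t|lborel. ?g' t * indicator {r..s} t)"
    and int: "integrable lborel (\<lambda>t. ?g' t * indicator {r..s} t)"
    using g0 by (simp_all add: has_bochner_integral_iff)
  then have "ennreal (?g s) = ennreal (norm (LINT t|lborel. ?g' t * indicator {r..s} t))"
    by (metis abs_of_nonneg real_norm_def zero_le_power2)
  also have "\<dots> \<le> (\<integral>\<^sup>+t. norm (?g' t * indicator {r..s} t) \<partial>lborel)"
    by (rule integral_norm_bound_ennreal[OF int])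
  also have "\<dots> \<le> (\<integral>\<^sup>+t. ennreal (2 * \<bar>\<phi> (y + t *\<^sub>R b) * ?d (y + t *\<^sub>R b)\<bar>) \<partial>lborel)"
    by (intro nn_integral_mono) (auto simp: abs_mult indicator_def intro!: ennreal_leI)
  finally show ?thesis .
qed

lemma nn_integral_lborel_dim1:
  fixes f :: "'a::euclidean_space \<Rightarrow> ennreal"
  assumes B: "Basis = {b::'a}" and f: "f \<in> borel_measurable borel"
  shows "(\<integral>\<^sup>+x. f x \<partial>lborel) = (\<integral>\<^sup>+s. f (s *\<^sub>R b) \<partial>lborel)"
proof -
  have "b \<in> Basis" unfolding B by simp
  then have bb: "inner b b = 1" by (rule inner_same_Basis)
  have [measurable]: "(\<lambda>s. s *\<^sub>R b) \<in> borel_measurable borel" by simp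
  have "lborel = distr lborel borel (\<lambda>s. s *\<^sub>R b)"
  proof (rule lborel_eqI)
    fix l u :: 'a assume le: "\<And>b. b \<in> Basis \<Longrightarrow> l \<bullet> b \<le> u \<bullet> b"
    have "(\<lambda>s. s *\<^sub>R b) -` box l u \<inter> space lborel = {l \<bullet> b<..<u \<bullet> b}"
      by (auto simp: mem_box B bb)
    then show "emeasure (distr lborel borel (\<lambda>s. s *\<^sub>R b)) (box l u) = (\<Prod>b\<in>Basis. (u - l) \<bullet> b)"
      using le by (simp add: emeasure_distr B inner_diff_left)
  qed simp
  then have "(\<integral>\<^sup>+x. f x \<partial>lborel) = (\<integral>\<^sup>+x. f x \<partial>distr lborel borel (\<lambda>s. s *\<^sub>R b))" by simp
  also have "\<dots> = (\<integral>\<^sup>+s. f (s *\<^sub>R b) \<partial>lborel)"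
    using f by (intro nn_integral_distr) auto
  finally show ?thesis .
qed

lemma nn_integral_lborel_dim2:
  fixes f :: "'a::euclidean_space \<Rightarrow> ennreal"
  assumes B: "Basis = {b, c::'a}" "b \<noteq> c" and f: "f \<in> borel_measurable borel"
  shows "(\<integral>\<^sup>+x. f x \<partial>lborel) = (\<integral>\<^sup>+s. \<integral>\<^sup>+t. f (s *\<^sub>R b + t *\<^sub>R c) \<partial>lborel \<partial>lborel)"
    and "(\<integral>\<^sup>+x. f x \<partial>lborel) = (\<integral>\<^sup>+t. \<integral>\<^sup>+s. f (s *\<^sub>R b + t *\<^sub>R c) \<partial>lborel \<partial>lborel)"
proof -
  have Bb: "b \<in> Basis" "c \<in> Basis" unfolding B by simp_all
  then have on: "inner b b = 1" "inner c c = 1" "inner b c = 0" "inner c b = 0"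
    using B(2) by (simp_all add: inner_Basis)
  let ?T = "\<lambda>p::real \<times> real. fst p *\<^sub>R b + snd p *\<^sub>R c"
  have T: "?T \<in> measurable (lborel \<Otimes>\<^sub>M lborel) borel"
    unfolding lborel_prod by (simp, intro borel_measurable_continuous_onI continuous_intros)
  have fT: "(\<lambda>p. f (?T p)) \<in> borel_measurable (lborel \<Otimes>\<^sub>M lborel)"
    using measurable_compose[OF T f] .
  have "lborel = distr (lborel \<Otimes>\<^sub>M lborel) borel ?T"
  proof (rule lborel_eqI)
    fix l u :: 'a assume le: "\<And>b. b \<in> Basis \<Longrightarrow> l \<bullet> b \<le> u \<bullet> b"
    have "?T -` box l u \<inter> space (lborel \<Otimes>\<^sub>M lborel) = {l \<bullet> b<..<u \<bullet> b} \<times> {l \<bullet> c<..<u \<bullet> c}"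
      by (auto simp: mem_box B(1) on inner_add_left space_pair_measure)
    moreover have "(\<Prod>i\<in>Basis. (u - l) \<bullet> i) = (u \<bullet> b - l \<bullet> b) * (u \<bullet> c - l \<bullet> c)"
      unfolding B(1) using B(2) by (simp add: inner_diff_left)
    ultimately show "emeasure (distr (lborel \<Otimes>\<^sub>M lborel) borel ?T) (box l u) = (\<Prod>b\<in>Basis. (u - l) \<bullet> b)"
      using le[OF Bb(1)] le[OF Bb(2)] T
      by (simp add: emeasure_distr lborel.emeasure_pair_measure_Times ennreal_mult)
  qed simp
  then have "(\<integral>\<^sup>+x. f x \<partial>lborel) = (\<integral>\<^sup>+x. f x \<partial>distr (lborel \<Otimes>\<^sub>M lborel) borel ?T)" by simp
  also have "\<dots> = (\<integral>\<^sup>+p. f (?T p) \<partial>(lborel \<Otimes>\<^sub>M lborel))"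
    using f T by (intro nn_integral_distr) auto
  finally have eq: "(\<integral>\<^sup>+x. f x \<partial>lborel) = (\<integral>\<^sup>+p. f (?T p) \<partial>(lborel \<Otimes>\<^sub>M lborel))" .
  show "(\<integral>\<^sup>+x. f x \<partial>lborel) = (\<integral>\<^sup>+s. \<integral>\<^sup>+t. f (s *\<^sub>R b + t *\<^sub>R c) \<partial>lborel \<partial>lborel)"
    unfolding eq using lborel.nn_integral_fst[OF fT] by simp
  show "(\<integral>\<^sup>+x. f x \<partial>lborel) = (\<integral>\<^sup>+t. \<integral>\<^sup>+s. f (s *\<^sub>R b + t *\<^sub>R c) \<partial>lborel \<partial>lborel)"
    unfolding eq using lborel_pair.nn_integral_snd[OF fT] by simp
qed

lemma nn_integral_product_le:
  assumes \<phi>: "l2_rel \<phi> \<phi>" and \<psi>: "l2_rel \<psi> \<psi>"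
  shows "(\<integral>\<^sup>+x. ennreal (2 * \<bar>\<phi> x * \<psi> x\<bar>) \<partial>lborel) \<le> ennreal (2 * (norm (abs_l2 \<phi>) * norm (abs_l2 \<psi>)))"
proof -
  have a: "l2_rel (\<lambda>x. \<bar>\<phi> x\<bar>) (\<lambda>x. \<bar>\<phi> x\<bar>)" "l2_rel (\<lambda>x. \<bar>\<psi> x\<bar>) (\<lambda>x. \<bar>\<psi> x\<bar>)"
    using \<phi> \<psi> by (auto simp: l2_rel_refl_iff)
  have norm: "norm (abs_l2 (\<lambda>x. \<bar>f x\<bar>)) = norm (abs_l2 f)" if "l2_rel f f" "l2_rel (\<lambda>x. \<bar>f x\<bar>) (\<lambda>x. \<bar>f x\<bar>)" for f :: "'a \<Rightarrow> real"
    unfolding norm_eq_sqrt_inner using inner_l2.abs_eq[OF that(1,1)] inner_l2.abs_eq[OF that(2,2)] by simp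
  have int: "integrable lborel (\<lambda>x. \<bar>\<phi> x\<bar> * \<bar>\<psi> x\<bar>)"
    using a by (intro integrable_mult_l2) (auto simp: l2_rel_refl_iff)
  then have "(\<integral>\<^sup>+x. ennreal (2 * \<bar>\<phi> x * \<psi> x\<bar>) \<partial>lborel) = ennreal (LINT x|lborel. 2 * (\<bar>\<phi> x\<bar> * \<bar>\<psi> x\<bar>))"
    by (subst nn_integral_eq_integral[symmetric]) (auto simp: abs_mult)
  also have "(LINT x|lborel. 2 * (\<bar>\<phi> x\<bar> * \<bar>\<psi> x\<bar>)) = 2 * inner (abs_l2 (\<lambda>x. \<bar>\<phi> x\<bar>)) (abs_l2 (\<lambda>x. \<bar>\<psi> x\<bar>))"
    using inner_l2.abs_eq[OF a] by simp
  also have "\<dots> \<le> 2 * (norm (abs_l2 \<phi>) * norm (abs_l2 \<psi>))"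
    using norm_cauchy_schwarz[of "abs_l2 (\<lambda>x. \<bar>\<phi> x\<bar>)" "abs_l2 (\<lambda>x. \<bar>\<psi> x\<bar>)"] norm[OF \<phi> a(1)] norm[OF \<psi> a(2)]
    by simp
  finally show ?thesis by (simp add: ennreal_leI)
qed

text \<open>Ladyzhenskaya's inequality, weakened to a bound by the \<open>H\<^sup>1\<close> norm. In dimension two, one factor
  \<open>\<phi>\<^sup>2\<close> is bounded by a function of the second coordinate only and the other one by a function of the
  first, so that the integral of \<open>\<phi>\<^sup>4\<close> is at most a product of two integrals over the plane. In
  dimension one, one factor is bounded by a constant.\<close>

lemma ladyzhenskaya:
  fixes \<phi> :: "'a::euclidean_space \<Rightarrow> real"
  assumes dim: "DIM('a) \<in> {1, 2}" and \<phi>: "\<phi> \<in> test_functions D"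
    and M: "norm (abs_l2 \<phi>) \<le> M" "\<And>b. b \<in> Basis \<Longrightarrow> norm (abs_l2 (pderiv_at b \<phi>)) \<le> M"
  shows "(\<integral>\<^sup>+x. ennreal ((\<phi> x) ^ 4) \<partial>lborel) \<le> ennreal (4 * M ^ 4)"
proof -
  have M0: "M \<ge> 0" using M(1) norm_ge_zero by (rule order_trans[rotated])
  have [measurable]: "\<phi> \<in> borel_measurable borel" by (rule test_functionsD(3)[OF \<phi>])
  define h where "h b x = ennreal (2 * \<bar>\<phi> x * pderiv_at b \<phi> x\<bar>)" for b x
  have h_meas[measurable]: "h b \<in> borel_measurable borel" if "b \<in> Basis" for b
    using test_functionsD(3)[OF test_function_pderiv[OF \<phi> that]] unfolding h_def by measurable
  have h_int: "(\<integral>\<^sup>+x. h b x \<partial>lborel) \<le> ennreal (2 * M\<^sup>2)" if b: "b \<in> Basis" for b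
  proof -
    have "(\<integral>\<^sup>+x. h b x \<partial>lborel) \<le> ennreal (2 * (norm (abs_l2 \<phi>) * norm (abs_l2 (pderiv_at b \<phi>))))"
      unfolding h_def
      using nn_integral_product_le[OF test_function_l2[OF \<phi>] test_function_l2[OF test_function_pderiv[OF \<phi> b]]] .
    also have "\<dots> \<le> ennreal (2 * M\<^sup>2)"
      using M(1) M(2)[OF b] M0 by (intro ennreal_leI) (auto simp: power2_eq_square intro!: mult_mono)
    finally show ?thesis .
  qed
  have line: "ennreal ((\<phi> (y + s *\<^sub>R b))\<^sup>2) \<le> (\<integral>\<^sup>+t. h b (y + t *\<^sub>R b) \<partial>lborel)" if "b \<in> Basis" for y s b
    unfolding h_def using square_le_line_integral[OF \<phi> that] .
  have sq: "ennreal ((\<phi> x) ^ 4) = ennreal ((\<phi> x)\<^sup>2) * ennreal ((\<phi> x)\<^sup>2)" for x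
    by (simp add: ennreal_mult[symmetric] power_add[symmetric])
  from dim consider "card (Basis :: 'a set) = 1" | "card (Basis :: 'a set) = 2" by auto
  then have "(\<integral>\<^sup>+x. ennreal ((\<phi> x) ^ 4) \<partial>lborel) \<le> ennreal (2 * M\<^sup>2) * ennreal (2 * M\<^sup>2)"
  proof cases
    case 1
    then obtain b where B: "Basis = {b::'a}" using card_1_singletonE by blast
    then have b: "b \<in> Basis" by blast
    let ?A = "\<integral>\<^sup>+x. h b x \<partial>lborel"
    have A: "ennreal ((\<phi> x)\<^sup>2) \<le> ?A" for x
      unfolding nn_integral_lborel_dim1[OF B h_meas[OF b]]
      using line[OF b, of 0 "x \<bullet> b"] euclidean_representation[of x] by (simp add: B)
    have "(\<integral>\<^sup>+x. ennreal ((\<phi> x) ^ 4) \<partial>lborel) \<le> (\<integral>\<^sup>+x. ?A * ennreal ((\<phi> x)\<^sup>2) \<partial>lborel)"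
      unfolding sq by (intro nn_integral_mono mult_right_mono A) simp
    also have "\<dots> = ?A * (\<integral>\<^sup>+x. ennreal ((\<phi> x)\<^sup>2) \<partial>lborel)"
      by (rule nn_integral_cmult) simp
    also have "(\<integral>\<^sup>+x. ennreal ((\<phi> x)\<^sup>2) \<partial>lborel) = ennreal ((norm (abs_l2 \<phi>))\<^sup>2)"
      unfolding power2_norm_eq_inner
      using test_function_l2[OF \<phi>] inner_l2.abs_eq[OF test_function_l2[OF \<phi>] test_function_l2[OF \<phi>]]
      by (subst nn_integral_eq_integral) (auto simp: l2_rel_refl_iff power2_eq_square)
    also have "?A * ennreal ((norm (abs_l2 \<phi>))\<^sup>2) \<le> ennreal (2 * M\<^sup>2) * ennreal (2 * M\<^sup>2)"
      using power_mono[OF M(1) norm_ge_zero, of 2] zero_le_power2[of M]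
      by (intro mult_mono h_int[OF b] ennreal_leI) (linarith | simp)+
    finally show ?thesis .
  next
    case 2
    then obtain b c where B: "Basis = {b, c::'a}" "b \<noteq> c" by (auto simp: card_2_iff)
    then have b: "b \<in> Basis" and c: "c \<in> Basis" by auto
    let ?A = "\<lambda>t. \<integral>\<^sup>+s. h b (s *\<^sub>R b + t *\<^sub>R c) \<partial>lborel"
    let ?B = "\<lambda>s. \<integral>\<^sup>+t. h c (s *\<^sub>R b + t *\<^sub>R c) \<partial>lborel"
    have T: "(\<lambda>p::real \<times> real. fst p *\<^sub>R b + snd p *\<^sub>R c) \<in> measurable (lborel \<Otimes>\<^sub>M lborel) borel"
      unfolding lborel_prod by (simp, intro borel_measurable_continuous_onI continuous_intros)
    have Bm: "?B \<in> borel_measurable lborel"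
      using lborel.borel_measurable_nn_integral_fst[OF measurable_compose[OF T h_meas[OF c]]] by simp
    have "?A \<in> borel_measurable lborel"
      using lborel.borel_measurable_nn_integral_fst[OF measurable_pair_swap[OF measurable_compose[OF T h_meas[OF b]]]]
      by (simp add: case_prod_unfold)
    then have Am: "?A \<in> borel_measurable borel" by simp
    have "(\<integral>\<^sup>+x. ennreal ((\<phi> x) ^ 4) \<partial>lborel)
        = (\<integral>\<^sup>+s. \<integral>\<^sup>+t. ennreal ((\<phi> (s *\<^sub>R b + t *\<^sub>R c)) ^ 4) \<partial>lborel \<partial>lborel)"
      by (rule nn_integral_lborel_dim2(1)[OF B]) simp
    also have "\<dots> \<le> (\<integral>\<^sup>+s. \<integral>\<^sup>+t. ?A t * ?B s \<partial>lborel \<partial>lborel)"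
    proof (intro nn_integral_mono)
      fix s t
      have "ennreal ((\<phi> (s *\<^sub>R b + t *\<^sub>R c))\<^sup>2) \<le> ?A t"
        using line[OF b, of "t *\<^sub>R c" s] by (simp add: add.commute)
      moreover have "ennreal ((\<phi> (s *\<^sub>R b + t *\<^sub>R c))\<^sup>2) \<le> ?B s"
        using line[OF c, of "s *\<^sub>R b" t] by simp
      ultimately show "ennreal ((\<phi> (s *\<^sub>R b + t *\<^sub>R c)) ^ 4) \<le> ?A t * ?B s"
        unfolding sq by (intro mult_mono) auto
    qed
    also have "\<dots> = (\<integral>\<^sup>+s. (\<integral>\<^sup>+t. ?A t \<partial>lborel) * ?B s \<partial>lborel)"
      using Am by (intro nn_integral_cong nn_integral_multc) simp
    also have "\<dots> = (\<integral>\<^sup>+t. ?A t \<partial>lborel) * (\<integral>\<^sup>+s. ?B s \<partial>lborel)"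
      by (rule nn_integral_cmult[OF Bm])
    also have "\<dots> = (\<integral>\<^sup>+x. h b x \<partial>lborel) * (\<integral>\<^sup>+x. h c x \<partial>lborel)"
      using nn_integral_lborel_dim2(2)[OF B h_meas[OF b]] nn_integral_lborel_dim2(1)[OF B h_meas[OF c]] by simp
    also have "\<dots> \<le> ennreal (2 * M\<^sup>2) * ennreal (2 * M\<^sup>2)"
      by (intro mult_mono h_int b c) auto
    finally show ?thesis .
  qed
  also have "ennreal (2 * M\<^sup>2) * ennreal (2 * M\<^sup>2) = ennreal (4 * M ^ 4)"
    by (simp add: ennreal_mult[symmetric] power_add[symmetric])
  finally show ?thesis .
qed

text \<open>The approximating test functions are bounded in \<open>L\<^sup>4\<close>, and a subsequence of them converges almost
  everywhere; Fatou's lemma passes the bound on to the limit.\<close>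

lemma H10_L4:
  fixes D :: "'a::euclidean_space set"
  assumes dim: "DIM('a) \<in> {1, 2}" and D: "open D" and u: "u \<in> H10 D"
  shows "integrable lborel (\<lambda>x. (rep_l2 u x) ^ 4)"
proof -
  obtain \<phi> where \<phi>: "\<And>n. \<phi> n \<in> test_functions D" and lim: "(\<lambda>n. abs_l2 (\<phi> n)) \<longlonglongrightarrow> u"
    "\<And>b. b \<in> Basis \<Longrightarrow> (\<lambda>n. abs_l2 (pderiv_at b (\<phi> n))) \<longlonglongrightarrow> weak_partial D b u"
    using H10_approximation[OF D u] by metis
  have [measurable]: "\<phi> n \<in> borel_measurable borel" for n by (rule test_functionsD(3)[OF \<phi>])
  have "\<exists>M. \<forall>n. norm (abs_l2 (\<phi> n)) \<le> M"
    using convergent_imp_Bseq[OF convergentI[OF lim(1)]] by (auto simp: Bseq_def)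
  then obtain M0 where M0: "\<And>n. norm (abs_l2 (\<phi> n)) \<le> M0" by blast
  have "\<forall>b\<in>Basis. \<exists>M. \<forall>n. norm (abs_l2 (pderiv_at b (\<phi> n))) \<le> M"
    using convergent_imp_Bseq[OF convergentI[OF lim(2)]] unfolding Bseq_def by blast
  then obtain m where m: "\<And>b n. b \<in> Basis \<Longrightarrow> norm (abs_l2 (pderiv_at b (\<phi> n))) \<le> m b" by metis
  define M where "M = max M0 (Max (m ` Basis))"
  have M: "norm (abs_l2 (\<phi> n)) \<le> M" "\<And>b. b \<in> Basis \<Longrightarrow> norm (abs_l2 (pderiv_at b (\<phi> n))) \<le> M" for n
  proof -
    show "norm (abs_l2 (\<phi> n)) \<le> M" using M0 by (simp add: M_def le_max_iff_disj)
    fix b :: 'a assume b: "b \<in> Basis"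
    then have "m b \<le> Max (m ` Basis)" by simp
    then show "norm (abs_l2 (pderiv_at b (\<phi> n))) \<le> M"
      using m[OF b, of n] by (simp add: M_def)
  qed
  have sq: "integrable lborel (\<lambda>x. (rep_l2 u x - \<phi> n x)\<^sup>2)
      \<and> (LINT x|lborel. (rep_l2 u x - \<phi> n x)\<^sup>2) = (norm (u - abs_l2 (\<phi> n)))\<^sup>2" for n
  proof
    have ae: "AE x in lborel. (rep_l2 (u - abs_l2 (\<phi> n)) x)\<^sup>2 = (rep_l2 u x - \<phi> n x)\<^sup>2"
      using rep_diff_l2[of u "abs_l2 (\<phi> n)"] rep_abs_l2[OF test_function_l2[OF \<phi>[of n]]]
      by eventually_elim simp
    show "integrable lborel (\<lambda>x. (rep_l2 u x - \<phi> n x)\<^sup>2)"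
      using integrable_rep_sq[of "u - abs_l2 (\<phi> n)"] by (rule integrable_cong_AE_imp) (use ae in \<open>auto elim: eventually_mono\<close>)
    show "(LINT x|lborel. (rep_l2 u x - \<phi> n x)\<^sup>2) = (norm (u - abs_l2 (\<phi> n)))\<^sup>2"
      unfolding norm_l2_rep using ae by (intro integral_cong_AE) (auto elim: eventually_mono)
  qed
  have "(\<lambda>n. (norm (u - abs_l2 (\<phi> n)))\<^sup>2) \<longlonglongrightarrow> (norm (u - u))\<^sup>2"
    by (intro tendsto_intros lim)
  then have "(\<lambda>n. LINT x|lborel. norm ((rep_l2 u x - \<phi> n x)\<^sup>2)) \<longlonglongrightarrow> 0"
    using sq by simp
  from tendsto_L1_AE_subseq[OF conjunct1[OF sq] this] obtain r :: "nat \<Rightarrow> nat" where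
    r: "AE x in lborel. (\<lambda>n. (rep_l2 u x - \<phi> (r n) x)\<^sup>2) \<longlonglongrightarrow> 0" by blast
  have ae: "AE x in lborel. ennreal ((rep_l2 u x) ^ 4) = liminf (\<lambda>n. ennreal ((\<phi> (r n) x) ^ 4))"
    using r
  proof eventually_elim
    case (elim x)
    then have "(\<lambda>n. \<bar>rep_l2 u x - \<phi> (r n) x\<bar>) \<longlonglongrightarrow> 0"
      using tendsto_real_sqrt[OF elim] by simp
    then have "(\<lambda>n. rep_l2 u x - (rep_l2 u x - \<phi> (r n) x)) \<longlonglongrightarrow> rep_l2 u x - 0"
      by (intro tendsto_diff tendsto_const) (simp only: tendsto_rabs_zero_iff)
    then have "(\<lambda>n. \<phi> (r n) x) \<longlonglongrightarrow> rep_l2 u x" by simp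
    then have "(\<lambda>n. ennreal ((\<phi> (r n) x) ^ 4)) \<longlonglongrightarrow> ennreal ((rep_l2 u x) ^ 4)"
      by (intro tendsto_intros)
    then show ?case by (intro lim_imp_Liminf[symmetric] trivial_limit_sequentially)
  qed
  have "(\<integral>\<^sup>+x. ennreal ((rep_l2 u x) ^ 4) \<partial>lborel) = (\<integral>\<^sup>+x. liminf (\<lambda>n. ennreal ((\<phi> (r n) x) ^ 4)) \<partial>lborel)"
    using ae by (rule nn_integral_cong_AE)
  also have "\<dots> \<le> liminf (\<lambda>n. \<integral>\<^sup>+x. ennreal ((\<phi> (r n) x) ^ 4) \<partial>lborel)"
    by (rule nn_integral_liminf) simp
  also have "\<dots> \<le> liminf (\<lambda>n. ennreal (4 * M ^ 4))"
    using ladyzhenskaya[OF dim \<phi> M] by (intro Liminf_mono) auto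
  also have "\<dots> < \<infinity>" by (simp add: Liminf_const)
  finally show ?thesis
    by (intro integrableI_nonneg) auto
qed

section \<open>The discrete space\<close>

text \<open>One eigenmode of the exponential integrator, for a constant force \<open>g\<close>. For \<open>l = 0\<close> the powers with
  negative exponents are zero, like \<open>0 powr a\<close> for any \<open>a\<close>, and the step is the identity.\<close>

lemma energy_conserved_mode:
  fixes l t u v g u' v' :: real
  assumes l: "l \<ge> 0"
    and u': "u' = cos (t * sqrt l) * u + l powr (- 1 / 2) * (sin (t * sqrt l) * v)
      - l powr (- 1) * (g - cos (t * sqrt l) * g)"
    and v': "v' = - (l powr (1 / 2) * (sin (t * sqrt l) * u)) + cos (t * sqrt l) * v
      - l powr (- 1 / 2) * (sin (t * sqrt l) * g)"
  shows "l * u'\<^sup>2 / 2 + v'\<^sup>2 / 2 + g * (u' - u) = l * u\<^sup>2 / 2 + v\<^sup>2 / 2"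
proof (cases "l = 0")
  case True
  then show ?thesis using u' v' by simp
next
  case False
  define s where "s = sqrt l"
  have s: "s > 0" "l = s * s" using l False by (auto simp: s_def)
  have pw: "l powr (- 1 / 2) = 1 / s" "l powr (1 / 2) = s" "l powr (- 1) = 1 / (s * s)"
    using l False unfolding s_def
    by (simp_all add: powr_half_sqrt[symmetric] powr_minus_divide powr_add[symmetric])
  let ?C = "cos (t * s)" and ?S = "sin (t * s)"
  define w where "w = s * u + g / s"
  \<comment> \<open>The shift moves the equilibrium \<open>u = - g / l\<close> to the origin; then the step is a rotation.\<close>
  have a: "s * u' + g / s = ?C * w + ?S * v"
    unfolding u' s_def[symmetric] pw w_def using s(1) by (simp add: field_simps)
  have b: "v' = ?C * v - ?S * w"
    unfolding v' s_def[symmetric] pw w_def using s(1) by (simp add: field_simps)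
  have "(s * u' + g / s)\<^sup>2 + v'\<^sup>2 = (?C\<^sup>2 + ?S\<^sup>2) * (w\<^sup>2 + v\<^sup>2)"
    unfolding a b by algebra
  then have "(s * u' + g / s)\<^sup>2 + v'\<^sup>2 = (s * u + g / s)\<^sup>2 + v\<^sup>2" by (simp add: w_def)
  moreover have "(s * x + g / s)\<^sup>2 = l * x\<^sup>2 + 2 * (g * x) + (g / s)\<^sup>2" for x
    using s(1) unfolding s(2) by (simp add: power2_eq_square field_simps)
  ultimately show ?thesis by (simp add: algebra_simps)
qed

text \<open>A finite-dimensional subspace of \<open>H\<^sup>1 \<inter> L\<^sup>4\<close>, represented by an orthonormal basis that is orthogonal
  for the Dirichlet form as well, that is, consists of eigenvectors of \<open>\<Lambda>\<^sub>h\<close>.\<close>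

locale discrete_eigenbasis =
  fixes D :: "'a::euclidean_space set" and E :: "'a l2 set"
  assumes open_D: "open D" and bounded_D: "bounded D"
    and orthonormal_E: "orthonormal E" and finite_E: "finite E"
    and E_H1: "span E \<subseteq> H1 D"
    and E_L4: "\<And>u. u \<in> span E \<Longrightarrow> integrable lborel (\<lambda>x. (rep_l2 u x) ^ 4)"
    and diagonal: "\<And>e e'. e \<in> E \<Longrightarrow> e' \<in> E \<Longrightarrow> e \<noteq> e' \<Longrightarrow> grad_inner D e e' = 0"

lemma discrete_space_eigenbasis:
  fixes D :: "'a::euclidean_space set"
  assumes dim: "DIM('a) \<in> {1, 2}" and D: "open D" "bounded D" and Vh: "discrete_space D Vh"
  obtains E where "discrete_eigenbasis D E" "Vh = span E"
proof -
  from Vh obtain B where B: "finite B" "Vh = span B" and H: "Vh \<subseteq> H10 D"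
    by (auto simp: discrete_space_def)
  have H1: "Vh \<subseteq> H1 D" using H by (auto simp: H10_def)
  interpret symmetric_form Vh "grad_inner D"
  proof
    show "subspace Vh" using B by simp
  qed (use H1 in \<open>auto simp: grad_inner_add_left[OF D(1)] grad_inner_scaleR_left[OF D(1)] subset_iff
      intro: grad_inner_commute\<close>)
  obtain E where E: "finite E" "orthonormal E" "span E = Vh"
    "\<And>e e'. e \<in> E \<Longrightarrow> e' \<in> E \<Longrightarrow> e \<noteq> e' \<Longrightarrow> grad_inner D e e' = 0"
    using ex_diagonalising_basis[OF B] by blast
  have "discrete_eigenbasis D E"
    by unfold_locales (use E D H H1 H10_L4[OF dim D(1)] in auto)
  then show thesis using E(3) that by blast
qed

context discrete_eigenbasis
begin

definition lam :: "'a l2 \<Rightarrow> real" where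
  "lam e = grad_inner D e e"

lemma lam_nonneg: "lam e \<ge> 0"
  by (simp add: lam_def grad_inner_nonneg)

lemma sum_in_span: "(\<Sum>e\<in>E. c e *\<^sub>R e) \<in> span E"
  by (intro span_sum span_scale span_base)

lemmas inner_sum_E = orthonormal_inner_sum[OF orthonormal_E finite_E]
lemmas expand_E = orthonormal_expand[OF orthonormal_E finite_E]
lemmas inner_expand_E = orthonormal_inner_expand[OF orthonormal_E finite_E]
lemmas eqI_E = orthonormal_eqI[OF orthonormal_E finite_E]

lemma norm_expand_E: "u \<in> span E \<Longrightarrow> (norm u)\<^sup>2 = (\<Sum>e\<in>E. (inner u e)\<^sup>2)"
  using inner_expand_E[of u u] by (simp only: power2_norm_eq_inner) (simp add: power2_eq_square)

lemma span_L2_on: "span E \<subseteq> L2_on D"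
  using E_H1 by (auto simp: H1_def)

text \<open>Both \<^const>\<open>P_h\<close> and \<^const>\<open>Lambda_h\<close> are defined as the Riesz representative in the discrete space
  of a functional that is linear there; the assumption expresses this linearity.\<close>

lemma riesz_representative:
  assumes "\<And>z. z \<in> span E \<Longrightarrow> l z = (\<Sum>e\<in>E. inner z e * l e)"
  shows "(THE w. w \<in> span E \<and> (\<forall>z\<in>span E. inner w z = l z)) = (\<Sum>e\<in>E. l e *\<^sub>R e)"
proof (rule the_equality)
  show "(\<Sum>e\<in>E. l e *\<^sub>R e) \<in> span E \<and> (\<forall>z\<in>span E. inner (\<Sum>e\<in>E. l e *\<^sub>R e) z = l z)"
    using assms inner_expand_E inner_sum_E[of _ l] by (auto simp: sum_in_span mult.commute)
next
  fix w assume "w \<in> span E \<and> (\<forall>z\<in>span E. inner w z = l z)"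
  then show "w = (\<Sum>e\<in>E. l e *\<^sub>R e)"
    using inner_sum_E[of _ l] by (intro eqI_E) (auto simp: sum_in_span span_base)
qed

lemma P_h_inner: "P_h (span E) (inner u) = (\<Sum>e\<in>E. inner u e *\<^sub>R e)"
  unfolding P_h_def by (rule riesz_representative) (simp add: inner_expand_E mult.commute)

lemma grad_inner_expand:
  assumes u: "u \<in> span E" and z: "z \<in> span E"
  shows "grad_inner D u z = (\<Sum>e\<in>E. inner z e * (lam e * inner u e))"
proof -
  interpret symmetric_form "span E" "grad_inner D"
    by unfold_locales (use E_H1 in \<open>auto simp: grad_inner_add_left[OF open_D] grad_inner_scaleR_left[OF open_D] subset_iff
      intro: grad_inner_commute\<close>)
  note ex = form_expand[OF orthonormal_E finite_E refl]
  have e: "grad_inner D e z = inner z e * lam e" if "e \<in> E" for e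
  proof -
    have "grad_inner D z e = (\<Sum>e'\<in>E. inner z e' * grad_inner D e' e)"
      by (rule ex[OF z span_base[OF that]])
    also have "\<dots> = (\<Sum>e'\<in>E. if e' = e then inner z e * lam e else 0)"
      using diagonal that by (intro sum.cong) (auto simp: lam_def)
    finally show ?thesis using finite_E that by (simp add: grad_inner_commute[of D e z])
  qed
  show ?thesis
    unfolding ex[OF u z] using e by (intro sum.cong) auto
qed

lemma Lambda_h_expand:
  assumes "u \<in> span E"
  shows "Lambda_h D (span E) u = (\<Sum>e\<in>E. (lam e * inner u e) *\<^sub>R e)"
proof -
  have e: "grad_inner D u e = lam e * inner u e" if "e \<in> E" for e
  proof -
    have "grad_inner D u e = (\<Sum>e'\<in>E. if e' = e then lam e * inner u e else 0)"
      unfolding grad_inner_expand[OF assms span_base[OF that]]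
      using that by (intro sum.cong) (auto simp: orthonormal_inner[OF orthonormal_E])
    then show ?thesis using finite_E that by simp
  qed
  have "Lambda_h D (span E) u = (\<Sum>e\<in>E. grad_inner D u e *\<^sub>R e)"
    unfolding Lambda_h_def
    by (rule riesz_representative) (simp add: grad_inner_expand[OF assms] e)
  then show ?thesis using e by (simp cong: sum.cong)
qed

lemma fun_Lambda_h_expand:
  assumes u: "u \<in> span E"
  shows "fun_Lambda_h D (span E) g u = (\<Sum>e\<in>E. (g (lam e) * inner u e) *\<^sub>R e)"
  unfolding fun_Lambda_h_def
proof (rule fun_of_op_finite[OF orthonormal_E finite_E _ _ u])
  show "Lambda_h D (span E) e = lam e *\<^sub>R e" if e: "e \<in> E" for e
  proof -
    have "(\<Sum>e'\<in>E. (lam e' * inner e e') *\<^sub>R e') = (\<Sum>e'\<in>E. if e' = e then lam e *\<^sub>R e else 0)"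
      using e by (intro sum.cong) (auto simp: orthonormal_inner[OF orthonormal_E])
    then show ?thesis using finite_E e by (simp add: Lambda_h_expand[OF span_base[OF e]])
  qed
  show "inner (Lambda_h D (span E) x) y = inner x (Lambda_h D (span E) y)"
    if "x \<in> span E" "y \<in> span E" for x y
    using that by (simp add: Lambda_h_expand inner_sum_left inner_sum_right algebra_simps inner_commute[of y])
qed

lemma fun_Lambda_h:
  assumes "u \<in> span E"
  shows "fun_Lambda_h D (span E) g u \<in> span E"
    and "e \<in> E \<Longrightarrow> inner (fun_Lambda_h D (span E) g u) e = g (lam e) * inner u e"
  using inner_sum_E[of e "\<lambda>e. g (lam e) * inner u e"] fun_Lambda_h_expand[OF assms, of g]
  by (simp_all add: sum_in_span)

text \<open>The deterministic part of the scheme, with the averaged nonlinearity replaced by an arbitrary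
  element \<open>G\<close>.\<close>

definition step_U :: "real \<Rightarrow> 'a l2 \<Rightarrow> 'a l2 \<Rightarrow> 'a l2 \<Rightarrow> 'a l2" where
  "step_U \<tau> u v G = C_h D (span E) \<tau> u + Lambda_h_pow D (span E) (- 1/2) (S_h D (span E) \<tau> v)
     - Lambda_h_pow D (span E) (- 1) (G - C_h D (span E) \<tau> G)"

definition step_V :: "real \<Rightarrow> 'a l2 \<Rightarrow> 'a l2 \<Rightarrow> 'a l2 \<Rightarrow> 'a l2" where
  "step_V \<tau> u v G = - Lambda_h_pow D (span E) (1/2) (S_h D (span E) \<tau> u) + C_h D (span E) \<tau> v
     - Lambda_h_pow D (span E) (- 1/2) (S_h D (span E) \<tau> G)"

lemma step_in_span:
  assumes "u \<in> span E" "v \<in> span E" "G \<in> span E"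
  shows "step_U \<tau> u v G \<in> span E" "step_V \<tau> u v G \<in> span E"
  using assms unfolding step_U_def step_V_def C_h_def S_h_def Lambda_h_pow_def
  by (auto intro!: span_add span_diff span_neg fun_Lambda_h(1))

lemma step_coords:
  assumes "u \<in> span E" "v \<in> span E" "G \<in> span E" "e \<in> E"
  shows "inner (step_U \<tau> u v G) e = cos (\<tau> * sqrt (lam e)) * inner u e
      + lam e powr (- 1 / 2) * (sin (\<tau> * sqrt (lam e)) * inner v e)
      - lam e powr (- 1) * (inner G e - cos (\<tau> * sqrt (lam e)) * inner G e)"
    and "inner (step_V \<tau> u v G) e = - (lam e powr (1 / 2) * (sin (\<tau> * sqrt (lam e)) * inner u e))
      + cos (\<tau> * sqrt (lam e)) * inner v e
      - lam e powr (- 1 / 2) * (sin (\<tau> * sqrt (lam e)) * inner G e)"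
  using assms unfolding step_U_def step_V_def C_h_def S_h_def Lambda_h_pow_def
  by (simp_all add: inner_add_left inner_diff_left fun_Lambda_h span_diff)

lemma step_energy:
  fixes \<tau> :: real
  assumes "u \<in> span E" "v \<in> span E" "G \<in> span E"
  defines "u' \<equiv> step_U \<tau> u v G" and "v' \<equiv> step_V \<tau> u v G"
  shows "grad_inner D u' u' / 2 + (norm v')\<^sup>2 / 2 + inner G (u' - u) = grad_inner D u u / 2 + (norm v)\<^sup>2 / 2"
proof -
  have sp: "u' \<in> span E" "v' \<in> span E" using step_in_span[OF assms(1-3)] by (auto simp: u'_def v'_def)
  have "lam e * (inner u' e)\<^sup>2 / 2 + (inner v' e)\<^sup>2 / 2 + inner G e * (inner u' e - inner u e)
      = lam e * (inner u e)\<^sup>2 / 2 + (inner v e)\<^sup>2 / 2" if "e \<in> E" for e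
    unfolding u'_def v'_def
    by (rule energy_conserved_mode[OF lam_nonneg step_coords[OF assms(1-3) that]])
  then have "(\<Sum>e\<in>E. lam e * (inner u' e)\<^sup>2 / 2 + (inner v' e)\<^sup>2 / 2 + inner G e * (inner u' e - inner u e))
      = (\<Sum>e\<in>E. lam e * (inner u e)\<^sup>2 / 2 + (inner v e)\<^sup>2 / 2)"
    by (rule sum.cong[OF refl])
  moreover have "inner G (u' - u) = (\<Sum>e\<in>E. inner G e * (inner u' e - inner u e))"
    using inner_expand_E[OF span_diff[OF sp(1) assms(1)], of G] by (simp add: inner_diff_left)
  moreover have "grad_inner D w w = (\<Sum>e\<in>E. lam e * (inner w e)\<^sup>2)" if "w \<in> span E" for w
    unfolding grad_inner_expand[OF that that] by (simp add: power2_eq_square mult_ac)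
  ultimately show ?thesis
    by (simp add: sp assms(1,2) norm_expand_E sum.distrib sum_divide_distrib)
qed

lemma rep_expand:
  assumes "u \<in> span E"
  shows "AE x in lborel. rep_l2 u x = (\<Sum>e\<in>E. inner u e * rep_l2 e x)"
proof -
  have "AE x in lborel. \<forall>e\<in>E. rep_l2 (inner u e *\<^sub>R e) x = inner u e * rep_l2 e x"
    using finite_E by (intro AE_finite_allI) (auto intro: rep_scaleR_l2)
  moreover have "AE x in lborel. rep_l2 u x = (\<Sum>e\<in>E. rep_l2 (inner u e *\<^sub>R e) x)"
    using rep_sum_l2[OF finite_E, of "\<lambda>e. inner u e *\<^sub>R e"] expand_E[OF assms] by simp
  ultimately show ?thesis by eventually_elim simp
qed

end

section \<open>The cubic nonlinearity on the discrete space\<close>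

lemma pow4_add_le: "(\<bar>a\<bar> + \<bar>b\<bar>) ^ 4 \<le> 8 * (a ^ 4 + b ^ 4)" for a b :: real
proof -
  have sq: "(x + y)\<^sup>2 \<le> 2 * (x\<^sup>2 + y\<^sup>2)" for x y :: real
    using zero_le_power2[of "x - y"] by (simp add: power2_sum power2_diff)
  have "((\<bar>a\<bar> + \<bar>b\<bar>)\<^sup>2)\<^sup>2 \<le> (2 * (a\<^sup>2 + b\<^sup>2))\<^sup>2"
    using sq[of "\<bar>a\<bar>" "\<bar>b\<bar>"] by (intro power_mono) auto
  also have "\<dots> \<le> 4 * (2 * ((a\<^sup>2)\<^sup>2 + (b\<^sup>2)\<^sup>2))"
  proof -
    have four: "(2::real)\<^sup>2 = 4" by simp
    show ?thesis using sq[of "a\<^sup>2" "b\<^sup>2"] unfolding power_mult_distrib[of 2] four by linarith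
  qed
  finally show ?thesis by simp
qed

lemma integrable_pow4_add:
  fixes g h :: "'a::euclidean_space \<Rightarrow> real"
  assumes [measurable]: "g \<in> borel_measurable borel" "h \<in> borel_measurable borel"
    and "integrable lborel (\<lambda>x. (g x) ^ 4)" "integrable lborel (\<lambda>x. (h x) ^ 4)"
  shows "integrable lborel (\<lambda>x. (\<bar>g x\<bar> + \<bar>h x\<bar>) ^ 4)"
  by (rule Bochner_Integration.integrable_bound[where f = "\<lambda>x. 8 * ((g x) ^ 4 + (h x) ^ 4)"])
    (use assms pow4_add_le in auto)

lemma integrable_pow4_sum:
  fixes g :: "'i \<Rightarrow> 'a::euclidean_space \<Rightarrow> real"
  assumes "finite I" "\<And>i. i \<in> I \<Longrightarrow> g i \<in> borel_measurable borel \<and> integrable lborel (\<lambda>x. (g i x) ^ 4)"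
  shows "integrable lborel (\<lambda>x. (\<Sum>i\<in>I. \<bar>g i x\<bar>) ^ 4)"
  using assms
proof (induction I)
  case (insert i I)
  have "integrable lborel (\<lambda>x. (\<bar>g i x\<bar> + \<bar>\<Sum>i\<in>I. \<bar>g i x\<bar>\<bar>) ^ 4)"
    using insert by (intro integrable_pow4_add) (auto intro!: borel_measurable_sum borel_measurable_abs)
  then show ?case using insert by (simp add: abs_of_nonneg sum_nonneg)
qed simp

lemma cubic_growth:
  fixes f :: "real poly"
  assumes "degree f \<le> 3"
  shows "\<exists>K\<ge>0. \<forall>y. \<bar>poly f y\<bar> \<le> K * (1 + \<bar>y\<bar> ^ 3)"
proof (intro exI conjI allI)
  let ?K = "\<Sum>i\<le>degree f. \<bar>coeff f i\<bar>"
  show "?K \<ge> 0" by (intro sum_nonneg) simp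
  fix y :: real
  have le: "\<bar>y\<bar> ^ i \<le> 1 + \<bar>y\<bar> ^ 3" if "i \<le> 3" for i
  proof (cases "\<bar>y\<bar> \<le> 1")
    case True
    then show ?thesis using power_le_one[of "\<bar>y\<bar>" i] by (simp add: add_increasing2)
  next
    case False
    then have "\<bar>y\<bar> ^ i \<le> \<bar>y\<bar> ^ 3" by (intro power_increasing that) auto
    then show ?thesis by linarith
  qed
  have "\<bar>poly f y\<bar> \<le> (\<Sum>i\<le>degree f. \<bar>coeff f i\<bar> * \<bar>y\<bar> ^ i)"
    unfolding poly_altdef by (rule order_trans[OF sum_abs]) (simp add: abs_mult power_abs)
  also have "\<dots> \<le> (\<Sum>i\<le>degree f. \<bar>coeff f i\<bar> * (1 + \<bar>y\<bar> ^ 3))"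
    using le assms by (intro sum_mono mult_left_mono) auto
  finally show "\<bar>poly f y\<bar> \<le> ?K * (1 + \<bar>y\<bar> ^ 3)" by (simp add: sum_distrib_right)
qed

text \<open>For a primitive \<open>F\<close> of \<open>f\<close>, this is the divided difference of \<open>F\<close>.\<close>

definition avg :: "real poly \<Rightarrow> real \<Rightarrow> real \<Rightarrow> real" where
  "avg f a b = (LINT \<theta>:{0..1}|lborel. poly f (a + \<theta> * (b - a)))"

lemma measurable_poly [measurable]: "poly (f :: real poly) \<in> borel_measurable borel"
  by (intro borel_measurable_continuous_onI continuous_intros)

lemma avg_measurable:
  assumes [measurable]: "g \<in> borel_measurable N" "h \<in> borel_measurable N"
  shows "(\<lambda>x. avg f (g x) (h x)) \<in> borel_measurable N"
proof -
  have "(\<lambda>(x, \<theta>). indicator {0..1::real} \<theta> *\<^sub>R poly f (g x + \<theta> * (h x - g x))) \<in> borel_measurable (N \<Otimes>\<^sub>M lborel)"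
    by measurable
  then show ?thesis
    unfolding avg_def set_lebesgue_integral_def by (rule lborel.borel_measurable_lebesgue_integral)
qed

locale primitive =
  fixes f :: "real poly" and F :: "real \<Rightarrow> real"
  assumes degree_f: "degree f \<le> 3"
    and F_deriv: "\<And>x. (F has_real_derivative poly f x) (at x)"
begin

lemma F_measurable [measurable]: "F \<in> borel_measurable borel"
  using F_deriv by (intro borel_measurable_continuous_onI continuous_at_imp_continuous_on) (auto intro: DERIV_isCont)

lemma avg_mult: "avg f a b * (b - a) = F b - F a"
proof -
  have "((\<lambda>\<theta>. F (a + \<theta> * (b - a))) has_real_derivative poly f (a + \<theta> * (b - a)) * (b - a)) (at \<theta>)" for \<theta>
    by (rule DERIV_chain'[OF _ F_deriv, of _ "b - a", THEN DERIV_cong]) (auto intro!: derivative_eq_intros)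
  then have "has_bochner_integral lborel (\<lambda>\<theta>. (poly f (a + \<theta> * (b - a)) * (b - a)) * indicator {0..1} \<theta>)
      (F (a + 1 * (b - a)) - F (a + 0 * (b - a)))"
    by (intro has_bochner_integral_FTC_Icc_real) (auto intro!: continuous_intros)
  then have "(LINT \<theta>|lborel. (poly f (a + \<theta> * (b - a)) * (b - a)) * indicator {0..1} \<theta>) = F b - F a"
    by (simp add: has_bochner_integral_iff)
  moreover have "(LINT \<theta>|lborel. (poly f (a + \<theta> * (b - a)) * (b - a)) * indicator {0..1} \<theta>) = avg f a b * (b - a)"
    unfolding avg_def set_lebesgue_integral_def
    by (subst integral_mult_left_zero[symmetric]) (simp add: mult_ac)
  ultimately show ?thesis by simp
qed

lemma F_mvt: "\<exists>\<xi>. \<bar>\<xi>\<bar> \<le> \<bar>a\<bar> + \<bar>b\<bar> \<and> F b - F a = (b - a) * poly f \<xi>"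
proof (rule linorder_cases[of a b])
  assume "a < b"
  then obtain \<xi> where "a < \<xi>" "\<xi> < b" "F b - F a = (b - a) * poly f \<xi>"
    using MVT2[of a b F "poly f"] F_deriv by blast
  then show ?thesis by (intro exI[of _ \<xi>]) auto
next
  assume "b < a"
  then obtain \<xi> where "b < \<xi>" "\<xi> < a" "F a - F b = (a - b) * poly f \<xi>"
    using MVT2[of b a F "poly f"] F_deriv by blast
  then show ?thesis by (intro exI[of _ \<xi>]) (auto simp: algebra_simps)
next
  assume "a = b"
  then show ?thesis by (intro exI[of _ a]) auto
qed

lemma avg_value: "\<exists>\<xi>. \<bar>\<xi>\<bar> \<le> \<bar>a\<bar> + \<bar>b\<bar> \<and> avg f a b = poly f \<xi>"
proof (cases "a = b")
  case True
  then show ?thesis by (intro exI[of _ a]) (simp add: avg_def set_lebesgue_integral_def)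
next
  case False
  obtain \<xi> where "\<bar>\<xi>\<bar> \<le> \<bar>a\<bar> + \<bar>b\<bar>" "F b - F a = (b - a) * poly f \<xi>" using F_mvt by blast
  moreover from this(2) have "avg f a b = poly f \<xi>"
    using False avg_mult[of a b] by (simp add: mult.commute)
  ultimately show ?thesis by blast
qed

lemma F_growth: "\<exists>K\<ge>0. \<forall>y. \<bar>F y\<bar> \<le> K * (1 + y ^ 4)"
proof -
  obtain K where K: "K \<ge> 0" "\<And>y. \<bar>poly f y\<bar> \<le> K * (1 + \<bar>y\<bar> ^ 3)"
    using cubic_growth[OF degree_f] by blast
  have "\<bar>F y\<bar> \<le> (\<bar>F 0\<bar> + 2 * K) * (1 + y ^ 4)" for y
  proof -
    obtain \<xi> where \<xi>: "\<bar>\<xi>\<bar> \<le> \<bar>y\<bar>" "F y - F 0 = y * poly f \<xi>" using F_mvt[of 0 y] by auto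
    have "\<bar>poly f \<xi>\<bar> \<le> K * (1 + \<bar>y\<bar> ^ 3)"
      using K(2)[of \<xi>] K(1) power_mono[OF \<xi>(1), of 3]
      by (meson abs_ge_zero add_left_mono mult_left_mono order_trans)
    then have "\<bar>y * poly f \<xi>\<bar> \<le> \<bar>y\<bar> * (K * (1 + \<bar>y\<bar> ^ 3))"
      unfolding abs_mult by (intro mult_left_mono) auto
    also have "\<dots> = K * (\<bar>y\<bar> + y ^ 4)"
    proof -
      have "\<bar>y\<bar> * \<bar>y\<bar> ^ 3 = \<bar>y\<bar> ^ Suc 3" by (rule power_Suc[symmetric])
      also have "\<dots> = y ^ 4" by simp
      finally have "\<bar>y\<bar> * (1 + \<bar>y\<bar> ^ 3) = \<bar>y\<bar> + y ^ 4" by (simp only: distrib_left mult_1_right)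
      then show ?thesis by (metis mult.left_commute)
    qed
    also have "\<dots> \<le> K * (2 * (1 + y ^ 4))"
    proof (intro mult_left_mono K)
      have "\<bar>y\<bar> \<le> 1 + y ^ 4"
      proof (cases "\<bar>y\<bar> \<le> 1")
        case True
        then show ?thesis by (simp add: add_increasing2)
      next
        case False
        then have "\<bar>y\<bar> ^ 1 \<le> \<bar>y\<bar> ^ 4" by (intro power_increasing) auto
        then show ?thesis by simp
      qed
      then show "\<bar>y\<bar> + y ^ 4 \<le> 2 * (1 + y ^ 4)" by simp
    qed
    finally have "\<bar>F y\<bar> \<le> \<bar>F 0\<bar> + 2 * K * (1 + y ^ 4)" using \<xi>(2) by linarith
    also have "\<dots> \<le> \<bar>F 0\<bar> * (1 + y ^ 4) + 2 * K * (1 + y ^ 4)"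
      using mult_left_mono[of 1 "1 + y ^ 4" "\<bar>F 0\<bar>"] by simp
    finally show ?thesis by (simp add: algebra_simps)
  qed
  then show ?thesis using K(1) by (intro exI[of _ "\<bar>F 0\<bar> + 2 * K"]) auto
qed

end

locale discrete_nonlinear = discrete_eigenbasis D E + primitive f F
  for D :: "'a::euclidean_space set" and E f F
begin

definition F_int :: "'a l2 \<Rightarrow> real" where
  "F_int u = (LINT x:D|lborel. F (rep_l2 u x))"

lemma D_sets [measurable]: "D \<in> sets borel"
  using open_D by simp

lemma integrable_indicator_D: "integrable lborel (indicator D :: 'a \<Rightarrow> real)"
  using emeasure_bounded_finite[OF bounded_D] by (intro integrable_real_indicator) auto

lemma F_integrable:
  assumes u: "u \<in> span E"
  shows "set_integrable lborel D (\<lambda>x. F (rep_l2 u x))"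
proof -
  obtain K where K: "K \<ge> 0" "\<And>y. \<bar>F y\<bar> \<le> K * (1 + y ^ 4)" using F_growth by blast
  show ?thesis
    unfolding set_integrable_def
  proof (rule Bochner_Integration.integrable_bound)
    show "integrable lborel (\<lambda>x. K * (indicator D x + (rep_l2 u x) ^ 4))"
      using integrable_indicator_D E_L4[OF u] by simp
    show "AE x in lborel. norm (indicator D x *\<^sub>R F (rep_l2 u x)) \<le> norm (K * (indicator D x + (rep_l2 u x) ^ 4))"
      using K by (auto simp: indicator_def abs_mult)
  qed simp
qed

text \<open>The averaged cubic grows like the third power of two functions in \<open>L\<^sup>4\<close>; with one more such factor, the
  product is bounded by the fourth power of a function in \<open>L\<^sup>4\<close>, which includes the indicator function
  of \<open>D\<close> in order to absorb constants.\<close>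

lemma pairing_integrable:
  assumes u: "u \<in> span E" "u' \<in> span E" "z \<in> span E"
  shows "set_integrable lborel D (\<lambda>x. avg f (rep_l2 u x) (rep_l2 u' x) * rep_l2 z x)"
proof -
  obtain K where K: "K \<ge> 0" "\<And>y. \<bar>poly f y\<bar> \<le> K * (1 + \<bar>y\<bar> ^ 3)"
    using cubic_growth[OF degree_f] by blast
  have [measurable]: "(\<lambda>x. avg f (rep_l2 u x) (rep_l2 u' x)) \<in> borel_measurable borel"
    by (intro avg_measurable) auto
  let ?s = "\<lambda>x. \<bar>rep_l2 u x\<bar> + \<bar>rep_l2 u' x\<bar>"
  let ?t = "\<lambda>x. \<bar>rep_l2 z x\<bar> + \<bar>indicator D x\<bar>"
  have ind4: "(\<lambda>x. (indicator D x :: real) ^ 4) = indicator D" by (auto simp: indicator_def)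
  have s: "integrable lborel (\<lambda>x. ?s x ^ 4)"
    using u by (intro integrable_pow4_add E_L4) auto
  have t: "integrable lborel (\<lambda>x. ?t x ^ 4)"
    using u integrable_indicator_D by (intro integrable_pow4_add E_L4) (auto simp: ind4)
  have st: "integrable lborel (\<lambda>x. (\<bar>?s x\<bar> + \<bar>?t x\<bar>) ^ 4)"
    by (rule integrable_pow4_add[OF _ _ s t]) auto
  show ?thesis
    unfolding set_integrable_def
  proof (rule Bochner_Integration.integrable_bound)
    show "integrable lborel (\<lambda>x. K * (2 * (\<bar>?s x\<bar> + \<bar>?t x\<bar>) ^ 4))" using st by simp
    show "AE x in lborel. norm (indicator D x *\<^sub>R (avg f (rep_l2 u x) (rep_l2 u' x) * rep_l2 z x))
        \<le> norm (K * (2 * (\<bar>?s x\<bar> + \<bar>?t x\<bar>) ^ 4))"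
    proof (intro AE_I2)
      fix x
      show "norm (indicator D x *\<^sub>R (avg f (rep_l2 u x) (rep_l2 u' x) * rep_l2 z x))
        \<le> norm (K * (2 * (\<bar>?s x\<bar> + \<bar>?t x\<bar>) ^ 4))"
      proof (cases "x \<in> D")
        case True
        obtain \<xi> where \<xi>: "\<bar>\<xi>\<bar> \<le> ?s x" "avg f (rep_l2 u x) (rep_l2 u' x) = poly f \<xi>"
          using avg_value by blast
        define m where "m = ?s x + ?t x"
        have m: "1 \<le> m" "?s x \<le> m" "\<bar>rep_l2 z x\<bar> \<le> m" using True by (auto simp: m_def)
        have "\<bar>poly f \<xi>\<bar> \<le> K * (1 + \<bar>\<xi>\<bar> ^ 3)" by (rule K(2))
        also have "\<dots> \<le> K * (m ^ 3 + m ^ 3)"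
          using m \<xi>(1) K(1) by (intro mult_left_mono add_mono power_mono) (auto intro: one_le_power)
        finally have "\<bar>poly f \<xi>\<bar> * \<bar>rep_l2 z x\<bar> \<le> K * (m ^ 3 + m ^ 3) * m"
          using m K(1) by (intro mult_mono) auto
        also have "\<dots> = K * (2 * m ^ 4)" by (simp add: power_numeral_reduce)
        finally show ?thesis using True K(1) \<xi>(2) m by (simp add: abs_mult m_def)
      next
        case False
        then show ?thesis by simp
      qed
    qed
  qed simp
qed

lemma avf_term_inner:
  assumes u: "u \<in> span E" "u' \<in> span E"
  defines "G \<equiv> avf_term D f (span E) u u'"
  shows "G \<in> span E"
    and "z \<in> span E \<Longrightarrow> inner G z = (LINT x:D|lborel. avg f (rep_l2 u x) (rep_l2 u' x) * rep_l2 z x)"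
proof -
  let ?q = "\<lambda>x. avg f (rep_l2 u x) (rep_l2 u' x)"
  have [measurable]: "?q \<in> borel_measurable borel"
    by (intro avg_measurable) auto
  have lin: "pairing D ?q z = (\<Sum>e\<in>E. inner z e * pairing D ?q e)" if z: "z \<in> span E" for z
  proof -
    have "pairing D ?q z = (LINT x|lborel. (\<Sum>e\<in>E. inner z e * (indicator D x *\<^sub>R (?q x * rep_l2 e x))))"
      unfolding pairing_def set_lebesgue_integral_def
    proof (intro integral_cong_AE)
      show "AE x in lborel. indicator D x *\<^sub>R (?q x * rep_l2 z x)
          = (\<Sum>e\<in>E. inner z e * (indicator D x *\<^sub>R (?q x * rep_l2 e x)))"
        using rep_expand[OF z] by eventually_elim (simp add: sum_distrib_left mult_ac)
    qed auto
    also have "\<dots> = (\<Sum>e\<in>E. inner z e * pairing D ?q e)"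
      unfolding pairing_def set_lebesgue_integral_def
      using pairing_integrable[OF u span_base] unfolding set_integrable_def
      by (subst Bochner_Integration.integral_sum) auto
    finally show ?thesis .
  qed
  have G: "G = (\<Sum>e\<in>E. pairing D ?q e *\<^sub>R e)"
    unfolding G_def avf_term_def P_h_def avg_def[symmetric] by (rule riesz_representative[OF lin])
  show "G \<in> span E" unfolding G by (rule sum_in_span)
  show "inner G z = (LINT x:D|lborel. ?q x * rep_l2 z x)" if z: "z \<in> span E"
    unfolding pairing_def[symmetric] lin[OF z] inner_expand_E[OF z]
    using inner_sum_E[of _ "pairing D ?q"] by (simp add: G mult.commute)
qed

text \<open>The averaged vector field is a discrete gradient of the potential: it satisfies the chain rule
  exactly, because it does so pointwise.\<close>

lemma avf_term_chain_rule:
  assumes u: "u \<in> span E" "u' \<in> span E"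
  shows "inner (avf_term D f (span E) u u') (u' - u) = F_int u' - F_int u"
proof -
  have [measurable]: "(\<lambda>x. avg f (rep_l2 u x) (rep_l2 u' x)) \<in> borel_measurable borel"
    by (intro avg_measurable) auto
  have "inner (avf_term D f (span E) u u') (u' - u)
      = (LINT x:D|lborel. avg f (rep_l2 u x) (rep_l2 u' x) * rep_l2 (u' - u) x)"
    by (rule avf_term_inner(2)[OF u span_diff[OF u(2,1)]])
  also have "\<dots> = (LINT x:D|lborel. F (rep_l2 u' x) - F (rep_l2 u x))"
    unfolding set_lebesgue_integral_def
  proof (intro integral_cong_AE)
    show "AE x in lborel. indicator D x *\<^sub>R (avg f (rep_l2 u x) (rep_l2 u' x) * rep_l2 (u' - u) x)
        = indicator D x *\<^sub>R (F (rep_l2 u' x) - F (rep_l2 u x))"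
      using rep_diff_l2[of u' u] by eventually_elim (simp add: avg_mult)
  qed auto
  also have "\<dots> = F_int u' - F_int u"
    unfolding F_int_def by (intro set_integral_diff(2) F_integrable u)
  finally show ?thesis .
qed

lemma energy_eq: "energy D F C1 u v = grad_inner D u u / 2 + (norm v)\<^sup>2 / 2 + F_int u + C1"
  by (simp add: energy_def F_int_def)

lemma step_conserves_energy:
  assumes u: "u \<in> span E" "u' \<in> span E" and v: "v \<in> span E"
  defines "G \<equiv> avf_term D f (span E) u u'"
  assumes u': "u' = step_U \<tau> u v G"
  shows "energy D F C1 u' (step_V \<tau> u v G) = energy D F C1 u v"
proof -
  have G: "G \<in> span E" unfolding G_def by (rule avf_term_inner(1)[OF u])
  have "inner G (u' - u) = F_int u' - F_int u"
    unfolding G_def by (rule avf_term_chain_rule[OF u])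
  then show ?thesis
    using step_energy[OF u(1) v G, of \<tau>] unfolding energy_eq u'[symmetric] by simp
qed

text \<open>Every element of the discrete space is dominated by its \<open>L\<^sup>2\<close> norm times the fixed \<open>L\<^sup>4\<close> function given
  by the sum of the absolute values of the basis.\<close>

lemma F_int_growth: "\<exists>A\<ge>0. \<forall>u\<in>span E. \<bar>F_int u\<bar> \<le> A * (1 + norm u ^ 4)"
proof -
  obtain K where K: "K \<ge> 0" "\<And>y. \<bar>F y\<bar> \<le> K * (1 + y ^ 4)" using F_growth by blast
  let ?w = "\<lambda>x. \<Sum>e\<in>E. \<bar>rep_l2 e x\<bar>"
  have w: "integrable lborel (\<lambda>x. ?w x ^ 4)"
    using finite_E E_L4 by (intro integrable_pow4_sum) (auto intro: span_base)
  let ?m = "LINT x|lborel. indicator D x :: real" and ?W = "LINT x|lborel. ?w x ^ 4"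
  have pos: "?m \<ge> 0" "?W \<ge> 0" by auto
  have "\<bar>F_int u\<bar> \<le> K * (?m + ?W) * (1 + norm u ^ 4)" if u: "u \<in> span E" for u
  proof -
    have "\<bar>F_int u\<bar> \<le> (LINT x|lborel. norm (indicator D x *\<^sub>R F (rep_l2 u x)))"
      unfolding F_int_def set_lebesgue_integral_def real_norm_def[symmetric] by (rule integral_norm_bound)
    also have "\<dots> \<le> (LINT x|lborel. K * (indicator D x + norm u ^ 4 * ?w x ^ 4))"
    proof (rule integral_mono_AE)
      show "integrable lborel (\<lambda>x. norm (indicator D x *\<^sub>R F (rep_l2 u x)))"
        using F_integrable[OF u] unfolding set_integrable_def by (rule integrable_norm)
      show "integrable lborel (\<lambda>x. K * (indicator D x + norm u ^ 4 * ?w x ^ 4))"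
        using integrable_indicator_D w by simp
      show "AE x in lborel. norm (indicator D x *\<^sub>R F (rep_l2 u x)) \<le> K * (indicator D x + norm u ^ 4 * ?w x ^ 4)"
        using rep_expand[OF u]
      proof eventually_elim
        case (elim x)
        have "\<bar>rep_l2 u x\<bar> \<le> (\<Sum>e\<in>E. \<bar>inner u e\<bar> * \<bar>rep_l2 e x\<bar>)"
          unfolding elim by (rule order_trans[OF sum_abs]) (simp add: abs_mult)
        also have "\<dots> \<le> (\<Sum>e\<in>E. norm u * \<bar>rep_l2 e x\<bar>)"
        proof (intro sum_mono mult_right_mono)
          fix e assume "e \<in> E"
          then show "\<bar>inner u e\<bar> \<le> norm u"
            using Cauchy_Schwarz_ineq2[of u e] orthonormal_E by (simp add: orthonormal_def)
        qed simp
        finally have "\<bar>rep_l2 u x\<bar> \<le> norm u * ?w x" by (simp add: sum_distrib_left)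
        then have "\<bar>rep_l2 u x\<bar> ^ 4 \<le> (norm u * ?w x) ^ 4" by (rule power_mono) simp
        then have "1 + (rep_l2 u x) ^ 4 \<le> 1 + norm u ^ 4 * ?w x ^ 4" by (simp add: power_mult_distrib)
        then have "\<bar>F (rep_l2 u x)\<bar> \<le> K * (1 + norm u ^ 4 * ?w x ^ 4)"
          using K by (meson mult_left_mono order_trans)
        then show ?case using K(1) by (auto simp: indicator_def)
      qed
    qed
    also have "\<dots> = K * (?m + norm u ^ 4 * ?W)"
      using integrable_indicator_D w by simp
    also have "\<dots> \<le> K * ((?m + ?W) * (1 + norm u ^ 4))"
      using pos by (intro mult_left_mono K) (simp add: algebra_simps)
    finally show ?thesis by (simp add: mult.assoc)
  qed
  moreover have "K * (?m + ?W) \<ge> 0" using K(1) pos by simp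
  ultimately show ?thesis by blast
qed

lemma energy_growth:
  "\<exists>A\<ge>0. \<forall>u\<in>span E. \<forall>v. \<bar>energy D F C1 u v\<bar> \<le> A * (1 + norm u ^ 4 + (norm v)\<^sup>2)"
proof -
  obtain A where A: "A \<ge> 0" "\<And>u. u \<in> span E \<Longrightarrow> \<bar>F_int u\<bar> \<le> A * (1 + norm u ^ 4)"
    using F_int_growth by blast
  let ?L = "\<Sum>e\<in>E. lam e"
  have L: "?L \<ge> 0" by (intro sum_nonneg lam_nonneg)
  have "\<bar>energy D F C1 u v\<bar> \<le> (A + 1 + ?L + \<bar>C1\<bar>) * (1 + norm u ^ 4 + (norm v)\<^sup>2)" if u: "u \<in> span E" for u v
  proof -
    have "grad_inner D u u = (\<Sum>e\<in>E. lam e * (inner u e)\<^sup>2)"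
      unfolding grad_inner_expand[OF u u] by (simp add: power2_eq_square mult_ac)
    also have "\<dots> \<le> (\<Sum>e\<in>E. lam e * (norm u)\<^sup>2)"
    proof (intro sum_mono mult_left_mono lam_nonneg)
      fix e assume "e \<in> E"
      then have "\<bar>inner u e\<bar> \<le> norm u"
        using Cauchy_Schwarz_ineq2[of u e] orthonormal_E by (simp add: orthonormal_def)
      then show "(inner u e)\<^sup>2 \<le> (norm u)\<^sup>2" by (simp add: abs_le_square_iff[symmetric])
    qed
    also have "\<dots> = ?L * (norm u)\<^sup>2" by (simp add: sum_distrib_right)
    also have "\<dots> \<le> ?L * (1 + norm u ^ 4)"
    proof (intro mult_left_mono L)
      have "2 * (norm u)\<^sup>2 \<le> 1 + norm u ^ 4"
        using zero_le_power2[of "(norm u)\<^sup>2 - 1"] by (simp add: power2_diff)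
      then show "(norm u)\<^sup>2 \<le> 1 + norm u ^ 4" using zero_le_power2[of "norm u"] by linarith
    qed
    finally have g: "grad_inner D u u \<le> ?L * (1 + norm u ^ 4)" .
    have "\<bar>energy D F C1 u v\<bar> \<le> ?L * (1 + norm u ^ 4) + (norm v)\<^sup>2 + A * (1 + norm u ^ 4) + \<bar>C1\<bar>"
      using A(2)[OF u] g grad_inner_nonneg[of D u] zero_le_power2[of "norm v"] unfolding energy_eq by linarith
    also have "\<dots> \<le> (A + 1 + ?L + \<bar>C1\<bar>) * (1 + norm u ^ 4 + (norm v)\<^sup>2)"
      using A(1) L by (simp add: algebra_simps)
    finally show ?thesis .
  qed
  then show ?thesis using A(1) L by (intro exI[of _ "A + 1 + ?L + \<bar>C1\<bar>"]) auto
qed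

text \<open>Random elements of the discrete space are measurable if their coordinates are. In this form
  measurability is inherited by integrals over \<open>D\<close>, which depend on the representatives only through
  the jointly measurable combination of the fixed representatives of the basis.\<close>

definition coord_measurable :: "'w measure \<Rightarrow> ('w \<Rightarrow> 'a l2) \<Rightarrow> bool" where
  "coord_measurable N U \<longleftrightarrow> (\<forall>e\<in>E. (\<lambda>\<omega>. inner (U \<omega>) e) \<in> borel_measurable N)"

lemma coord_measurable_kernel:
  assumes "coord_measurable N U"
  shows "(\<lambda>p. \<Sum>e\<in>E. inner (U (fst p)) e * rep_l2 e (snd p)) \<in> borel_measurable (N \<Otimes>\<^sub>M lborel)"
  using assms unfolding coord_measurable_def
  by (intro borel_measurable_sum borel_measurable_times measurable_compose[OF measurable_fst]
      measurable_compose[OF measurable_snd]) auto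

lemma F_int_measurable:
  assumes U: "coord_measurable N U" "\<And>\<omega>. \<omega> \<in> space N \<Longrightarrow> U \<omega> \<in> span E"
  shows "(\<lambda>\<omega>. F_int (U \<omega>)) \<in> borel_measurable N"
proof -
  let ?r = "\<lambda>\<omega> x. \<Sum>e\<in>E. inner (U \<omega>) e * rep_l2 e x"
  have "(\<lambda>p. indicator D (snd p) *\<^sub>R F (?r (fst p) (snd p))) \<in> borel_measurable (N \<Otimes>\<^sub>M lborel)"
    by (intro borel_measurable_scaleR measurable_compose[OF coord_measurable_kernel[OF U(1)] F_measurable]
      measurable_compose[OF measurable_snd]) auto
  then have "(\<lambda>\<omega>. LINT x|lborel. indicator D x *\<^sub>R F (?r \<omega> x)) \<in> borel_measurable N"
    by (intro lborel.borel_measurable_lebesgue_integral) (simp add: case_prod_unfold)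
  moreover have "F_int (U \<omega>) = (LINT x|lborel. indicator D x *\<^sub>R F (?r \<omega> x))" if "\<omega> \<in> space N" for \<omega>
    unfolding F_int_def set_lebesgue_integral_def
  proof (intro integral_cong_AE)
    show "AE x in lborel. indicator D x *\<^sub>R F (rep_l2 (U \<omega>) x) = indicator D x *\<^sub>R F (?r \<omega> x)"
      using rep_expand[OF U(2)[OF that]] by eventually_elim simp
  qed auto
  ultimately show ?thesis by (simp cong: measurable_cong)
qed

lemma avf_term_measurable:
  assumes U: "coord_measurable N U" "\<And>\<omega>. \<omega> \<in> space N \<Longrightarrow> U \<omega> \<in> span E"
    and U': "coord_measurable N U'" "\<And>\<omega>. \<omega> \<in> space N \<Longrightarrow> U' \<omega> \<in> span E"
  shows "coord_measurable N (\<lambda>\<omega>. avf_term D f (span E) (U \<omega>) (U' \<omega>))"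
  unfolding coord_measurable_def
proof
  fix e assume e: "e \<in> E"
  let ?r = "\<lambda>U \<omega> x. \<Sum>e\<in>E. inner (U \<omega>) e * rep_l2 e x"
  have "(\<lambda>p. indicator D (snd p) *\<^sub>R (avg f (?r U (fst p) (snd p)) (?r U' (fst p) (snd p)) * rep_l2 e (snd p)))
      \<in> borel_measurable (N \<Otimes>\<^sub>M lborel)"
    by (intro borel_measurable_scaleR borel_measurable_times
      avg_measurable[OF coord_measurable_kernel[OF U(1)] coord_measurable_kernel[OF U'(1)]]
      measurable_compose[OF measurable_snd]) auto
  then have "(\<lambda>\<omega>. LINT x|lborel. indicator D x *\<^sub>R (avg f (?r U \<omega> x) (?r U' \<omega> x) * rep_l2 e x)) \<in> borel_measurable N"
    by (intro lborel.borel_measurable_lebesgue_integral) (simp add: case_prod_unfold)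
  moreover have "inner (avf_term D f (span E) (U \<omega>) (U' \<omega>)) e
      = (LINT x|lborel. indicator D x *\<^sub>R (avg f (?r U \<omega> x) (?r U' \<omega> x) * rep_l2 e x))" if \<omega>: "\<omega> \<in> space N" for \<omega>
    unfolding avf_term_inner(2)[OF U(2)[OF \<omega>] U'(2)[OF \<omega>] span_base[OF e]] set_lebesgue_integral_def
  proof (intro integral_cong_AE)
    show "AE x in lborel. indicator D x *\<^sub>R (avg f (rep_l2 (U \<omega>) x) (rep_l2 (U' \<omega>) x) * rep_l2 e x)
        = indicator D x *\<^sub>R (avg f (?r U \<omega> x) (?r U' \<omega> x) * rep_l2 e x)"
      using rep_expand[OF U(2)[OF \<omega>]] rep_expand[OF U'(2)[OF \<omega>]] by eventually_elim simp
    show "(\<lambda>x. indicator D x *\<^sub>R (avg f (rep_l2 (U \<omega>) x) (rep_l2 (U' \<omega>) x) * rep_l2 e x)) \<in> borel_measurable lborel"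
      "(\<lambda>x. indicator D x *\<^sub>R (avg f (?r U \<omega> x) (?r U' \<omega> x) * rep_l2 e x)) \<in> borel_measurable lborel"
      by (auto intro!: borel_measurable_times avg_measurable borel_measurable_sum)
  qed
  ultimately show "(\<lambda>\<omega>. inner (avf_term D f (span E) (U \<omega>) (U' \<omega>)) e) \<in> borel_measurable N"
    by (simp cong: measurable_cong)
qed

lemma step_V_measurable:
  assumes "coord_measurable N U" "coord_measurable N V" "coord_measurable N G"
    and "\<And>\<omega>. \<omega> \<in> space N \<Longrightarrow> U \<omega> \<in> span E \<and> V \<omega> \<in> span E \<and> G \<omega> \<in> span E"
  shows "coord_measurable N (\<lambda>\<omega>. step_V \<tau> (U \<omega>) (V \<omega>) (G \<omega>))"
  unfolding coord_measurable_def
proof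
  fix e assume e: "e \<in> E"
  then have [measurable]: "(\<lambda>\<omega>. inner (U \<omega>) e) \<in> borel_measurable N"
    "(\<lambda>\<omega>. inner (V \<omega>) e) \<in> borel_measurable N" "(\<lambda>\<omega>. inner (G \<omega>) e) \<in> borel_measurable N"
    using assms by (auto simp: coord_measurable_def)
  have "(\<lambda>\<omega>. - (lam e powr (1 / 2) * (sin (\<tau> * sqrt (lam e)) * inner (U \<omega>) e))
      + cos (\<tau> * sqrt (lam e)) * inner (V \<omega>) e
      - lam e powr (- 1 / 2) * (sin (\<tau> * sqrt (lam e)) * inner (G \<omega>) e)) \<in> borel_measurable N"
    by measurable
  then show "(\<lambda>\<omega>. inner (step_V \<tau> (U \<omega>) (V \<omega>) (G \<omega>)) e) \<in> borel_measurable N"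
    using assms(4) e by (subst measurable_cong[OF step_coords(2)]) auto
qed

lemma energy_measurable:
  assumes "coord_measurable N U" "coord_measurable N V"
    and "\<And>\<omega>. \<omega> \<in> space N \<Longrightarrow> U \<omega> \<in> span E \<and> V \<omega> \<in> span E"
  shows "(\<lambda>\<omega>. energy D F C1 (U \<omega>) (V \<omega>)) \<in> borel_measurable N"
proof -
  have "(\<lambda>\<omega>. (\<Sum>e\<in>E. inner (U \<omega>) e * (lam e * inner (U \<omega>) e)) / 2 + (\<Sum>e\<in>E. (inner (V \<omega>) e)\<^sup>2) / 2 + F_int (U \<omega>) + C1)
      \<in> borel_measurable N"
    using assms F_int_measurable[OF assms(1)] unfolding coord_measurable_def
    by (intro borel_measurable_add borel_measurable_divide borel_measurable_sum borel_measurable_times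
        borel_measurable_power borel_measurable_const) auto
  then show ?thesis
    using assms(3) by (simp add: energy_eq grad_inner_expand norm_expand_E cong: measurable_cong)
qed

end

section \<open>One step of the scheme with noise\<close>

lemma centered_gaussian_moments:
  assumes "prob_space M" "centered_gaussian M X v" "v \<ge> 0"
  shows "integrable M X" "(LINT \<omega>|M. X \<omega>) = 0" "integrable M (\<lambda>\<omega>. (X \<omega>)\<^sup>2)" "(LINT \<omega>|M. (X \<omega>)\<^sup>2) = v"
proof -
  interpret prob_space M by fact
  have [measurable]: "X \<in> borel_measurable M" using assms(2) by (simp add: centered_gaussian_def)
  have "integrable M X \<and> (LINT \<omega>|M. X \<omega>) = 0 \<and> integrable M (\<lambda>\<omega>. (X \<omega>)\<^sup>2) \<and> (LINT \<omega>|M. (X \<omega>)\<^sup>2) = v"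
  proof (cases "v = 0")
    case True
    then have X0: "AE \<omega> in M. X \<omega> = 0" using assms(2) by (simp add: centered_gaussian_def)
    then have X20: "AE \<omega> in M. (X \<omega>)\<^sup>2 = 0" by eventually_elim simp
    show ?thesis
      using integrable_cong_AE[of X M "\<lambda>_. 0"] integral_cong_AE[of X M "\<lambda>_. 0"] X0
        integrable_cong_AE[of "\<lambda>\<omega>. (X \<omega>)\<^sup>2" M "\<lambda>_. 0"] integral_cong_AE[of "\<lambda>\<omega>. (X \<omega>)\<^sup>2" M "\<lambda>_. 0"] X20 True
      by simp
  next
    case False
    define s where "s = sqrt v"
    have s: "s > 0" "s\<^sup>2 = v" using False assms(3) by (auto simp: s_def)
    have d: "distributed M lborel X (normal_density 0 s)"
      using assms(2) False by (simp add: centered_gaussian_def s_def)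
    have nonneg: "0 \<le> normal_density 0 s x" for x using s by (simp add: normal_density_nonneg)
    have m1: "has_bochner_integral lborel (\<lambda>x. normal_density 0 s x * x) 0"
      using normal_moment_nz_1[OF s(1), of 0] .
    have m2: "has_bochner_integral lborel (\<lambda>x. normal_density 0 s x * x\<^sup>2) v"
      using normal_moment_even[OF s(1), of 0 1] s by (simp add: field_simps power2_eq_square)
    show ?thesis
      using m1 m2 distributed_integrable[OF d, of "\<lambda>x. x"] distributed_integrable[OF d, of "\<lambda>x. x\<^sup>2"]
        distributed_integral[OF d, of "\<lambda>x. x"] distributed_integral[OF d, of "\<lambda>x. x\<^sup>2"] nonneg
      by (simp add: has_bochner_integral_iff)
  qed
  then show "integrable M X" "(LINT \<omega>|M. X \<omega>) = 0" "integrable M (\<lambda>\<omega>. (X \<omega>)\<^sup>2)" "(LINT \<omega>|M. (X \<omega>)\<^sup>2) = v"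
    by auto
qed

lemma (in prob_space) indep_var_of_indep_set:
  assumes ind: "indep_set (sets F) {Z -` A \<inter> space M |A. A \<in> sets borel}"
    and F: "subalgebra M F" and Y: "Y \<in> borel_measurable F" and X: "X \<in> borel_measurable M"
    and g: "g \<in> borel_measurable borel" "\<And>\<omega>. X \<omega> = g (Z \<omega>)"
  shows "indep_var borel Y borel X"
proof -
  have Y': "Y \<in> borel_measurable M" using measurable_from_subalg[OF F Y] .
  have "indep_sets (case_bool {Y -` A \<inter> space M |A. A \<in> sets borel} {X -` A \<inter> space M |A. A \<in> sets borel}) UNIV"
  proof (rule indep_sets_mono_sets[OF ind[unfolded indep_set_def]])
    fix i :: bool
    show "case_bool {Y -` A \<inter> space M |A. A \<in> sets borel} {X -` A \<inter> space M |A. A \<in> sets borel} i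
      \<subseteq> case_bool (sets F) {Z -` A \<inter> space M |A. A \<in> sets borel} i"
    proof (cases i)
      case True
      have "Y -` A \<inter> space M \<in> sets F" if "A \<in> sets borel" for A
        using measurable_sets[OF Y that] F by (simp add: subalgebra_def)
      then show ?thesis using True by auto
    next
      case False
      have "\<exists>B. X -` A \<inter> space M = Z -` B \<inter> space M \<and> B \<in> sets borel" if "A \<in> sets borel" for A
        using measurable_sets[OF g(1) that] g(2) by (intro exI[of _ "g -` A"]) auto
      then show ?thesis using False by auto
    qed
  qed
  moreover have "(\<lambda>i. {case_bool Y X i -` A \<inter> space M |A. A \<in> sets (case_bool borel borel i)})
      = case_bool {Y -` A \<inter> space M |A. A \<in> sets borel} {X -` A \<inter> space M |A. A \<in> sets borel}"
    by (rule ext) (simp split: bool.split)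
  ultimately show ?thesis
    unfolding indep_var_def indep_vars_def2 using Y' X by (simp add: UNIV_bool)
qed

locale galerkin_scheme = discrete_nonlinear D E f F + prob_space M
  for D :: "'a::euclidean_space set" and E f F and M :: "'w measure" +
  fixes T :: real and Fl :: "real \<Rightarrow> 'w measure" and Q :: "'a l2 \<Rightarrow> 'a l2" and W :: "real \<Rightarrow> 'w \<Rightarrow> 'a l2"
  assumes filtration: "normal_filtration M T Fl"
    and Q_psd: "psd_op (L2_on D) Q"
    and Wiener: "Q_Wiener (L2_on D) Q M T Fl W"
begin

definition noise :: "real \<Rightarrow> real \<Rightarrow> 'w \<Rightarrow> 'a l2" where
  "noise s t \<omega> = P_h (span E) (inner (W t \<omega> - W s \<omega>))"

definition noise_trace :: real where
  "noise_trace = (\<Sum>e\<in>E. inner (Q e) e)"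

lemma noise_coord: "e \<in> E \<Longrightarrow> inner (noise s t \<omega>) e = inner (W t \<omega> - W s \<omega>) e"
  unfolding noise_def P_h_inner using inner_sum_E[of e "\<lambda>e. inner (W t \<omega> - W s \<omega>) e"] by simp

lemma noise_in_span: "noise s t \<omega> \<in> span E"
  unfolding noise_def P_h_inner by (rule sum_in_span)

lemma subalg: "0 \<le> s \<Longrightarrow> s \<le> T \<Longrightarrow> subalgebra M (Fl s)"
  using filtration by (simp add: normal_filtration_def)

lemma subalg_mono: "0 \<le> s \<Longrightarrow> s \<le> t \<Longrightarrow> t \<le> T \<Longrightarrow> subalgebra (Fl t) (Fl s)"
  using filtration by (auto simp: normal_filtration_def subalgebra_def)

lemma inner_const_measurable: "(\<lambda>u::'a l2. inner u e) \<in> borel_measurable borel"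
  by (intro borel_measurable_continuous_onI continuous_intros)

lemma coord_measurableI:
  assumes "U \<in> borel_measurable N"
  shows "coord_measurable N U"
  unfolding coord_measurable_def using measurable_compose[OF assms inner_const_measurable] by blast

lemma coord_measurable_subalg:
  assumes "subalgebra N N'" "coord_measurable N' U"
  shows "coord_measurable N U"
  using assms measurable_from_subalg unfolding coord_measurable_def by blast

lemma noise_measurable:
  assumes st: "0 \<le> s" "s < t" "t \<le> T"
  shows "coord_measurable (Fl t) (noise s t)"
  unfolding coord_measurable_def
proof
  fix e assume e: "e \<in> E"
  have "W t \<in> borel_measurable (Fl t)" "W s \<in> borel_measurable (Fl s)"
    using Wiener st by (auto simp: Q_Wiener_def)
  then have "(\<lambda>\<omega>. inner (W t \<omega>) e) \<in> borel_measurable (Fl t)" "(\<lambda>\<omega>. inner (W s \<omega>) e) \<in> borel_measurable (Fl s)"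
    using measurable_compose[OF _ inner_const_measurable] by blast+
  then have "(\<lambda>\<omega>. inner (W t \<omega>) e) \<in> borel_measurable (Fl t)" "(\<lambda>\<omega>. inner (W s \<omega>) e) \<in> borel_measurable (Fl t)"
    using measurable_from_subalg[OF subalg_mono[of s t]] st by auto
  then show "(\<lambda>\<omega>. inner (noise s t \<omega>) e) \<in> borel_measurable (Fl t)"
    by (simp add: noise_coord[OF e] inner_diff_left)
qed

lemma noise_coord_moments:
  assumes st: "0 \<le> s" "s < t" "t \<le> T" and e: "e \<in> E"
  defines "X \<equiv> (\<lambda>\<omega>. inner (noise s t \<omega>) e)"
  shows "integrable M X" "(LINT \<omega>|M. X \<omega>) = 0"
    "integrable M (\<lambda>\<omega>. (X \<omega>)\<^sup>2)" "(LINT \<omega>|M. (X \<omega>)\<^sup>2) = (t - s) * inner (Q e) e"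
proof -
  have eH: "e \<in> L2_on D" using span_L2_on span_base[OF e] by auto
  have "centered_gaussian M (\<lambda>\<omega>. inner (W t \<omega> - W s \<omega>) e) ((t - s) * inner (Q e) e)"
    using Wiener st eH by (auto simp: Q_Wiener_def)
  then have "centered_gaussian M X ((t - s) * inner (Q e) e)" by (simp add: X_def noise_coord[OF e])
  moreover have "(t - s) * inner (Q e) e \<ge> 0"
    using Q_psd eH st by (intro mult_nonneg_nonneg) (auto simp: psd_op_def)
  ultimately show "integrable M X" "(LINT \<omega>|M. X \<omega>) = 0"
    "integrable M (\<lambda>\<omega>. (X \<omega>)\<^sup>2)" "(LINT \<omega>|M. (X \<omega>)\<^sup>2) = (t - s) * inner (Q e) e"
    using centered_gaussian_moments[OF prob_space_axioms] by blast+
qed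

lemma noise_norm:
  assumes st: "0 \<le> s" "s < t" "t \<le> T"
  shows "integrable M (\<lambda>\<omega>. (norm (noise s t \<omega>))\<^sup>2)"
    "(LINT \<omega>|M. (norm (noise s t \<omega>))\<^sup>2) = (t - s) * noise_trace"
  unfolding norm_expand_E[OF noise_in_span] noise_trace_def sum_distrib_left
  using noise_coord_moments[OF st] by (simp_all add: Bochner_Integration.integral_sum)

text \<open>The increment is independent of the past and has mean zero.\<close>

lemma noise_orthogonal:
  assumes st: "0 \<le> s" "s < t" "t \<le> T" and v: "coord_measurable (Fl s) v"
    and int: "\<And>e. e \<in> E \<Longrightarrow> integrable M (\<lambda>\<omega>. inner (v \<omega>) e)"
  shows "integrable M (\<lambda>\<omega>. inner (v \<omega>) (noise s t \<omega>))" "(LINT \<omega>|M. inner (v \<omega>) (noise s t \<omega>)) = 0"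
proof -
  have ind: "indep_set (sets (Fl s)) {(\<lambda>\<omega>. W t \<omega> - W s \<omega>) -` A \<inter> space M |A. A \<in> sets borel}"
    using Wiener st by (simp add: Q_Wiener_def)
  have *: "integrable M (\<lambda>\<omega>. inner (v \<omega>) e * inner (noise s t \<omega>) e) \<and>
      (LINT \<omega>|M. inner (v \<omega>) e * inner (noise s t \<omega>) e) = 0" if e: "e \<in> E" for e
  proof -
    have "indep_var borel (\<lambda>\<omega>. inner (v \<omega>) e) borel (\<lambda>\<omega>. inner (noise s t \<omega>) e)"
      using v e noise_coord_moments(1)[OF st e] st
      by (intro indep_var_of_indep_set[OF ind subalg _ _ inner_const_measurable noise_coord[OF e]])
        (auto simp: coord_measurable_def)
    from indep_var_integrable[OF this int[OF e] noise_coord_moments(1)[OF st e]]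
      indep_var_lebesgue_integral[OF this int[OF e] noise_coord_moments(1)[OF st e]]
    show ?thesis using noise_coord_moments(2)[OF st e] by simp
  qed
  show "integrable M (\<lambda>\<omega>. inner (v \<omega>) (noise s t \<omega>))" "(LINT \<omega>|M. inner (v \<omega>) (noise s t \<omega>)) = 0"
    unfolding inner_expand_E[OF noise_in_span] using * by (simp_all add: Bochner_Integration.integral_sum)
qed

text \<open>The noise enters only the second component, so it changes the conserved energy by a cross term and
  by half of its squared norm. The cross term has mean zero, provided that the noise-free second
  component \<open>w\<close> is integrable; this follows from the integrability of the energy at the previous time,
  since the potential part of the energy is bounded below and the noise-free step conserves it.\<close>

lemma noisy_step_energy:
  fixes \<tau> :: real
  assumes st: "0 \<le> s" "s < t" "t \<le> T"
    and u: "coord_measurable (Fl s) u" "\<And>\<omega>. \<omega> \<in> space M \<Longrightarrow> u \<omega> \<in> span E"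
    and v: "coord_measurable (Fl s) v" "\<And>\<omega>. \<omega> \<in> space M \<Longrightarrow> v \<omega> \<in> span E"
    and u': "coord_measurable (Fl s) u'" "\<And>\<omega>. \<omega> \<in> space M \<Longrightarrow> u' \<omega> \<in> span E"
  defines "G \<equiv> (\<lambda>\<omega>. avf_term D f (span E) (u \<omega>) (u' \<omega>))"
  defines "v' \<equiv> (\<lambda>\<omega>. step_V \<tau> (u \<omega>) (v \<omega>) (G \<omega>) + noise s t \<omega>)"
  assumes scheme: "AE \<omega> in M. u' \<omega> = step_U \<tau> (u \<omega>) (v \<omega>) (G \<omega>)"
    and C1: "\<And>w. w \<in> span E \<Longrightarrow> 0 \<le> F_int w + C1"
    and int: "integrable M (\<lambda>\<omega>. energy D F C1 (u \<omega>) (v \<omega>))"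
  shows "coord_measurable (Fl t) v'" "\<And>\<omega>. \<omega> \<in> space M \<Longrightarrow> v' \<omega> \<in> span E"
    "integrable M (\<lambda>\<omega>. energy D F C1 (u' \<omega>) (v' \<omega>))"
    "(LINT \<omega>|M. energy D F C1 (u' \<omega>) (v' \<omega>)) = (LINT \<omega>|M. energy D F C1 (u \<omega>) (v \<omega>)) + 1/2 * noise_trace * (t - s)"
proof -
  define w where "w = (\<lambda>\<omega>. step_V \<tau> (u \<omega>) (v \<omega>) (G \<omega>))"
  have sub: "subalgebra M (Fl s)" "subalgebra M (Fl t)" "subalgebra (Fl t) (Fl s)"
    using subalg subalg_mono st by auto
  have space: "space (Fl s) = space M" using sub(1) by (simp add: subalgebra_def)
  have G: "coord_measurable (Fl s) G" "\<And>\<omega>. \<omega> \<in> space M \<Longrightarrow> G \<omega> \<in> span E"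
    unfolding G_def using avf_term_measurable[OF u(1) _ u'(1)] avf_term_inner(1) u(2) u'(2) by (auto simp: space)
  have w: "coord_measurable (Fl s) w" "\<And>\<omega>. \<omega> \<in> space M \<Longrightarrow> w \<omega> \<in> span E"
    unfolding w_def using step_V_measurable[OF u(1) v(1) G(1)] step_in_span(2) u(2) v(2) G(2)
    by (auto simp: space)
  have v'_eq: "v' \<omega> = w \<omega> + noise s t \<omega>" for \<omega> by (simp add: v'_def w_def)
  show v'_span: "v' \<omega> \<in> span E" if "\<omega> \<in> space M" for \<omega>
    unfolding v'_eq using w(2)[OF that] noise_in_span by (rule span_add)
  show v'_meas: "coord_measurable (Fl t) v'"
    using coord_measurable_subalg[OF sub(3) w(1)] noise_measurable[OF st]
    unfolding coord_measurable_def v'_eq inner_add_left by (auto intro!: borel_measurable_add)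
  note M_meas = coord_measurable_subalg[OF sub(1)]
  have eq: "AE \<omega> in M. energy D F C1 (u' \<omega>) (w \<omega>) = energy D F C1 (u \<omega>) (v \<omega>)"
    using scheme AE_space
  proof eventually_elim
    case (elim \<omega>)
    then show ?case
      unfolding w_def G_def by (intro step_conserves_energy u(2) u'(2) v(2)) (auto simp: G_def)
  qed
  have meas_w: "(\<lambda>\<omega>. energy D F C1 (u' \<omega>) (w \<omega>)) \<in> borel_measurable M"
    using u' w by (intro energy_measurable M_meas) auto
  have int_w: "integrable M (\<lambda>\<omega>. energy D F C1 (u' \<omega>) (w \<omega>))"
    and lint_w: "(LINT \<omega>|M. energy D F C1 (u' \<omega>) (w \<omega>)) = (LINT \<omega>|M. energy D F C1 (u \<omega>) (v \<omega>))"
    using integrable_cong_AE[OF meas_w _ eq] integral_cong_AE[OF meas_w _ eq] int borel_measurable_integrable[OF int]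
    by auto
  have norm_w: "(norm (w \<omega>))\<^sup>2 \<le> 2 * energy D F C1 (u' \<omega>) (w \<omega>)" if "\<omega> \<in> space M" for \<omega>
    using C1[OF u'(2)[OF that]] grad_inner_nonneg[of D "u' \<omega>"] by (simp add: energy_eq algebra_simps)
  have "integrable M (\<lambda>\<omega>. inner (w \<omega>) e)" if e: "e \<in> E" for e
  proof -
    have m: "(\<lambda>\<omega>. inner (w \<omega>) e) \<in> borel_measurable M"
      using M_meas[OF w(1)] e by (simp add: coord_measurable_def)
    have "integrable M (\<lambda>\<omega>. (inner (w \<omega>) e)\<^sup>2)"
    proof (rule Bochner_Integration.integrable_bound)
      show "integrable M (\<lambda>\<omega>. 2 * energy D F C1 (u' \<omega>) (w \<omega>))" using int_w by simp
      show "AE \<omega> in M. norm ((inner (w \<omega>) e)\<^sup>2) \<le> norm (2 * energy D F C1 (u' \<omega>) (w \<omega>))"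
      proof (rule AE_I2)
        fix \<omega> assume \<omega>: "\<omega> \<in> space M"
        have "(inner (w \<omega>) e)\<^sup>2 \<le> (norm (w \<omega>))\<^sup>2"
          unfolding norm_expand_E[OF w(2)[OF \<omega>]] by (rule member_le_sum[OF e]) (auto simp: finite_E)
        then show "norm ((inner (w \<omega>) e)\<^sup>2) \<le> norm (2 * energy D F C1 (u' \<omega>) (w \<omega>))"
          using norm_w[OF \<omega>] by simp
      qed
    qed (use m in simp)
    then show ?thesis using m by (rule square_integrable_imp_integrable[rotated])
  qed
  note cross = noise_orthogonal[OF st w(1) this]
  have split: "energy D F C1 (u' \<omega>) (v' \<omega>)
      = energy D F C1 (u' \<omega>) (w \<omega>) + inner (w \<omega>) (noise s t \<omega>) + 1/2 * (norm (noise s t \<omega>))\<^sup>2" for \<omega>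
    unfolding energy_eq v'_eq power2_norm_eq_inner
    by (simp add: inner_add_left inner_add_right inner_commute field_simps)
  show "integrable M (\<lambda>\<omega>. energy D F C1 (u' \<omega>) (v' \<omega>))"
    unfolding split using int_w cross noise_norm[OF st] by simp
  show "(LINT \<omega>|M. energy D F C1 (u' \<omega>) (v' \<omega>)) = (LINT \<omega>|M. energy D F C1 (u \<omega>) (v \<omega>)) + 1/2 * noise_trace * (t - s)"
    unfolding split using int_w lint_w cross noise_norm[OF st] by simp
qed

text \<open>The compression of \<open>Q\<close> to the discrete space has the matrix \<open>\<langle>Q e, e'\<rangle>\<close>.\<close>

lemma trace_eq_noise_trace:
  assumes ex: "\<exists>B. onb (L2_on D) B"
  shows "trace_op (L2_on D) (\<lambda>u. P_h (span E) (inner (Q (P_h (span E) (inner u))))) = noise_trace"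
proof -
  have EH: "E \<subseteq> L2_on D" using span_L2_on span_superset by blast
  have Q: "\<And>u v. u \<in> L2_on D \<Longrightarrow> v \<in> L2_on D \<Longrightarrow> Q (u + v) = Q u + Q v"
    "\<And>r u. u \<in> L2_on D \<Longrightarrow> Q (r *\<^sub>R u) = r *\<^sub>R Q u"
    using Q_psd by (auto simp: psd_op_def bounded_op_def)
  have Qsum: "Q (\<Sum>e\<in>E'. c e *\<^sub>R e) = (\<Sum>e\<in>E'. c e *\<^sub>R Q e)" if "finite E'" "E' \<subseteq> L2_on D" for E' c
    using that
  proof (induction E')
    case empty
    show ?case using Q(2)[OF subspace_0[OF subspace_L2_on], of 0] by simp
  next
    case (insert e E')
    then have "c e *\<^sub>R e \<in> L2_on D" "(\<Sum>e\<in>E'. c e *\<^sub>R e) \<in> L2_on D"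
      by (auto intro!: subspace_scale[OF subspace_L2_on] subspace_sum[OF subspace_L2_on])
    then show ?case using insert Q by simp
  qed
  show ?thesis
    unfolding noise_trace_def
  proof (rule trace_op_finite_rank[OF ex subspace_L2_on orthonormal_E finite_E EH, where q = "\<lambda>e e'. inner (Q e) e'"])
    fix u
    show "inner (P_h (span E) (inner (Q (P_h (span E) (inner u))))) u
        = (\<Sum>e\<in>E. \<Sum>e'\<in>E. inner u e * inner u e' * inner (Q e) e')"
      unfolding P_h_inner Qsum[OF finite_E EH] inner_sum_left inner_scaleR_left sum_distrib_right
      by (subst sum.swap) (simp add: inner_commute mult_ac)
  qed
qed

end

section \<open>The trace formula\<close>

lemma power_le_one_plus_power:
  fixes x :: real
  assumes "0 \<le> x" "k \<le> p"
  shows "x ^ k \<le> 1 + x ^ p"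
proof (cases "x \<le> 1")
  case True
  then have "x ^ k \<le> 1" using assms by (intro power_le_one)
  moreover have "0 \<le> x ^ p" using assms by simp
  ultimately show ?thesis by linarith
next
  case False
  then have "x ^ k \<le> x ^ p" using assms by (intro power_increasing) auto
  then show ?thesis by simp
qed

lemma (in discrete_eigenbasis) P_h_norm_le: "norm (P_h (span E) (inner u)) \<le> norm u"
proof (rule power2_le_imp_le)
  have "(norm (P_h (span E) (inner u)))\<^sup>2 = (\<Sum>e\<in>E. (inner u e)\<^sup>2)"
    unfolding P_h_inner norm_expand_E[OF sum_in_span] using inner_sum_E[of _ "inner u"] by simp
  then show "(norm (P_h (span E) (inner u)))\<^sup>2 \<le> (norm u)\<^sup>2"
    using bessel_inequality[OF orthonormal_E finite_E] by simp
qed simp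

text \<open>On the finite-dimensional space the energy grows at most like the fourth power of the \<open>L\<^sup>2\<close>
  norms, and these are controlled by \<^const>\<open>HH_norm\<close> since \<open>\<Lambda>\<close> is bounded below; so moments of order
  four suffice.\<close>

lemma (in galerkin_scheme) initial_energy_integrable:
  assumes R: "D \<subseteq> cball 0 R" "R > 0" and \<gamma>: "1 \<le> \<gamma>" and p: "4 \<le> p" and T: "0 < T"
    and init: "initial_value D M (Fl 0) \<gamma> p u0 v0"
  defines "u \<equiv> (\<lambda>\<omega>. P_h (span E) (inner (u0 \<omega>)))" and "v \<equiv> (\<lambda>\<omega>. P_h (span E) (inner (v0 \<omega>)))"
  shows "coord_measurable (Fl 0) u" "coord_measurable (Fl 0) v"
    "u \<omega> \<in> span E" "v \<omega> \<in> span E" "integrable M (\<lambda>\<omega>. energy D F C1 (u \<omega>) (v \<omega>))"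
proof -
  have coord: "inner (u \<omega>) e = inner (u0 \<omega>) e" "inner (v \<omega>) e = inner (v0 \<omega>) e" if "e \<in> E" for \<omega> e
    unfolding u_def v_def P_h_inner using inner_sum_E[OF that, of "inner (u0 \<omega>)"] inner_sum_E[OF that, of "inner (v0 \<omega>)"]
    by simp_all
  have "coord_measurable (Fl 0) u0" "coord_measurable (Fl 0) v0"
    using init by (auto simp: initial_value_def intro: coord_measurableI)
  then show uv: "coord_measurable (Fl 0) u" "coord_measurable (Fl 0) v"
    by (simp_all add: coord_measurable_def coord)
  show sp: "u \<omega> \<in> span E" "v \<omega> \<in> span E" for \<omega>
    unfolding u_def v_def P_h_inner by (rule sum_in_span)+
  obtain A where A: "A \<ge> 0" "\<And>u v. u \<in> span E \<Longrightarrow> \<bar>energy D F C1 u v\<bar> \<le> A * (1 + norm u ^ 4 + (norm v)\<^sup>2)"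
    using energy_growth by blast
  define k1 k2 where "k1 = inverse ((2 * R)\<^sup>2) powr (\<gamma> / 2)" and "k2 = inverse ((2 * R)\<^sup>2) powr ((\<gamma> - 1) / 2)"
  have k: "k1 > 0" "k2 > 0" using R(2) by (auto simp: k1_def k2_def)
  let ?h = "\<lambda>\<omega>. HH_norm D \<gamma> (u0 \<omega>) (v0 \<omega>)"
  show "integrable M (\<lambda>\<omega>. energy D F C1 (u \<omega>) (v \<omega>))"
  proof (rule Bochner_Integration.integrable_bound)
    show "integrable M (\<lambda>\<omega>. A * (1 + (1 / k1) ^ 4 * (1 + ?h \<omega> ^ p) + (1 / k2)\<^sup>2 * (1 + ?h \<omega> ^ p)))"
      using init by (simp add: initial_value_def)
    show "(\<lambda>\<omega>. energy D F C1 (u \<omega>) (v \<omega>)) \<in> borel_measurable M"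
      using uv sp coord_measurable_subalg[OF subalg[of 0]] T by (intro energy_measurable) auto
    have "AE \<omega> in M. u0 \<omega> \<in> Hdot D \<gamma> \<and> v0 \<omega> \<in> Hdot D (\<gamma> - 1)"
      using init by (simp add: initial_value_def)
    then show "AE \<omega> in M. norm (energy D F C1 (u \<omega>) (v \<omega>))
        \<le> norm (A * (1 + (1 / k1) ^ 4 * (1 + ?h \<omega> ^ p) + (1 / k2)\<^sup>2 * (1 + ?h \<omega> ^ p)))"
    proof eventually_elim
      case (elim \<omega>)
      have h0: "0 \<le> ?h \<omega>" by (simp add: HH_norm_def)
      have "k1 * norm (u0 \<omega>) \<le> Hdot_norm D \<gamma> (u0 \<omega>)" "k2 * norm (v0 \<omega>) \<le> Hdot_norm D (\<gamma> - 1) (v0 \<omega>)"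
        using elim \<gamma> Lambda_pow_norm_ge[OF open_D R]
        by (auto simp: k1_def k2_def Hdot_def Hdot_norm_def)
      moreover have "Hdot_norm D \<gamma> (u0 \<omega>) \<le> ?h \<omega>" "Hdot_norm D (\<gamma> - 1) (v0 \<omega>) \<le> ?h \<omega>"
        unfolding HH_norm_def by (auto intro!: real_le_rsqrt)
      ultimately have "k1 * norm (u0 \<omega>) \<le> ?h \<omega>" "k2 * norm (v0 \<omega>) \<le> ?h \<omega>" by linarith+
      then have "norm (u0 \<omega>) \<le> 1 / k1 * ?h \<omega>" "norm (v0 \<omega>) \<le> 1 / k2 * ?h \<omega>"
        using k by (simp_all add: field_simps)
      then have "norm (u \<omega>) \<le> 1 / k1 * ?h \<omega>" "norm (v \<omega>) \<le> 1 / k2 * ?h \<omega>"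
        using P_h_norm_le[of "u0 \<omega>"] P_h_norm_le[of "v0 \<omega>"] unfolding u_def v_def by linarith+
      then have "norm (u \<omega>) ^ 4 \<le> (1 / k1 * ?h \<omega>) ^ 4" "(norm (v \<omega>))\<^sup>2 \<le> (1 / k2 * ?h \<omega>)\<^sup>2"
        by (auto intro!: power_mono)
      moreover have "(1 / k1 * ?h \<omega>) ^ 4 \<le> (1 / k1) ^ 4 * (1 + ?h \<omega> ^ p)"
        "(1 / k2 * ?h \<omega>)\<^sup>2 \<le> (1 / k2)\<^sup>2 * (1 + ?h \<omega> ^ p)"
        unfolding power_mult_distrib
        using p h0 k by (auto intro!: mult_left_mono power_le_one_plus_power)
      ultimately have "1 + norm (u \<omega>) ^ 4 + (norm (v \<omega>))\<^sup>2
          \<le> 1 + (1 / k1) ^ 4 * (1 + ?h \<omega> ^ p) + (1 / k2)\<^sup>2 * (1 + ?h \<omega> ^ p)" by linarith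
      then have "\<bar>energy D F C1 (u \<omega>) (v \<omega>)\<bar>
          \<le> A * (1 + (1 / k1) ^ 4 * (1 + ?h \<omega> ^ p) + (1 / k2)\<^sup>2 * (1 + ?h \<omega> ^ p))"
        using A(2)[OF sp(1)] mult_left_mono[OF _ A(1)] order_trans by blast
      then show ?case by simp
    qed
  qed
qed

lemma (in discrete_nonlinear) F_int_lower_bound:
  assumes "nonlinearity D f F a1 a2 b1 b2 c" "b1 \<le> C1" and w: "w \<in> span E"
  shows "0 \<le> F_int w + C1"
proof -
  have "set_integrable lborel D (\<lambda>x. (rep_l2 w x) ^ 4)"
    unfolding set_integrable_def using E_L4[OF w] by (intro integrable_mult_indicator) auto
  then have "a1 * (LINT x:D|lborel. (rep_l2 w x) ^ 4) - b1 \<le> F_int w"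
    using assms(1) unfolding nonlinearity_def F_int_def by auto
  moreover have "0 \<le> a1 * (LINT x:D|lborel. (rep_l2 w x) ^ 4)"
    using assms(1) unfolding nonlinearity_def set_lebesgue_integral_def by simp
  ultimately show ?thesis using assms(2) by linarith
qed

theorem lemma4p4:
  fixes D :: "'a::euclidean_space set"
    and T \<gamma> a1 a2 b1 b2 c C1 :: real
    and f :: "real poly" and F :: "real \<Rightarrow> real"
    and Q :: "'a l2 \<Rightarrow> 'a l2"
    and M :: "'w measure" and Fl :: "real \<Rightarrow> 'w measure" and W :: "real \<Rightarrow> 'w \<Rightarrow> 'a l2"
  assumes dim: "DIM('a) \<in> {1, 2}"
    and domain: "convex_polygonal_domain D"
    and T_pos: "0 < T"
    and f_assm: "nonlinearity D f F a1 a2 b1 b2 c"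
    and C1: "b1 \<le> C1"
    and prob: "prob_space M"
    and filtr: "normal_filtration M T Fl"
    and Q_psd: "psd_op (L2_on D) Q"
    and Wiener: "Q_Wiener (L2_on D) Q M T Fl W"
    and gamma: "1 \<le> \<gamma>" "DIM('a) = 2 \<Longrightarrow> \<gamma> \<le> 3"
    and Q_reg: "noise_regularity D Q \<gamma>"
  shows "\<exists>pmin::nat. \<forall>p0\<ge>pmin. \<forall>(u0 :: 'w \<Rightarrow> 'a l2) v0 Vh (N::nat) U V.
           initial_value D M (Fl 0) \<gamma> p0 u0 v0 \<longrightarrow>
           discrete_space D Vh \<longrightarrow> 0 < N \<longrightarrow>
           scheme_solution D f M Fl W Vh (T / real N) N u0 v0 U V \<longrightarrow>
           (\<forall>n\<le>N.
              integrable M (\<lambda>\<omega>. energy D F C1 (U n \<omega>) (V n \<omega>)) \<and>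
              (LINT \<omega>|M. energy D F C1 (U n \<omega>) (V n \<omega>)) =
                (LINT \<omega>|M. energy D F C1 (U 0 \<omega>) (V 0 \<omega>)) +
                1/2 * trace_op (L2_on D) (\<lambda>u. P_h Vh (inner (Q (P_h Vh (inner u)))))
                    * (real n * (T / real N)))"
proof (intro exI[of _ 4] allI impI)
  fix p0 :: nat and u0 v0 :: "'w \<Rightarrow> 'a l2" and Vh and N :: nat and U V n
  assume p0: "4 \<le> p0" and init: "initial_value D M (Fl 0) \<gamma> p0 u0 v0"
    and Vh: "discrete_space D Vh" and N: "0 < N"
    and sol: "scheme_solution D f M Fl W Vh (T / real N) N u0 v0 U V" and n: "n \<le> N"
  have D: "open D" "bounded D" using domain by (auto simp: convex_polygonal_domain_def)
  obtain R where R: "R > 0" "D \<subseteq> cball 0 R" using D(2) unfolding bounded_pos by (auto simp: subset_iff)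
  obtain E where E: "discrete_eigenbasis D E" and VE: "Vh = span E"
    using discrete_space_eigenbasis[OF dim D Vh] by blast
  interpret discrete_eigenbasis D E by (rule E)
  interpret galerkin_scheme D E f F M T Fl Q W
  proof -
    interpret prob_space M by (rule prob)
    show "galerkin_scheme D E f F M T Fl Q W"
      by unfold_locales (use f_assm filtr Q_psd Wiener in \<open>auto simp: nonlinearity_def\<close>)
  qed
  have C1_bound: "0 \<le> F_int w + C1" if "w \<in> span E" for w
    using F_int_lower_bound[OF f_assm C1 that] .
  define \<tau> where "\<tau> = T / real N"
  have \<tau>: "\<tau> > 0" "real k * \<tau> \<le> T" if "k \<le> N" for k
    using T_pos N that mult_right_mono[of "real k" "real N" T] by (auto simp: \<tau>_def field_simps)
  have U_meas: "U k \<in> borel_measurable M" "V k \<in> borel_measurable M"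
    and UV_span: "\<And>\<omega>. \<omega> \<in> space M \<Longrightarrow> U k \<omega> \<in> span E \<and> V k \<omega> \<in> span E" if "k \<le> N" for k
    using sol that by (auto simp: scheme_solution_def VE)
  \<comment> \<open>The scheme holds almost surely, and \<open>V k\<close> is only known to be measurable for the full
    \<open>\<sigma>\<close>-algebra; the induction therefore carries versions \<open>u\<close>, \<open>v\<close> adapted to the filtration.\<close>
  have claim: "\<exists>u v. coord_measurable (Fl (real k * \<tau>)) u \<and> coord_measurable (Fl (real k * \<tau>)) v \<and>
      (\<forall>\<omega>\<in>space M. u \<omega> \<in> span E \<and> v \<omega> \<in> span E) \<and> (AE \<omega> in M. U k \<omega> = u \<omega> \<and> V k \<omega> = v \<omega>) \<and>
      integrable M (\<lambda>\<omega>. energy D F C1 (u \<omega>) (v \<omega>)) \<and>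
      (LINT \<omega>|M. energy D F C1 (u \<omega>) (v \<omega>))
        = (LINT \<omega>|M. energy D F C1 (U 0 \<omega>) (V 0 \<omega>)) + 1/2 * noise_trace * (real k * \<tau>)" if "k \<le> N" for k
    using that
  proof (induction k)
    case 0
    let ?u = "\<lambda>\<omega>. P_h (span E) (inner (u0 \<omega>))" and ?v = "\<lambda>\<omega>. P_h (span E) (inner (v0 \<omega>))"
    note ini = initial_energy_integrable[OF R(2,1) gamma(1) p0 T_pos init]
    have ae: "AE \<omega> in M. U 0 \<omega> = ?u \<omega> \<and> V 0 \<omega> = ?v \<omega>"
      using sol by (simp add: scheme_solution_def VE)
    have "(LINT \<omega>|M. energy D F C1 (U 0 \<omega>) (V 0 \<omega>)) = (LINT \<omega>|M. energy D F C1 (?u \<omega>) (?v \<omega>))"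
    proof (rule integral_cong_AE)
      show "(\<lambda>\<omega>. energy D F C1 (U 0 \<omega>) (V 0 \<omega>)) \<in> borel_measurable M"
        using U_meas[of 0] UV_span[of 0] by (intro energy_measurable coord_measurableI) auto
      show "(\<lambda>\<omega>. energy D F C1 (?u \<omega>) (?v \<omega>)) \<in> borel_measurable M"
        using ini(5) by (rule borel_measurable_integrable)
      show "AE \<omega> in M. energy D F C1 (U 0 \<omega>) (V 0 \<omega>) = energy D F C1 (?u \<omega>) (?v \<omega>)"
        using ae by eventually_elim simp
    qed
    then show ?case
      using ini ae by (intro exI[of _ ?u] exI[of _ ?v]) simp
  next
    case (Suc k)
    then have k: "k < N" "k \<le> N" by auto
    define s t where "s = real k * \<tau>" and "t = real (Suc k) * \<tau>"
    have st: "0 \<le> s" "s < t" "t \<le> T" "t - s = \<tau>"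
      using \<tau>[OF Suc.prems] by (auto simp: s_def t_def algebra_simps)
    obtain u v where u: "coord_measurable (Fl s) u" and v: "coord_measurable (Fl s) v"
      and uv: "\<And>\<omega>. \<omega> \<in> space M \<Longrightarrow> u \<omega> \<in> span E \<and> v \<omega> \<in> span E"
      and ae: "AE \<omega> in M. U k \<omega> = u \<omega> \<and> V k \<omega> = v \<omega>"
      and int: "integrable M (\<lambda>\<omega>. energy D F C1 (u \<omega>) (v \<omega>))"
      and lint: "(LINT \<omega>|M. energy D F C1 (u \<omega>) (v \<omega>))
        = (LINT \<omega>|M. energy D F C1 (U 0 \<omega>) (V 0 \<omega>)) + 1/2 * noise_trace * s"
      using Suc.IH[OF k(2)] unfolding s_def[symmetric] by blast
    have u': "coord_measurable (Fl s) (U (Suc k))"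
      using sol k by (intro coord_measurableI) (simp add: scheme_solution_def s_def \<tau>_def)
    \<comment> \<open>The next \<open>U\<close> is known at the old time, so the noise-free part of the next \<open>V\<close> is independent
      of the new increment.\<close>
    let ?G = "\<lambda>\<omega>. avf_term D f (span E) (u \<omega>) (U (Suc k) \<omega>)"
    let ?v' = "\<lambda>\<omega>. step_V \<tau> (u \<omega>) (v \<omega>) (?G \<omega>) + noise s t \<omega>"
    have scheme: "AE \<omega> in M. U (Suc k) \<omega> = step_U \<tau> (U k \<omega>) (V k \<omega>) (avf_term D f (span E) (U k \<omega>) (U (Suc k) \<omega>))
        \<and> V (Suc k) \<omega> = step_V \<tau> (U k \<omega>) (V k \<omega>) (avf_term D f (span E) (U k \<omega>) (U (Suc k) \<omega>)) + noise s t \<omega>"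
      using sol k(1) unfolding scheme_solution_def Let_def step_U_def step_V_def noise_def VE s_def t_def \<tau>_def
      by blast
    have ae_U: "AE \<omega> in M. U (Suc k) \<omega> = step_U \<tau> (u \<omega>) (v \<omega>) (?G \<omega>)"
      using scheme ae by eventually_elim simp
    have ae_V: "AE \<omega> in M. U (Suc k) \<omega> = U (Suc k) \<omega> \<and> V (Suc k) \<omega> = ?v' \<omega>"
      using scheme ae by eventually_elim simp
    note step = noisy_step_energy[OF st(1-3) u _ v _ u' _ ae_U C1_bound int]
    have step': "coord_measurable (Fl t) ?v'" "\<And>\<omega>. \<omega> \<in> space M \<Longrightarrow> ?v' \<omega> \<in> span E"
      "integrable M (\<lambda>\<omega>. energy D F C1 (U (Suc k) \<omega>) (?v' \<omega>))"
      "(LINT \<omega>|M. energy D F C1 (U (Suc k) \<omega>) (?v' \<omega>))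
        = (LINT \<omega>|M. energy D F C1 (u \<omega>) (v \<omega>)) + 1/2 * noise_trace * (t - s)"
      using step uv UV_span[OF Suc.prems] by auto
    show ?case
      unfolding t_def[symmetric]
    proof (rule exI[of _ "U (Suc k)"], rule exI[of _ ?v'], intro conjI)
      show "coord_measurable (Fl t) (U (Suc k))"
        using st by (intro coord_measurable_subalg[OF subalg_mono u']) auto
      show "\<forall>\<omega>\<in>space M. U (Suc k) \<omega> \<in> span E \<and> ?v' \<omega> \<in> span E"
        using step'(2) UV_span[OF Suc.prems] by simp
      show "(LINT \<omega>|M. energy D F C1 (U (Suc k) \<omega>) (?v' \<omega>))
          = (LINT \<omega>|M. energy D F C1 (U 0 \<omega>) (V 0 \<omega>)) + 1/2 * noise_trace * t"
        unfolding step'(4) lint by (simp add: field_simps)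
    qed (fact step'(1) ae_V step'(3))+
  qed
  obtain u v where ae: "AE \<omega> in M. U n \<omega> = u \<omega> \<and> V n \<omega> = v \<omega>"
    and int: "integrable M (\<lambda>\<omega>. energy D F C1 (u \<omega>) (v \<omega>))"
    and lint: "(LINT \<omega>|M. energy D F C1 (u \<omega>) (v \<omega>))
      = (LINT \<omega>|M. energy D F C1 (U 0 \<omega>) (V 0 \<omega>)) + 1/2 * noise_trace * (real n * \<tau>)"
    using claim[OF n] by blast
  have meas: "(\<lambda>\<omega>. energy D F C1 (U n \<omega>) (V n \<omega>)) \<in> borel_measurable M"
    using U_meas[OF n] UV_span[OF n] by (intro energy_measurable coord_measurableI) auto
  have ae_energy: "AE \<omega> in M. energy D F C1 (U n \<omega>) (V n \<omega>) = energy D F C1 (u \<omega>) (v \<omega>)"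
    using ae by eventually_elim simp
  note cong = integrable_cong_AE[OF meas borel_measurable_integrable[OF int] ae_energy]
    integral_cong_AE[OF meas borel_measurable_integrable[OF int] ae_energy]
  have "\<exists>B. onb (L2_on D) B"
    using Q_reg by (auto simp: noise_regularity_def hilbert_schmidt_def)
  from trace_eq_noise_trace[OF this]
  show "integrable M (\<lambda>\<omega>. energy D F C1 (U n \<omega>) (V n \<omega>)) \<and>
      (LINT \<omega>|M. energy D F C1 (U n \<omega>) (V n \<omega>)) =
        (LINT \<omega>|M. energy D F C1 (U 0 \<omega>) (V 0 \<omega>)) +
        1/2 * trace_op (L2_on D) (\<lambda>u. P_h Vh (inner (Q (P_h Vh (inner u)))))
            * (real n * (T / real N))"
    using cong int lint unfolding VE \<tau>_def by simp
qed

end
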